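(* Let $f:[0,\infty)\to[0,\infty)$ satisfy $f(t)\le c/(1+t^2)$ for all $t$ (some constant $c$) and have finite total variation $\int_0^\infty|df|<\infty$. Fix an integer $k\ge0$. Then as $\lambda\to\infty$, $$\mathbb P\big(N(\lambda)\le k\big)=\exp\Big(-\lambda^2\big(\|f\|_2^2/8+o(1)\big)\Big),$$ where $N(\lambda)$ is the number of points in $[0,\lambda]$ of the point process given by the Brownian carousel with parameter $f$. In particular, for $\operatorname{Sine}_\beta$ (where $f(t)=(\beta/4)e^{-\beta t/4}$), $\mathbb P(\#\text{points in }[0,\lambda]\le k)=\exp(-\lambda^2(\beta/64+o(1)))$.
   Context: Brownian carousel with parameter $f$: let $Z$ be a complex Brownian motion (independent standard real and imaginary parts) and for $\lambda\in\mathbb R$ let $\alpha_\lambda$ solve $d\alpha_\lambda=\lambda f(t)dt+\Re((e^{-i\alpha_\lambda}-1)dZ)$, $\alpha_\lambda(0)=0$. The limit $\lim_{t\to\infty}\alpha_\lambda(t)/(2\pi)$ exists a.s. and is an integer; $N(\lambda)$ is its right-continuous version in $\lambda$, the counting function of a point process ($N(\lambda)=\#$ points in $(0,\lambda]$ for $\lambda\ge0$). Equivalently, for each fixed $\lambda$, $N(\lambda)$ has the law of $\alpha(\infty)/(2\pi)$ where $d\alpha=\lambda f dt+2\sin(\alpha/2)dW$, $\alpha(0)=0$, $W$ a real Brownian motion. *)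

theory Defs
  imports "HOL-Probability.Probability"
begin

definition finite_total_variation_nonneg :: "(real \<Rightarrow> real) \<Rightarrow> bool" where
  "finite_total_variation_nonneg f \<longleftrightarrow>
     (\<exists>B. \<forall>(n::nat) (t::nat \<Rightarrow> real). t 0 \<ge> 0 \<and> (\<forall>i<n. t i \<le> t (Suc i)) \<longrightarrow>
        (\<Sum>i<n. \<bar>f (t (Suc i)) - f (t i)\<bar>) \<le> B)"

definition is_filtration :: "'a measure \<Rightarrow> (real \<Rightarrow> 'a measure) \<Rightarrow> bool" where
  "is_filtration M F \<longleftrightarrow>
     (\<forall>t. subalgebra M (F t)) \<and> (\<forall>s t. 0 \<le> s \<longrightarrow> s \<le> t \<longrightarrow> sets (F s) \<subseteq> sets (F t))"

definition is_martingale :: "'a measure \<Rightarrow> (real \<Rightarrow> 'a measure) \<Rightarrow> (real \<Rightarrow> 'a \<Rightarrow> real) \<Rightarrow> bool" where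
  "is_martingale M F Y \<longleftrightarrow>
     (\<forall>t\<ge>0. Y t \<in> borel_measurable (F t) \<and> integrable M (Y t)) \<and>
     (\<forall>s t A. 0 \<le> s \<longrightarrow> s \<le> t \<longrightarrow> A \<in> sets (F s) \<longrightarrow>
        (\<integral>\<omega>. indicator A \<omega> * Y t \<omega> \<partial>M) = (\<integral>\<omega>. indicator A \<omega> * Y s \<omega> \<partial>M))"

definition C2b :: "(real \<Rightarrow> real) \<Rightarrow> bool" where
  "C2b g \<longleftrightarrow> (\<forall>x. g differentiable at x) \<and> (\<forall>x. deriv g differentiable at x)
     \<and> continuous_on UNIV (deriv (deriv g))
     \<and> bounded (range g) \<and> bounded (range (deriv g)) \<and> bounded (range (deriv (deriv g)))"

text \<open>(M, F, alpha) is a (weak) solution of the SDE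
   d alpha = lambda f(t) dt + 2 sin(alpha/2) dW,  alpha(0) = 0,
  formulated as a solution of the associated (time-inhomogeneous) martingale problem:
  continuous adapted paths started at 0 such that for every test function g,
  g(alpha_t) - int_0^t (lambda f(s) g'(alpha_s) + 2 sin(alpha_s/2)^2 g''(alpha_s)) ds
  is a martingale. (Generator: drift lambda f, diffusion coefficient (2 sin(a/2))^2.)\<close>
definition carousel_sde_solution ::
  "(real \<Rightarrow> real) \<Rightarrow> real \<Rightarrow> 'a measure \<Rightarrow> (real \<Rightarrow> 'a measure) \<Rightarrow> (real \<Rightarrow> 'a \<Rightarrow> real) \<Rightarrow> bool" where
  "carousel_sde_solution f lam M F alpha \<longleftrightarrow>
     prob_space M \<and> is_filtration M F \<and>
     (\<forall>t\<ge>0. alpha t \<in> borel_measurable (F t)) \<and>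
     (\<forall>\<omega>\<in>space M. alpha 0 \<omega> = 0 \<and> continuous_on {0..} (\<lambda>t. alpha t \<omega>)) \<and>
     (\<forall>g. C2b g \<longrightarrow> is_martingale M F (\<lambda>t \<omega>. g (alpha t \<omega>) -
         (LBINT s:{0..t}. lam * f s * deriv g (alpha s \<omega>)
                          + 2 * (sin (alpha s \<omega> / 2))^2 * deriv (deriv g) (alpha s \<omega>))))"

definition carousel_count :: "(real \<Rightarrow> 'a \<Rightarrow> real) \<Rightarrow> 'a \<Rightarrow> real" where
  "carousel_count alpha \<omega> = Lim at_top (\<lambda>t. alpha t \<omega>) / (2 * pi)"

end

theory Submission
  imports Defs
begin

text \<open>
  The law of the count is only accessible through the martingale problem, so everything is done with
  explicit test functions \<open>g\<close>: Fubini turns the martingale property into a Dynkin formula, and a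
  differential inequality for the generator \<open>L g = \<lambda> f g' + 2 sin\<^sup>2(x/2) g''\<close> integrates, by
  Gronwall, to a bound for \<open>E g(\<alpha>\<^sub>t)\<close>. In the coordinate \<open>tan(x/4)\<close> the cheapest way of not passing
  \<open>2 \<pi>\<close> is to stay at the value 1, which costs \<open>\<lambda>\<^sup>2 f\<^sup>2 / 8\<close> per unit of time. Both
  bounds have this rate: \<open>exp(- \<lambda> a x / 4)\<close> is a supersolution when \<open>a \<le> f\<close>, since
  \<open>- a\<^sup>2 / 4 + (a\<^sup>2 / 8) sin\<^sup>2(x/2) \<le> - a\<^sup>2 / 8\<close>, and
  \<open>exp(- (\<lambda> b / 2) tan(x/4))\<close> is a subsolution up to terms linear in \<open>\<lambda>\<close> when \<open>f \<le> b\<close>. Cubic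
  factors make them vanish twice differentiably at a multiple of \<open>2 \<pi>\<close>, respectively before \<open>2 \<pi>\<close>.
  Since \<open>f\<close> has bounded variation, step functions of mesh about \<open>1 / \<lambda>\<close> up to a time of order \<open>\<lambda>\<close>
  suffice, and all errors in the exponent are \<open>O(\<lambda>)\<close>.
\<close>

section \<open>Twice differentiable test functions\<close>

text \<open>The coordinate v = log tan(\<alpha>/4) has unit noise and, up to a bounded Ito term, the
  drift (lam f/2) cosh v. This is least at v = 0, and cancelling a drift lam f/2 against unit noise
  costs half its square: hence the point 1 and the rate. The exponents come from optimising. On
  exp(-\<theta> x) the generator acts with rate at most -lam a \<theta> + 2 \<theta>^2, least at
  \<theta> = lam a/4. On exp(-\<theta> y), y = tan(x/4), its leading part is -lam b \<theta> (1 +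
  y^2)/4 + \<theta>^2 y^2/2, and \<theta> = lam b/2 is the value for which y drops out. The obstacle
  is that the count is a limit at infinity, whose existence is not part of the martingale problem,
  while test functions see finite times T. Convergence comes from |sin(\<alpha>/2)| being a
  supermartingale up to a finite drift, with a strict loss away from its zeros. For the upper bound,
  a completed turn is never undone. For the lower bound, the drift still to come after T is at most
  lam c/T in total, so T must be a large multiple of lam; such a horizon turns a bounded error per
  unit of time into O(lam).\<close>

lemma has_real_derivative_glue:
  fixes a :: real
  assumes l: "\<And>x. x \<in> S \<Longrightarrow> x \<le> a \<Longrightarrow> (l has_real_derivative l' x) (at x within S \<inter> {..a})"
    and r: "\<And>x. x \<in> S \<Longrightarrow> a \<le> x \<Longrightarrow> (r has_real_derivative r' x) (at x within S \<inter> {a..})"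
    and eq: "l a = r a" "l' a = r' a" and x: "x \<in> S"
  shows "((\<lambda>x. if x \<le> a then l x else r x) has_real_derivative (if x \<le> a then l' x else r' x)) (at x within S)"
    (is "(?g has_real_derivative _) _")
proof -
  consider "x < a" | "x = a" | "a < x" by linarith
  then show ?thesis
  proof cases
    case 1
    have "at x within S = at x within S \<inter> {..a}"
      by (rule at_within_nhd[of _ "{..<a}"]) (use 1 in auto)
    moreover have "(?g has_real_derivative l' x) (at x within S \<inter> {..a})"
      by (rule has_field_derivative_transform_within[OF l, of _ 1]) (use 1 x in auto)
    ultimately show ?thesis using 1 by simp
  next
    case 3
    have "at x within S = at x within S \<inter> {a..}"
      by (rule at_within_nhd[of _ "{a<..}"]) (use 3 in auto)
    moreover have "(?g has_real_derivative r' x) (at x within S \<inter> {a..})"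
      by (rule has_field_derivative_transform_within[OF r, of _ 1]) (use 3 x eq in auto)
    ultimately show ?thesis using 3 by simp
  next
    case 2
    have "(?g has_real_derivative l' x) (at x within S \<inter> {..a})"
      by (rule has_field_derivative_transform_within[OF l, of _ 1]) (use 2 x in auto)
    moreover have "(?g has_real_derivative r' x) (at x within S \<inter> {a..})"
      by (rule has_field_derivative_transform_within[OF r, of _ 1]) (use 2 x eq in auto)
    \<comment> \<open>At the joint the two one-sided difference quotients have the common limit
      \<open>l' a = r' a\<close>, and the limit within a union is the conjunction of the limits
      within its parts.\<close>
    ultimately have "(?g has_real_derivative l' x) (at x within (S \<inter> {..a}) \<union> (S \<inter> {a..}))"
      unfolding has_field_derivative_iff Lim_within_Un using 2 eq by simp
    moreover have "(S \<inter> {..a}) \<union> (S \<inter> {a..}) = S" by auto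
    ultimately show ?thesis using 2 by simp
  qed
qed

lemma C2b_intro:
  assumes "\<And>x. (g has_real_derivative g1 x) (at x)" "\<And>x. (g1 has_real_derivative g2 x) (at x)"
    and "continuous_on UNIV g2" "bounded (range g)" "bounded (range g1)" "bounded (range g2)"
  shows "C2b g" "deriv g = g1" "deriv (deriv g) = g2"
proof -
  show 1: "deriv g = g1" using assms(1) DERIV_imp_deriv by blast
  show 2: "deriv (deriv g) = g2" unfolding 1 using assms(2) DERIV_imp_deriv by blast
  show "C2b g" unfolding C2b_def 2 unfolding 1
    using assms by (auto simp: real_differentiable_def)
qed

lemma continuous_on_glue:
  fixes l r :: "real \<Rightarrow> real"
  assumes "continuous_on {..a} l" "continuous_on {a..b} r" "l a = r a" "a \<le> b"
  shows "continuous_on {..b} (\<lambda>x. if x \<le> a then l x else r x)"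
proof -
  have "{..b} = {..a} \<union> {a..b}" using assms by auto
  moreover have "continuous_on ({..a} \<union> {a..b}) (\<lambda>x. if x \<le> a then l x else r x)"
    by (rule continuous_on_If) (use assms in auto)
  ultimately show ?thesis by simp
qed

lemma continuous_on_glue_UNIV:
  fixes l r :: "real \<Rightarrow> real"
  assumes "continuous_on {..a} l" "continuous_on {a..} r" "l a = r a"
  shows "continuous_on UNIV (\<lambda>x. if x \<le> a then l x else r x)"
proof -
  have "UNIV = {..a} \<union> {a..}" by auto
  moreover have "continuous_on ({..a} \<union> {a..}) (\<lambda>x. if x \<le> a then l x else r x)"
    by (rule continuous_on_If) (use assms in auto)
  ultimately show ?thesis by simp
qed

text \<open>\<open>sin (x - a)\<close> and \<open>1 - cos (x - a)\<close> stand in for x - a and (x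
  - a)^2/2, so \<open>p\<close>, \<open>q\<close>, \<open>r\<close> are the value and the first two
  derivatives at \<open>a\<close>.\<close>

lemma trig_taylor:
  fixes a p q r :: real
  defines "T0 \<equiv> \<lambda>x. p + q * sin (x - a) + r * (1 - cos (x - a))"
    and "T1 \<equiv> \<lambda>x. q * cos (x - a) + r * sin (x - a)"
    and "T2 \<equiv> \<lambda>x. - q * sin (x - a) + r * cos (x - a)"
  shows "(T0 has_real_derivative T1 x) (at x within S)" "(T1 has_real_derivative T2 x) (at x within S)"
    "continuous_on S T2" "bounded (T0 ` S)" "bounded (T1 ` S)" "bounded (T2 ` S)"
proof -
  show "(T0 has_real_derivative T1 x) (at x within S)" "(T1 has_real_derivative T2 x) (at x within S)"
    unfolding T0_def T1_def T2_def by (auto intro!: derivative_eq_intros)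
  show "continuous_on S T2" unfolding T2_def by (intro continuous_intros)
  have bd: "bounded ((\<lambda>x. k * sin (x - a)) ` S)" "bounded ((\<lambda>x. k * cos (x - a)) ` S)" for k
    by (auto intro!: boundedI[of _ "\<bar>k\<bar>"] simp: abs_mult mult_left_le)
  have T: "T0 = (\<lambda>x. (p + r) + q * sin (x - a) + (- r) * cos (x - a))"
    unfolding T0_def by (auto simp: algebra_simps)
  show "bounded (T0 ` S)" unfolding T
    by (intro bounded_plus_comp bd) (auto intro: boundedI[of _ "\<bar>p\<bar>"] boundedI[of _ "\<bar>r\<bar>"])
  show "bounded (T1 ` S)" unfolding T1_def by (intro bounded_plus_comp bd)
  show "bounded (T2 ` S)" unfolding T2_def by (intro bounded_plus_comp bd)
qed

text \<open>Trigonometric Taylor polynomials keep the extension bounded, which polynomial ones would not.\<close>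
lemma C2b_extension:
  fixes p p1 p2 :: "real \<Rightarrow> real"
  assumes ab: "a \<le> b"
    and d1: "\<And>x. x \<in> {a..b} \<Longrightarrow> (p has_real_derivative p1 x) (at x within {a..b})"
    and d2: "\<And>x. x \<in> {a..b} \<Longrightarrow> (p1 has_real_derivative p2 x) (at x within {a..b})"
    and c: "continuous_on {a..b} p2"
  obtains g where "C2b g" "\<And>x. x \<in> {a..b} \<Longrightarrow> g x = p x" "\<And>x. x \<in> {a..b} \<Longrightarrow> deriv g x = p1 x"
    "\<And>x. x \<in> {a..b} \<Longrightarrow> deriv (deriv g) x = p2 x"
    "\<And>x. p b = 0 \<Longrightarrow> p1 b = 0 \<Longrightarrow> p2 b = 0 \<Longrightarrow> b \<le> x \<Longrightarrow> g x = 0 \<and> deriv g x = 0 \<and> deriv (deriv g) x = 0"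
proof -
  define T0 where "T0 = (\<lambda>e x. p e + p1 e * sin (x - e) + p2 e * (1 - cos (x - e)))"
  define T1 where "T1 = (\<lambda>e x. p1 e * cos (x - e) + p2 e * sin (x - e))"
  define T2 where "T2 = (\<lambda>e x. - p1 e * sin (x - e) + p2 e * cos (x - e))"
  note T = T0_def T1_def T2_def
  have tt: "(T0 e has_real_derivative T1 e x) (at x within S)" "(T1 e has_real_derivative T2 e x) (at x within S)"
    "continuous_on S (T2 e)" "bounded (T0 e ` S)" "bounded (T1 e ` S)" "bounded (T2 e ` S)" for e x S
    unfolding T by (rule trig_taylor)+
  define h where "h = (\<lambda>x. if x \<le> a then T0 a x else p x)"
  define h1 where "h1 = (\<lambda>x. if x \<le> a then T1 a x else p1 x)"
  define h2 where "h2 = (\<lambda>x. if x \<le> a then T2 a x else p2 x)"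
  define g where "g = (\<lambda>x. if x \<le> b then h x else T0 b x)"
  define g1 where "g1 = (\<lambda>x. if x \<le> b then h1 x else T1 b x)"
  define g2 where "g2 = (\<lambda>x. if x \<le> b then h2 x else T2 b x)"
  have I: "{..b} \<inter> {a..} = {a..b}" "{..b} \<inter> {..a} = {..a}" "UNIV \<inter> S = S" for S :: "real set" using ab by auto
  have e: "T0 e e = p e" "T1 e e = p1 e" "T2 e e = p2 e" for e by (auto simp: T)
  have hb: "h b = p b" "h1 b = p1 b" "h2 b = p2 b" "h a = p a"
    using ab by (auto simp: h_def h1_def h2_def e)
  \<comment> \<open>\<open>p\<close> has only a one-sided derivative at \<open>b\<close>, so the
    left joint is treated within \<open>{..b}\<close>; the second gluing, on the whole line, removes
    the restriction.\<close>
  have h: "(h has_real_derivative h1 x) (at x within {..b})" "(h1 has_real_derivative h2 x) (at x within {..b})" if "x \<le> b" for x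
    unfolding h_def h1_def h2_def
    by (rule has_real_derivative_glue; use that tt d1 d2 in \<open>auto simp: I e\<close>)+
  have g: "(g has_real_derivative g1 x) (at x)" "(g1 has_real_derivative g2 x) (at x)" for x
    unfolding g_def g1_def g2_def
    by (rule has_real_derivative_glue[where S=UNIV]; use tt h in \<open>auto simp: I e hb\<close>)+
  have "continuous_on {..b} h2" unfolding h2_def by (rule continuous_on_glue) (use tt c ab in \<open>auto simp: e\<close>)
  then have c2: "continuous_on UNIV g2" unfolding g2_def by (rule continuous_on_glue_UNIV) (use tt in \<open>auto simp: e hb\<close>)
  have cp: "continuous_on {a..b} p" "continuous_on {a..b} p1"
    using DERIV_continuous_on[OF d1] DERIV_continuous_on[OF d2] by auto
  have B: "bounded (p ` {a..b})" "bounded (p1 ` {a..b})" "bounded (p2 ` {a..b})"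
    using cp c by (auto intro!: compact_imp_bounded compact_continuous_image)
  have bb: "bounded (range (\<lambda>x. if x \<le> b then if x \<le> a then L x else P x else R x))"
    if "bounded (range L)" "bounded (P ` {a..b})" "bounded (range R)" for L P R :: "real \<Rightarrow> real"
  proof -
    have "range (\<lambda>x. if x \<le> b then if x \<le> a then L x else P x else R x) \<subseteq> range L \<union> (P ` {a..b} \<union> range R)" by auto
    then show ?thesis using that by (meson bounded_Un bounded_subset)
  qed
  have bd: "bounded (range g)" "bounded (range g1)" "bounded (range g2)"
    unfolding g_def g1_def g2_def h_def h1_def h2_def by (intro bb tt B)+
  note C = C2b_intro[OF g c2 bd]
  have on: "g x = p x" "g1 x = p1 x" "g2 x = p2 x" if "x \<in> {a..b}" for x
    using that e[of a] unfolding g_def g1_def g2_def h_def h1_def h2_def by (auto dest: antisym)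
  show thesis
  proof (rule that[of g])
    \<comment> \<open>If \<open>p\<close> and its first two derivatives vanish at \<open>b\<close>,
      the right-hand piece \<open>T0 b\<close> is identically zero. This is how test functions
      supported to the left of a level arise.\<close>
    fix x assume z: "p b = 0" "p1 b = 0" "p2 b = 0" "b \<le> x"
    show "g x = 0 \<and> deriv g x = 0 \<and> deriv (deriv g) x = 0"
    proof (cases "x = b")
      case True then show ?thesis using on[of b] z ab C(2,3) by simp
    next
      case False then show ?thesis using z C(2,3) by (simp add: g_def g1_def g2_def T)
    qed
  qed (use C on in auto)
qed

lemma C2b_continuous:
  assumes "C2b g"
  shows "continuous_on UNIV g" "continuous_on UNIV (deriv g)" "continuous_on UNIV (deriv (deriv g))"
  using assms unfolding C2b_def
  by (auto intro: continuous_at_imp_continuous_on differentiable_imp_continuous_within)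

lemma C2b_borel:
  assumes "C2b g"
  shows "g \<in> borel_measurable borel" "deriv g \<in> borel_measurable borel" "deriv (deriv g) \<in> borel_measurable borel"
  using C2b_continuous[OF assms] by (auto intro: borel_measurable_continuous_onI)

lemma C2b_bounded: "C2b g \<Longrightarrow> \<exists>K. \<forall>x. \<bar>g x\<bar> \<le> K"
  by (auto simp: C2b_def bounded_iff)

lemma C2b_uminus:
  assumes "C2b g"
  shows "C2b (\<lambda>x. - g x)" "deriv (\<lambda>x. - g x) = (\<lambda>x. - deriv g x)" "deriv (deriv (\<lambda>x. - g x)) = (\<lambda>x. - deriv (deriv g) x)"
proof -
  have d: "(g has_real_derivative deriv g x) (at x)" "(deriv g has_real_derivative deriv (deriv g) x) (at x)" for x
    using assms by (auto simp: C2b_def DERIV_deriv_iff_real_differentiable)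
  have b: "bounded (range g)" "bounded (range (deriv g))" "bounded (range (deriv (deriv g)))"
    "continuous_on UNIV (deriv (deriv g))"
    using assms by (auto simp: C2b_def)
  have m: "bounded (range (\<lambda>x. - h x))" if "bounded (range h)" for h :: "real \<Rightarrow> real"
    using that unfolding bounded_iff by simp
  note C = C2b_intro[OF DERIV_minus[OF d(1)] DERIV_minus[OF d(2)]]
  show "C2b (\<lambda>x. - g x)" "deriv (\<lambda>x. - g x) = (\<lambda>x. - deriv g x)"
    "deriv (deriv (\<lambda>x. - g x)) = (\<lambda>x. - deriv (deriv g) x)"
    using m b by (auto intro!: C continuous_on_minus)
qed

lemma abs_arctan_le: "\<bar>arctan x\<bar> \<le> pi / 2"
  using arctan_bounded[of x] by linarith

text \<open>A bounded increasing function with slope at most 1, concave on the half line: on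
  nonnegative paths only the drift can increase its mean. It measures how likely a further turn is
  after a late time.\<close>

lemma arctan_C2b: "C2b arctan" "deriv arctan = (\<lambda>x. inverse (1 + x\<^sup>2))"
  "deriv (deriv arctan) = (\<lambda>x. - 2 * x / (1 + x\<^sup>2)\<^sup>2)"
proof -
  have p: "0 < 1 + x\<^sup>2" "1 + x\<^sup>2 \<noteq> 0" for x :: real using add_pos_nonneg[of 1 "x\<^sup>2"] by auto
  have d: "(arctan has_real_derivative inverse (1 + x\<^sup>2)) (at x)" for x by (rule DERIV_arctan)
  have d1: "((\<lambda>x. inverse (1 + x\<^sup>2)) has_real_derivative - 2 * x / (1 + x\<^sup>2)\<^sup>2) (at x)" for x :: real
    using p[of x] by (auto intro!: derivative_eq_intros simp: divide_inverse power2_eq_square)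
  have c: "continuous_on UNIV (\<lambda>x::real. - 2 * x / (1 + x\<^sup>2)\<^sup>2)"
    using p by (intro continuous_intros) auto
  have b0: "bounded (range arctan)"
    using abs_arctan_le by (intro boundedI[of _ "pi / 2"]) auto
  have b1: "bounded (range (\<lambda>x::real. inverse (1 + x\<^sup>2)))"
  proof -
    have "\<bar>inverse (1 + x\<^sup>2)\<bar> \<le> 1" for x :: real
      using p(1)[of x] by (subst abs_of_pos) (auto simp: inverse_le_1_iff)
    then show ?thesis by (intro boundedI[of _ 1]) auto
  qed
  have b2: "bounded (range (\<lambda>x::real. - 2 * x / (1 + x\<^sup>2)\<^sup>2))"
  proof -
    have "\<bar>- 2 * x / (1 + x\<^sup>2)\<^sup>2\<bar> \<le> 1" for x :: real
    proof -
      have "\<bar>- 2 * x\<bar> \<le> 1 + x\<^sup>2" using sum_squares_bound[of 1 "\<bar>x\<bar>"] by simp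
      also have "\<dots> \<le> (1 + x\<^sup>2)\<^sup>2" using mult_left_mono[of 1 "1 + x\<^sup>2" "1 + x\<^sup>2"] p[of x] by (simp add: power2_eq_square)
      finally show ?thesis using p[of x] by (simp add: abs_divide)
    qed
    then show ?thesis by (intro boundedI[of _ 1]) auto
  qed
  show "C2b arctan" "deriv arctan = (\<lambda>x. inverse (1 + x\<^sup>2))"
    "deriv (deriv arctan) = (\<lambda>x. - 2 * x / (1 + x\<^sup>2)\<^sup>2)"
    using C2b_intro[OF d d1 c b0 b1 b2] by auto
qed

section \<open>Gronwall, total variation and step envelopes\<close>

text \<open>\<open>G\<close> is only continuous, so the inequality is assumed in integrated form on
  every subinterval. It says that \<open>P = G + k * \<phi>\<close> is nonincreasing, where
  \<open>\<phi>\<close> is the primitive of \<open>G\<close>, and (exp(k u) \<phi>)' = exp(k u) P.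
  Both signs of \<open>k\<close> occur: growth at rate 3 near a level, decay at rate of order
  lam^2.\<close>

lemma gronwall_integral:
  fixes G :: "real \<Rightarrow> real"
  assumes st: "s \<le> t" and c: "continuous_on {s..t} G"
    and le: "\<And>u v. s \<le> u \<Longrightarrow> u \<le> v \<Longrightarrow> v \<le> t \<Longrightarrow> G v - G u \<le> - k * integral {u..v} G"
  shows "G t \<le> exp (- k * (t - s)) * G s"
proof -
  define \<phi> where "\<phi> = (\<lambda>u. integral {s..u} G)"
  define P where "P = (\<lambda>u. G u + k * \<phi> u)"
  have int: "G integrable_on {u..v}" if "s \<le> u" "v \<le> t" for u v
    using c that by (meson atLeastatMost_subset_iff continuous_on_subset integrable_continuous_real)
  have dP: "P v \<le> P u" if "s \<le> u" "u \<le> v" "v \<le> t" for u v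
  proof -
    have "\<phi> u + integral {u..v} G = \<phi> v" unfolding \<phi>_def
      by (rule Henstock_Kurzweil_Integration.integral_combine) (use that int in auto)
    then have "k * \<phi> v = k * \<phi> u + k * integral {u..v} G" by (simp flip: distrib_left)
    then show ?thesis using le[OF that] by (simp add: P_def)
  qed
  have d\<phi>: "(\<phi> has_real_derivative G u) (at u within {s..t})" if "u \<in> {s..t}" for u
    unfolding \<phi>_def by (rule integral_has_real_derivative[OF c that])
  have d: "((\<lambda>u. exp (k * u) * \<phi> u) has_real_derivative exp (k * u) * P u) (at u within {s..t})" if "u \<in> {s..t}" for u
    using d\<phi>[OF that] by (auto intro!: derivative_eq_intros simp: P_def algebra_simps)
  have I: "((\<lambda>u. exp (k * u) * P u) has_integral exp (k * t) * \<phi> t - exp (k * s) * \<phi> s) {s..t}"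
    by (rule fundamental_theorem_of_calculus[OF st]) (use d in \<open>simp add: has_real_derivative_iff_has_vector_derivative\<close>)
  have \<phi>s: "\<phi> s = 0" by (simp add: \<phi>_def)
  have E: "((\<lambda>u. k * exp (k * u)) has_integral exp (k * t) - exp (k * s)) {s..t}"
    by (rule fundamental_theorem_of_calculus[OF st])
      (auto intro!: derivative_eq_intros simp flip: has_real_derivative_iff_has_vector_derivative)
  have K: "((\<lambda>u. k * (exp (k * u) * P u)) has_integral k * (exp (k * t) * \<phi> t)) {s..t}"
    using has_integral_mult_right[OF I, of k] \<phi>s by simp
  have EP: "((\<lambda>u. (k * exp (k * u)) * p) has_integral (exp (k * t) - exp (k * s)) * p) {s..t}" for p
    by (rule has_integral_mult_left[OF E])
  \<comment> \<open>\<open>P u\<close> lies between \<open>P t\<close> and \<open>P s\<close>; the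
    sign of \<open>k\<close> decides which of the two bounds \<open>k * P u\<close> from
    below.\<close>
  have main: "exp (k * t) * G t \<le> exp (k * s) * P s"
  proof (cases "0 \<le> k")
    case True
    have "(exp (k * t) - exp (k * s)) * P t \<le> k * (exp (k * t) * \<phi> t)"
      by (rule has_integral_le[OF EP K]) (use dP True st in \<open>auto simp: mult.assoc intro!: mult_left_mono\<close>)
    then have "exp (k * t) * G t \<le> exp (k * s) * P t" by (simp add: P_def algebra_simps)
    also have "\<dots> \<le> exp (k * s) * P s" using dP[of s t] st by simp
    finally show ?thesis .
  next
    case False
    have "(exp (k * t) - exp (k * s)) * P s \<le> k * (exp (k * t) * \<phi> t)"
      by (rule has_integral_le[OF EP K]) (use dP False st in \<open>auto simp: mult.assoc intro!: mult_left_mono_neg\<close>)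
    moreover have "exp (k * t) * P t \<le> exp (k * t) * P s" using dP[of s t] st by simp
    ultimately show ?thesis by (simp add: P_def algebra_simps)
  qed
  have "G t = exp (- k * t) * (exp (k * t) * G t)" by (simp flip: mult.assoc exp_add)
  also have "\<dots> \<le> exp (- k * t) * (exp (k * s) * P s)" using main by simp
  also have "\<dots> = exp (- k * (t - s)) * G s" using \<phi>s
    by (simp add: P_def algebra_simps flip: exp_add mult.assoc)
  finally show ?thesis .
qed

section \<open>Functions of bounded variation and their step envelopes\<close>

lemma finite_total_variation_majorant:
  assumes "finite_total_variation_nonneg f"
  obtains V B where "\<And>t. 0 \<le> t \<Longrightarrow> 0 \<le> V t" "\<And>t. 0 \<le> t \<Longrightarrow> V t \<le> (B::real)"
    "\<And>s t. 0 \<le> s \<Longrightarrow> s \<le> t \<Longrightarrow> \<bar>f t - f s\<bar> \<le> V t - V s"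
proof -
  obtain B where B: "\<And>(n::nat) (t::nat \<Rightarrow> real). t 0 \<ge> 0 \<Longrightarrow> (\<forall>i<n. t i \<le> t (Suc i)) \<Longrightarrow>
        (\<Sum>i<n. \<bar>f (t (Suc i)) - f (t i)\<bar>) \<le> B"
    using assms unfolding finite_total_variation_nonneg_def by blast
  define S where "S = (\<lambda>T. {(\<Sum>i<n. \<bar>f (t (Suc i)) - f (t i)\<bar>) | (n::nat) (t::nat \<Rightarrow> real).
      t 0 \<ge> 0 \<and> (\<forall>i<n. t i \<le> t (Suc i)) \<and> t n \<le> T})"
  \<comment> \<open>The variation function: the supremum over partitions that end no later than
    \<open>T\<close>.\<close>
  define V where "V = (\<lambda>T. Sup (S T))"
  have SB: "x \<le> B" if "x \<in> S T" for x T using that B unfolding S_def by blast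
  have bdd: "bdd_above (S T)" for T using SB by (meson bdd_aboveI)
  have S0: "0 \<in> S T" if "0 \<le> T" for T
    unfolding S_def by (rule CollectI, rule exI[of _ 0], rule exI[of _ "\<lambda>_. 0"]) (use that in auto)
  have V: "0 \<le> V T" "V T \<le> B" if "0 \<le> T" for T
    unfolding V_def using cSup_upper[OF S0[OF that] bdd] cSup_least[of "S T" B] S0[OF that] SB by auto
  have step: "\<bar>f t - f s\<bar> + x \<le> V t" if st: "0 \<le> s" "s \<le> t" and xS: "x \<in> S s" for s t x
  proof -
    obtain n p where x: "x = (\<Sum>i<n. \<bar>f (p (Suc i)) - f (p i)\<bar>)"
      and p: "p 0 \<ge> 0" "\<forall>i<n. p i \<le> p (Suc i)" "p n \<le> s"
      using xS unfolding S_def by blast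
    \<comment> \<open>A partition ending before \<open>s\<close> is prolonged by the two points
      \<open>s\<close> and \<open>t\<close>. The interval up to \<open>s\<close> can only increase
      the sum, and the last one contributes exactly \<open>\<bar>f t - f s\<bar>\<close>.\<close>
    define q where "q = (\<lambda>i. if i \<le> n then p i else if i = Suc n then s else t)"
    have "x \<le> (\<Sum>i<Suc n. \<bar>f (q (Suc i)) - f (q i)\<bar>)"
      unfolding x by (auto simp: q_def intro!: order_trans[OF sum_mono[of "{..<n}"], of _ "\<lambda>i. \<bar>f (q (Suc i)) - f (q i)\<bar>"])
    moreover have "(\<Sum>i<Suc (Suc n). \<bar>f (q (Suc i)) - f (q i)\<bar>) \<in> S t"
      unfolding S_def by (rule CollectI, rule exI[of _ "Suc (Suc n)"], rule exI[of _ q])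
        (use p st in \<open>auto simp: q_def less_Suc_eq\<close>)
    moreover have "\<bar>f (q (Suc (Suc n))) - f (q (Suc n))\<bar> = \<bar>f t - f s\<bar>" by (simp add: q_def)
    ultimately show ?thesis using cSup_upper[OF _ bdd, of _ t] unfolding V_def by force
  qed
  have "\<bar>f t - f s\<bar> \<le> V t - V s" if "0 \<le> s" "s \<le> t" for s t
  proof -
    have "V s \<le> V t - \<bar>f t - f s\<bar>" unfolding V_def
      by (rule cSup_least) (use S0[OF that(1)] step[OF that] V_def in \<open>force+\<close>)
    then show ?thesis by simp
  qed
  with V show thesis by (rule that)
qed

text \<open>Jordan decomposition: on the half line f = (V + f) - V is a difference of monotone
  functions. The indicator is there because nothing is known about \<open>f\<close> at negative
  times.\<close>

lemma borel_measurable_of_variation_majorant: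
  fixes f V :: "real \<Rightarrow> real"
  assumes "\<And>s t. 0 \<le> s \<Longrightarrow> s \<le> t \<Longrightarrow> \<bar>f t - f s\<bar> \<le> V t - V s"
  shows "(\<lambda>t. indicator {0..} t * f t) \<in> borel_measurable borel"
proof -
  have "mono_on {0..} V" "mono_on {0..} (\<lambda>t. V t + f t)"
    using assms by (force simp: mono_on_def)+
  then have "V \<in> borel_measurable (restrict_space borel {0..})"
     "(\<lambda>t. V t + f t) \<in> borel_measurable (restrict_space borel {0..})"
    by (auto intro: borel_measurable_mono_on_fnc)
  then have "(\<lambda>t. (V t + f t) - V t) \<in> borel_measurable (restrict_space borel {0..})"
    by (rule borel_measurable_diff[rotated])
  then show ?thesis by (subst (asm) borel_measurable_restrict_space_iff) auto
qed

text \<open>pi/2 - arctan T = arctan(1/T). This is the integral of 1/(1 + u^2) beyond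
  \<open>T\<close>, hence, up to the factor lam c, a bound for the drift still to come.\<close>

lemma arctan_tail_le: "0 < T \<Longrightarrow> pi / 2 - arctan T \<le> 1 / T"
  using arctan_inverse[of T] arctan_le_self[of "1 / T"] by (simp add: sgn_if inverse_eq_divide)

lemma set_integral_inverse_1_plus_square:
  "set_integrable lborel {T..} (\<lambda>u::real. 1 / (1 + u\<^sup>2))"
  "(LBINT u:{T..}. 1 / (1 + u\<^sup>2)) = pi / 2 - arctan T"
proof -
  have p: "0 < 1 + u\<^sup>2" "1 + u\<^sup>2 \<noteq> 0" for u :: real using add_pos_nonneg[of 1 "u\<^sup>2"] by auto
  have "(\<integral>\<^sup>+u. ennreal (1 / (1 + u\<^sup>2)) * indicator {T..} u \<partial>lborel) = ennreal (pi / 2 - arctan T)"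
  proof (rule nn_integral_FTC_atLeast)
    show "(\<lambda>u::real. 1 / (1 + u\<^sup>2)) \<in> borel_measurable borel" by measurable
    show "(arctan has_real_derivative 1 / (1 + u\<^sup>2)) (at u)" for u :: real
      using DERIV_arctan[of u] by (simp add: divide_inverse)
    show "0 \<le> 1 / (1 + u\<^sup>2)" for u :: real using p(1)[of u] by simp
  qed (rule tendsto_arctan_at_top)
  moreover have "ennreal (indicator {T..} u * (1 / (1 + u\<^sup>2))) = ennreal (1 / (1 + u\<^sup>2)) * indicator {T..} u" for u :: real
    by (auto simp: indicator_def)
  ultimately have nn: "(\<integral>\<^sup>+u. ennreal (indicator {T..} u * (1 / (1 + u\<^sup>2))) \<partial>lborel) = ennreal (pi / 2 - arctan T)"
    by (simp only:)
  have nneg: "0 \<le> indicator {T..} u * (1 / (1 + u\<^sup>2))" for u :: real using p(1)[of u] by simp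
  have "has_bochner_integral lborel (\<lambda>u. indicator {T..} u * (1 / (1 + u\<^sup>2))) (pi / 2 - arctan T)"
    by (rule has_bochner_integral_nn_integral[OF _ _ _ nn]) (use nneg arctan_ubound[of T] in auto)
  then show "set_integrable lborel {T..} (\<lambda>u::real. 1 / (1 + u\<^sup>2))"
    "(LBINT u:{T..}. 1 / (1 + u\<^sup>2)) = pi / 2 - arctan T"
    unfolding set_integrable_def set_lebesgue_integral_def real_scaleR_def
    by (auto simp: has_bochner_integral_iff)
qed

lemma set_integral_grid:
  fixes F :: "real \<Rightarrow> real"
  assumes F: "set_integrable lborel {0..} F" and h: "0 \<le> h"
  shows "(LBINT u:{0..}. F u) = (\<Sum>i<n. LBINT u:{real i * h..<real (Suc i) * h}. F u) + (LBINT u:{real n * h..}. F u)"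
proof (induction n)
  case 0 then show ?case by simp
next
  case (Suc n)
  have le: "real n * h \<le> real (Suc n) * h" using h by (intro mult_right_mono) auto
  have 0: "0 \<le> real n * h" "0 \<le> real (Suc n) * h" using h by auto
  have "{real n * h..} = {real n * h..<real (Suc n) * h} \<union> {real (Suc n) * h..}" using le by auto
  moreover have "(LBINT u:{real n * h..<real (Suc n) * h} \<union> {real (Suc n) * h..}. F u)
      = (LBINT u:{real n * h..<real (Suc n) * h}. F u) + (LBINT u:{real (Suc n) * h..}. F u)"
    by (rule set_integral_Un) (use 0 in \<open>auto intro!: set_integrable_subset[OF F]\<close>)
  ultimately show ?case using Suc.IH by simp
qed

text \<open>On a cell \<open>f\<close> differs from its left value by at most the increase of
  \<open>V\<close> there, and these increases add up to at most \<open>B\<close>. Hence the errors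
  in the integrals over the cells are at most a multiple of \<open>B * h\<close>, however many cells
  there are; only the comparison from below has a tail, beyond the last cell.\<close>

lemma step_envelopes:
  fixes f V :: "real \<Rightarrow> real"
  assumes f_nonneg: "\<And>t. 0 \<le> t \<Longrightarrow> 0 \<le> f t" and f_bound: "\<And>t. 0 \<le> t \<Longrightarrow> f t \<le> c / (1 + t\<^sup>2)"
    and V: "\<And>t. 0 \<le> t \<Longrightarrow> 0 \<le> V t" "\<And>t. 0 \<le> t \<Longrightarrow> V t \<le> B"
      "\<And>s t. 0 \<le> s \<Longrightarrow> s \<le> t \<Longrightarrow> \<bar>f t - f s\<bar> \<le> V t - V s"
    and h: "0 < h"
  obtains a b :: "nat \<Rightarrow> real" where
    "\<And>i. 0 \<le> a i" "\<And>i. a i \<le> c" "\<And>i. 0 \<le> b i"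
    "\<And>i u. real i * h \<le> u \<Longrightarrow> u \<le> real (Suc i) * h \<Longrightarrow> a i \<le> f u"
    "\<And>i u. real i * h \<le> u \<Longrightarrow> u \<le> real (Suc i) * h \<Longrightarrow> f u \<le> b i"
    "\<And>n. (\<Sum>i<n. \<bar>a (Suc i) - a i\<bar>) \<le> 3 * B" "\<And>n. (\<Sum>i<n. \<bar>b (Suc i) - b i\<bar>) \<le> 3 * B"
    "\<And>n. (LBINT u:{0..}. (f u)\<^sup>2) \<le> (\<Sum>i<n. h * (a i)\<^sup>2) + 4 * c * B * h + c\<^sup>2 * (pi / 2 - arctan (real n * h))"
    "\<And>n. (\<Sum>i<n. h * (b i)\<^sup>2) \<le> (LBINT u:{0..}. (f u)\<^sup>2) + 2 * B * (2 * c + B) * h"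
    "\<And>n. (\<Sum>i<n. h * b i) \<le> c * pi / 2 + 2 * B * h"
proof -
  define d where "d = (\<lambda>i. V (real (Suc i) * h) - V (real i * h))"
  \<comment> \<open>The truncation at 0 keeps \<open>a i\<close> a nonnegative rate and remains
    below \<open>f\<close>.\<close>
  define a where "a = (\<lambda>i. max 0 (f (real i * h) - d i))"
  define b where "b = (\<lambda>i. f (real i * h) + d i)"
  have g0: "0 \<le> real i * h" for i :: nat using h by simp
  have gS: "real i * h \<le> real (Suc i) * h" for i using h by (intro mult_right_mono) auto
  have Vmono: "V s \<le> V t" if "0 \<le> s" "s \<le> t" for s t using V(3)[OF that] by linarith
  have d0: "0 \<le> d i" for i using Vmono[OF g0 gS] by (simp add: d_def)
  have dsum: "(\<Sum>i<n. d i) \<le> B" for n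
  proof -
    have "(\<Sum>i<n. d i) = V (real n * h) - V 0"
      unfolding d_def by (induction n) auto
    then show ?thesis using V(1)[of 0] V(2)[OF g0[of n]] by simp
  qed
  have B0: "0 \<le> B" using dsum[of 0] by simp
  have dB: "d i \<le> B" for i using V(1)[OF g0[of i]] V(2)[OF g0[of "Suc i"]] by (simp add: d_def)
  have c0: "0 \<le> c" using f_nonneg[of 0] f_bound[of 0] by simp
  have fc: "f t \<le> c" if "0 \<le> t" for t
  proof -
    have "c / (1 + t\<^sup>2) \<le> c" using frac_le[of c c 1 "1 + t\<^sup>2"] c0 by simp
    then show ?thesis using f_bound[OF that] by linarith
  qed
  have near: "\<bar>f u - f (real i * h)\<bar> \<le> d i" if "real i * h \<le> u" "u \<le> real (Suc i) * h" for i u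
  proof -
    have "\<bar>f u - f (real i * h)\<bar> \<le> V u - V (real i * h)" by (rule V(3)[OF g0 that(1)])
    also have "\<dots> \<le> d i" using Vmono[of u "real (Suc i) * h"] that g0[of i] by (simp add: d_def)
    finally show ?thesis .
  qed
  have af: "a i \<le> f u" "f u \<le> a i + 2 * d i" "f u \<le> b i" "b i \<le> f u + 2 * d i"
    if "real i * h \<le> u" "u \<le> real (Suc i) * h" for i u
  proof -
    have "0 \<le> f u" using that g0[of i] by (intro f_nonneg) linarith
    then show "a i \<le> f u" "f u \<le> a i + 2 * d i" "f u \<le> b i" "b i \<le> f u + 2 * d i"
      using near[OF that] by (auto simp: a_def b_def)
  qed
  have a0: "0 \<le> a i" for i by (simp add: a_def)
  have b0: "0 \<le> b i" for i using f_nonneg[OF g0[of i]] d0[of i] by (simp add: b_def)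
  have ac: "a i \<le> c" for i using fc[OF g0[of i]] d0[of i] c0 by (simp add: a_def)
  \<comment> \<open>The left values of consecutive cells differ by at most \<open>d i\<close>, and
    the corrections \<open>d i\<close> and \<open>d (Suc i)\<close> are added on either side.
    Summing gives 2B + B, the bound \<open>3 * B\<close>.\<close>
  have step: "\<bar>a (Suc i) - a i\<bar> \<le> 2 * d i + d (Suc i)" "\<bar>b (Suc i) - b i\<bar> \<le> 2 * d i + d (Suc i)" for i
    using near[of i "real (Suc i) * h"] gS[of i] d0[of i] d0[of "Suc i"]
    unfolding a_def b_def by (auto simp only: max_def split: if_splits; linarith)+
  have dsum3: "(\<Sum>i<n. 2 * d i + d (Suc i)) \<le> 3 * B" for n
  proof -
    have "(\<Sum>i<n. d (Suc i)) \<le> (\<Sum>i<Suc n. d i)" unfolding sum.lessThan_Suc_shift using d0[of 0] by simp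
    then show ?thesis using dsum[of n] dsum[of "Suc n"] by (simp add: sum.distrib flip: sum_distrib_left)
  qed
  have fm: "(\<lambda>t. indicator {0..} t * f t) \<in> borel_measurable borel"
    by (rule borel_measurable_of_variation_majorant[OF V(3)])
  have fi: "set_integrable lborel {0..} f"
    unfolding set_integrable_def
  proof (rule Bochner_Integration.integrable_bound)
    show "integrable lborel (\<lambda>u. c * (indicator {0..} u *\<^sub>R (1 / (1 + u\<^sup>2))))"
      by (intro integrable_mult_right set_integral_inverse_1_plus_square(1)[unfolded set_integrable_def])
    show "(\<lambda>x. indicat_real {0..} x *\<^sub>R f x) \<in> borel_measurable lborel" using fm by simp
    show "AE x in lborel. norm (indicat_real {0..} x *\<^sub>R f x) \<le> norm (c * (indicator {0..} x *\<^sub>R (1 / (1 + x\<^sup>2))))"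
      using f_nonneg f_bound c0 by (auto simp: indicator_def abs_mult add_nonneg_nonneg)
  qed
  have f2i: "set_integrable lborel {0..} (\<lambda>u. (f u)\<^sup>2)"
    unfolding set_integrable_def
  proof (rule Bochner_Integration.integrable_bound)
    show "integrable lborel (\<lambda>u. c * (indicator {0..} u *\<^sub>R f u))"
      by (intro integrable_mult_right fi[unfolded set_integrable_def])
    have "(\<lambda>x. (indicat_real {0..} x * f x)\<^sup>2) \<in> borel_measurable borel" using fm by measurable
    also have "(\<lambda>x. (indicat_real {0..} x * f x)\<^sup>2) = (\<lambda>x. indicat_real {0..} x *\<^sub>R (f x)\<^sup>2)"
      by (auto simp: indicator_def)
    finally show "(\<lambda>x. indicat_real {0..} x *\<^sub>R (f x)\<^sup>2) \<in> borel_measurable lborel" by simp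
    show "AE x in lborel. norm (indicat_real {0..} x *\<^sub>R (f x)\<^sup>2) \<le> norm (c * (indicator {0..} x *\<^sub>R f x))"
      using f_nonneg fc c0 by (auto simp: indicator_def power2_eq_square abs_mult intro!: mult_right_mono)
  qed
  let ?P = "\<lambda>i. {real i * h..<real (Suc i) * h}"
  have Pm: "measure lborel (?P i) = h" for i using gS[of i] by (simp add: algebra_simps)
  have Pi: "set_integrable lborel (?P i) F" if "set_integrable lborel {0..} F" for F :: "real \<Rightarrow> real" and i
    by (rule set_integrable_subset[OF that]) (use g0[of i] in \<open>auto intro: order_trans\<close>)
  have Pc: "set_integrable lborel (?P i) (\<lambda>_. k)" "(LBINT u:?P i. k) = h * k" for i and k :: real
    using gS[of i] Pm[of i] by (auto simp: set_integrable_def set_lebesgue_integral_def)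
  have tail0: "0 \<le> (LBINT u:{real n * h..}. F u)" if "\<And>u. 0 \<le> u \<Longrightarrow> 0 \<le> F u" for F :: "real \<Rightarrow> real" and n
    unfolding set_lebesgue_integral_def
    by (rule integral_nonneg_AE) (use that g0[of n] in \<open>auto simp: indicator_def intro!: AE_I2 intro: order_trans\<close>)
  have tail: "(LBINT u:{real n * h..}. (f u)\<^sup>2) \<le> c\<^sup>2 * (pi / 2 - arctan (real n * h))" for n
  proof -
    have "(LBINT u:{real n * h..}. (f u)\<^sup>2) \<le> (LBINT u:{real n * h..}. c\<^sup>2 * (1 / (1 + u\<^sup>2)))"
    proof (rule set_integral_mono)
      show "set_integrable lborel {real n * h..} (\<lambda>u. (f u)\<^sup>2)"
        by (rule set_integrable_subset[OF f2i]) (use g0[of n] in \<open>auto intro: order_trans\<close>)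
      show "set_integrable lborel {real n * h..} (\<lambda>u. c\<^sup>2 * (1 / (1 + u\<^sup>2)))"
        by (intro set_integrable_mult_right set_integral_inverse_1_plus_square(1))
      fix u assume "u \<in> {real n * h..}"
      then have u: "0 \<le> u" using g0[of n] by (auto intro: order_trans)
      have "f u * f u \<le> c * (c / (1 + u\<^sup>2))"
        using f_nonneg[OF u] fc[OF u] f_bound[OF u] c0 by (intro mult_mono) auto
      then show "(f u)\<^sup>2 \<le> c\<^sup>2 * (1 / (1 + u\<^sup>2))" by (simp add: power2_eq_square)
    qed
    also have "\<dots> = c\<^sup>2 * (pi / 2 - arctan (real n * h))"
      unfolding set_integral_mult_right set_integral_inverse_1_plus_square(2) ..
    finally show ?thesis .
  qed
  have up: "(LBINT u:?P i. (f u)\<^sup>2) \<le> h * (a i)\<^sup>2 + 4 * c * h * d i" for i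
  proof -
    have "(LBINT u:?P i. (f u)\<^sup>2) \<le> (LBINT u:?P i. (a i)\<^sup>2 + 4 * c * d i)"
    proof (rule set_integral_mono[OF Pi[OF f2i] Pc(1)])
      fix u assume "u \<in> ?P i"
      then have u: "real i * h \<le> u" "u \<le> real (Suc i) * h" by auto
      have u0: "0 \<le> u" using u g0[of i] by linarith
      \<comment> \<open>Squares are compared through the difference factorised: one factor is at
        most twice the increase of \<open>V\<close> on the cell, the other at most 2c.\<close>
      have "(f u - a i) * (f u + a i) \<le> (2 * d i) * (2 * c)"
        using af[OF u] fc[OF u0] ac[of i] a0[of i] f_nonneg[OF u0] d0[of i] by (intro mult_mono) auto
      then show "(f u)\<^sup>2 \<le> (a i)\<^sup>2 + 4 * c * d i" by (simp add: power2_eq_square algebra_simps)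
    qed
    also have "\<dots> = h * ((a i)\<^sup>2 + 4 * c * d i)" by (rule Pc(2))
    finally show ?thesis by (simp add: algebra_simps)
  qed
  have low: "h * (b i)\<^sup>2 \<le> (LBINT u:?P i. (f u)\<^sup>2) + 2 * (2 * c + B) * h * d i" for i
  proof -
    have "h * ((b i)\<^sup>2 - 2 * (2 * c + B) * d i) = (LBINT u:?P i. (b i)\<^sup>2 - 2 * (2 * c + B) * d i)"
      by (rule Pc(2)[symmetric])
    also have "\<dots> \<le> (LBINT u:?P i. (f u)\<^sup>2)"
    proof (rule set_integral_mono[OF Pc(1) Pi[OF f2i]])
      fix u assume "u \<in> ?P i"
      then have u: "real i * h \<le> u" "u \<le> real (Suc i) * h" by auto
      have u0: "0 \<le> u" using u g0[of i] by linarith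
      have "b i \<le> c + B" using fc[OF g0[of i]] dB[of i] by (simp add: b_def)
      then have "(b i - f u) * (b i + f u) \<le> (2 * d i) * (2 * c + B)"
        using af[OF u] fc[OF u0] f_nonneg[OF u0] d0[of i] b0[of i] by (intro mult_mono) auto
      then show "(b i)\<^sup>2 - 2 * (2 * c + B) * d i \<le> (f u)\<^sup>2" by (simp add: power2_eq_square algebra_simps)
    qed
    finally show ?thesis by (simp add: algebra_simps)
  qed
  have low1: "h * b i \<le> (LBINT u:?P i. f u) + 2 * h * d i" for i
  proof -
    have "h * (b i - 2 * d i) = (LBINT u:?P i. b i - 2 * d i)" by (rule Pc(2)[symmetric])
    also have "\<dots> \<le> (LBINT u:?P i. f u)"
      by (rule set_integral_mono[OF Pc(1) Pi[OF fi]]) (use af(4) in \<open>force simp: algebra_simps\<close>)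
    finally show ?thesis by (simp add: algebra_simps)
  qed
  have sumd: "(\<Sum>i<n. k * d i) \<le> k * B" if "0 \<le> k" for k n
    using mult_left_mono[OF dsum[of n] that] by (simp add: sum_distrib_left)
  note grid2 = set_integral_grid[OF f2i less_imp_le[OF h]]
  note grid1 = set_integral_grid[OF fi less_imp_le[OF h]]
  have R1: "(LBINT u:{0..}. (f u)\<^sup>2) \<le> (\<Sum>i<n. h * (a i)\<^sup>2) + 4 * c * B * h + c\<^sup>2 * (pi / 2 - arctan (real n * h))" for n
  proof -
    have "(\<Sum>i<n. LBINT u:?P i. (f u)\<^sup>2) \<le> (\<Sum>i<n. h * (a i)\<^sup>2 + 4 * c * h * d i)" by (rule sum_mono) (rule up)
    also have "\<dots> \<le> (\<Sum>i<n. h * (a i)\<^sup>2) + 4 * c * h * B"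
      unfolding sum.distrib using sumd[of "4 * c * h" n] c0 h by simp
    finally show ?thesis using grid2[of n] tail[of n] by (simp add: mult.commute mult.left_commute)
  qed
  have R2: "(\<Sum>i<n. h * (b i)\<^sup>2) \<le> (LBINT u:{0..}. (f u)\<^sup>2) + 2 * B * (2 * c + B) * h" for n
  proof -
    have "(\<Sum>i<n. h * (b i)\<^sup>2) \<le> (\<Sum>i<n. (LBINT u:?P i. (f u)\<^sup>2) + 2 * (2 * c + B) * h * d i)" by (rule sum_mono) (rule low)
    also have "\<dots> \<le> (\<Sum>i<n. LBINT u:?P i. (f u)\<^sup>2) + 2 * (2 * c + B) * h * B"
      unfolding sum.distrib using sumd[of "2 * (2 * c + B) * h" n] c0 h B0 by simp
    also have "2 * (2 * c + B) * h * B = 2 * B * (2 * c + B) * h" by simp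
    finally show ?thesis using grid2[of n] tail0[of "\<lambda>u. (f u)\<^sup>2" n] by simp
  qed
  have R3: "(\<Sum>i<n. h * b i) \<le> c * pi / 2 + 2 * B * h" for n
  proof -
    have "(LBINT u:{0..}. f u) \<le> (LBINT u:{0..}. c * (1 / (1 + u\<^sup>2)))"
      by (rule set_integral_mono[OF fi set_integrable_mult_right[OF set_integral_inverse_1_plus_square(1)]])
        (use f_bound in auto)
    also have "\<dots> = c * (pi / 2 - arctan 0)"
      unfolding set_integral_mult_right set_integral_inverse_1_plus_square(2) ..
    finally have I: "(LBINT u:{0..}. f u) \<le> c * pi / 2" by simp
    have "(\<Sum>i<n. h * b i) \<le> (\<Sum>i<n. (LBINT u:?P i. f u) + 2 * h * d i)" by (rule sum_mono) (rule low1)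
    also have "\<dots> \<le> (\<Sum>i<n. LBINT u:?P i. f u) + 2 * h * B"
      unfolding sum.distrib using sumd[of "2 * h" n] h by simp
    also have "2 * h * B = 2 * B * h" by simp
    finally show ?thesis using grid1[of n] tail0[of f n, OF f_nonneg] I by linarith
  qed
  show thesis
  proof (rule that[of a b])
    show "(\<Sum>i<n. \<bar>a (Suc i) - a i\<bar>) \<le> 3 * B" for n
      by (rule order_trans[OF sum_mono dsum3]) (rule step(1))
    show "(\<Sum>i<n. \<bar>b (Suc i) - b i\<bar>) \<le> 3 * B" for n
      by (rule order_trans[OF sum_mono dsum3]) (rule step(2))
  qed (use a0 ac b0 af R1 R2 R3 in auto)
qed

text \<open>Dyadic approximation from below: it carries statements about countably many times over
  to all times along continuous paths.\<close>

lemma dyadic_floor_tendsto: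
  fixes x :: real
  shows "(\<lambda>p. real_of_int \<lfloor>x * 2 ^ p\<rfloor> / 2 ^ p) \<longlonglongrightarrow> x"
proof (rule tendsto_sandwich[of "\<lambda>p. x - (1/2) ^ p" _ _ "\<lambda>_. x"])
  have "(\<lambda>p. (1/2 :: real) ^ p) \<longlonglongrightarrow> 0" by (rule LIMSEQ_power_zero) simp
  from tendsto_diff[OF tendsto_const this, of x] show "(\<lambda>p. x - (1/2) ^ p) \<longlonglongrightarrow> x" by simp
  have "x - (1/2) ^ p \<le> real_of_int \<lfloor>x * 2 ^ p\<rfloor> / 2 ^ p" for p :: nat
  proof -
    have "x * 2 ^ p - 1 \<le> real_of_int \<lfloor>x * 2 ^ p\<rfloor>" by linarith
    then have "(x * 2 ^ p - 1) / 2 ^ p \<le> real_of_int \<lfloor>x * 2 ^ p\<rfloor> / 2 ^ p" by (rule divide_right_mono) simp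
    then show ?thesis by (simp add: diff_divide_distrib power_one_over)
  qed
  then show "\<forall>\<^sub>F p in sequentially. x - (1/2) ^ p \<le> real_of_int \<lfloor>x * 2 ^ p\<rfloor> / 2 ^ p" by simp
  have "real_of_int \<lfloor>x * 2 ^ p\<rfloor> / 2 ^ p \<le> x" for p :: nat
    by (simp add: pos_divide_le_eq)
  then show "\<forall>\<^sub>F p in sequentially. real_of_int \<lfloor>x * 2 ^ p\<rfloor> / 2 ^ p \<le> x" by simp
qed simp

section \<open>Dynkin's formula for the carousel\<close>

text \<open>One fixed value of \<open>lam\<close>. Of the bounded variation of \<open>f\<close> only
  its consequence \<open>f_meas\<close> is kept here; the size of the variation enters through the
  step sequences.\<close>

locale carousel =
  fixes f :: "real \<Rightarrow> real" and c lam :: real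
    and M :: "'a measure" and F :: "real \<Rightarrow> 'a measure" and alpha :: "real \<Rightarrow> 'a \<Rightarrow> real"
  assumes sol: "carousel_sde_solution f lam M F alpha"
    and lam_nonneg: "0 \<le> lam"
    and f_nonneg: "0 \<le> t \<Longrightarrow> 0 \<le> f t"
    and f_bound: "0 \<le> t \<Longrightarrow> f t \<le> c / (1 + t\<^sup>2)"
    and f_meas: "(\<lambda>t. indicator {0..} t * f t) \<in> borel_measurable borel"

sublocale carousel \<subseteq> prob_space M
  using sol unfolding carousel_sde_solution_def by blast

context carousel
begin

definition gen :: "(real \<Rightarrow> real) \<Rightarrow> real \<Rightarrow> real \<Rightarrow> real" where
  "gen g u x = lam * f u * deriv g x + 2 * (sin (x / 2))\<^sup>2 * deriv (deriv g) x"

lemma subalgebra_F: "subalgebra M (F t)"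
  and F_mono: "0 \<le> s \<Longrightarrow> s \<le> t \<Longrightarrow> sets (F s) \<subseteq> sets (F t)"
  and alpha_adapted: "0 \<le> t \<Longrightarrow> alpha t \<in> borel_measurable (F t)"
  and alpha_0: "\<omega> \<in> space M \<Longrightarrow> alpha 0 \<omega> = 0"
  and alpha_cont: "\<omega> \<in> space M \<Longrightarrow> continuous_on {0..} (\<lambda>t. alpha t \<omega>)"
  using sol unfolding carousel_sde_solution_def is_filtration_def by auto

lemma F_sets: "A \<in> sets (F t) \<Longrightarrow> A \<in> sets M"
  and space_F: "space (F t) = space M"
  using subalgebra_F[of t] by (auto simp: subalgebra_def)

lemma alpha_meas [measurable]: "0 \<le> t \<Longrightarrow> alpha t \<in> borel_measurable M"
  using measurable_from_subalg[OF subalgebra_F alpha_adapted] .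

lemma f_le: "0 \<le> t \<Longrightarrow> f t \<le> c" and c_nonneg: "0 \<le> c"
proof -
  show c: "0 \<le> c" using f_nonneg[of 0] f_bound[of 0] by simp
  show "f t \<le> c" if "0 \<le> t"
  proof -
    have "c / (1 + t\<^sup>2) \<le> c" using c by (simp add: divide_le_eq_1 frac_le[of c c 1 "1 + t\<^sup>2", simplified])
    then show ?thesis using f_bound[OF that] by simp
  qed
qed

text \<open>Paths are continuous, so the process is the pointwise limit of its values at times
  rounded down to multiples of 1/(n+1); each of these takes countably many times and is measurable
  piece by piece. \<open>max 0 u\<close> keeps the time where the process is controlled, although
  rounding may go below 0.\<close>

lemma alpha_joint_measurable:
  "(\<lambda>(u, \<omega>). alpha (max 0 u) \<omega>) \<in> borel_measurable (lborel \<Otimes>\<^sub>M M)"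
proof (rule borel_measurable_LIMSEQ_metric)
  fix n :: nat
  let ?q = "\<lambda>u::real. \<lfloor>real (Suc n) * u\<rfloor>"
  have "(\<lambda>x. (\<lambda>i::int. \<lambda>x. alpha (max 0 (real_of_int i / real (Suc n))) (snd x)) (?q (fst x)) x)
      \<in> borel_measurable (lborel \<Otimes>\<^sub>M M)"
    by (rule measurable_compose_countable) measurable
  then show "(\<lambda>x. alpha (max 0 (real_of_int (?q (fst x)) / real (Suc n))) (snd x)) \<in> borel_measurable (lborel \<Otimes>\<^sub>M M)" .
next
  fix x :: "real \<times> 'a" assume "x \<in> space (lborel \<Otimes>\<^sub>M M)"
  then have \<omega>: "snd x \<in> space M" by (auto simp: space_pair_measure)
  let ?u = "fst x"
  let ?r = "\<lambda>n. max 0 (real_of_int \<lfloor>real (Suc n) * ?u\<rfloor> / real (Suc n))"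
  have "(\<lambda>n. real_of_int \<lfloor>real (Suc n) * ?u\<rfloor> / real (Suc n)) \<longlonglongrightarrow> ?u"
  proof (rule tendsto_sandwich[of "\<lambda>n. ?u - 1 / real (Suc n)" _ _ "\<lambda>n. ?u"])
    show "(\<lambda>n. ?u - 1 / real (Suc n)) \<longlonglongrightarrow> ?u"
      using tendsto_diff[OF tendsto_const LIMSEQ_inverse_real_of_nat, of ?u] by (simp add: inverse_eq_divide)
  next
    show "\<forall>\<^sub>F n in sequentially. ?u - 1 / real (Suc n) \<le> real_of_int \<lfloor>real (Suc n) * ?u\<rfloor> / real (Suc n)"
    proof (rule always_eventually, rule allI)
      fix n
      have "real (Suc n) * ?u - 1 \<le> real_of_int \<lfloor>real (Suc n) * ?u\<rfloor>" by linarith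
      then have "(real (Suc n) * ?u - 1) / real (Suc n) \<le> real_of_int \<lfloor>real (Suc n) * ?u\<rfloor> / real (Suc n)"
        by (rule divide_right_mono) simp
      moreover have "(real (Suc n) * ?u - 1) / real (Suc n) = ?u - 1 / real (Suc n)"
        by (simp only: diff_divide_distrib nonzero_mult_div_cancel_left of_nat_eq_0_iff nat.distinct(2) not_False_eq_True)
      ultimately show "?u - 1 / real (Suc n) \<le> real_of_int \<lfloor>real (Suc n) * ?u\<rfloor> / real (Suc n)"
        by (simp only:)
    qed
  next
    show "\<forall>\<^sub>F n in sequentially. real_of_int \<lfloor>real (Suc n) * ?u\<rfloor> / real (Suc n) \<le> ?u"
    proof (rule always_eventually, rule allI)
      fix n
      have "real_of_int \<lfloor>real (Suc n) * ?u\<rfloor> \<le> real (Suc n) * ?u" by linarith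
      then show "real_of_int \<lfloor>real (Suc n) * ?u\<rfloor> / real (Suc n) \<le> ?u"
        by (simp add: pos_divide_le_eq mult.commute)
    qed
  qed simp
  then have "?r \<longlonglongrightarrow> max 0 ?u" by (intro tendsto_max tendsto_const)
  then have "(\<lambda>n. alpha (?r n) (snd x)) \<longlonglongrightarrow> alpha (max 0 ?u) (snd x)"
    by (rule continuous_on_tendsto_compose[OF alpha_cont[OF \<omega>]]) auto
  then show "(\<lambda>n. alpha (?r n) (snd x)) \<longlonglongrightarrow> (case x of (u, \<omega>) \<Rightarrow> alpha (max 0 u) \<omega>)"
    by (simp add: case_prod_beta)
qed

lemma C2b_bounds:
  assumes "C2b g"
  obtains K where "0 \<le> K" "\<And>x. \<bar>g x\<bar> \<le> K" "\<And>u x. 0 \<le> u \<Longrightarrow> \<bar>gen g u x\<bar> \<le> K"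
proof -
  obtain b0 b1 b2 where b: "\<And>x. \<bar>g x\<bar> \<le> b0" "\<And>x. \<bar>deriv g x\<bar> \<le> b1" "\<And>x. \<bar>deriv (deriv g) x\<bar> \<le> b2"
    using assms unfolding C2b_def bounded_iff by auto
  have nn: "0 \<le> b0" "0 \<le> b1" "0 \<le> b2" using b[of 0] by linarith+
  have "\<bar>gen g u x\<bar> \<le> lam * c * b1 + 2 * b2" if "0 \<le> u" for u x
  proof -
    have "\<bar>lam * f u * deriv g x\<bar> \<le> lam * c * b1"
      unfolding abs_mult using b(2)[of x] f_le[OF that] f_nonneg[OF that] lam_nonneg c_nonneg
      by (intro mult_mono) auto
    moreover have "\<bar>2 * (sin (x / 2))\<^sup>2 * deriv (deriv g) x\<bar> \<le> 2 * 1 * b2"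
      unfolding abs_mult using b(3)[of x] by (intro mult_mono) (auto simp: abs_square_le_1)
    ultimately show ?thesis unfolding gen_def by linarith
  qed
  then show thesis using b(1) nn lam_nonneg c_nonneg
    by (intro that[of "b0 + (lam * c * b1 + 2 * b2)"]) (force intro: add_increasing add_increasing2)+
qed

lemma gen_joint_measurable:
  assumes "C2b g"
  shows "(\<lambda>(u, \<omega>). indicator {0..} u * gen g u (alpha (max 0 u) \<omega>)) \<in> borel_measurable (lborel \<Otimes>\<^sub>M M)"
proof -
  note [measurable] = C2b_borel[OF assms] alpha_joint_measurable f_meas
  have "(\<lambda>z. lam * (indicator {0..} (fst z) * f (fst z)) * deriv g (case z of (u, \<omega>) \<Rightarrow> alpha (max 0 u) \<omega>)
     + 2 * indicator {0..} (fst z) * (sin ((case z of (u, \<omega>) \<Rightarrow> alpha (max 0 u) \<omega>) / 2))\<^sup>2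
        * deriv (deriv g) (case z of (u, \<omega>) \<Rightarrow> alpha (max 0 u) \<omega>)) \<in> borel_measurable (lborel \<Otimes>\<^sub>M M)"
    by measurable
  then show ?thesis
    by (rule measurable_cong[THEN iffD1, rotated]) (auto simp: gen_def indicator_def)
qed

lemma dynkin:
  assumes g: "C2b g" and st: "0 \<le> s" "s \<le> t" and A: "A \<in> sets (F s)"
  shows "(\<integral>\<omega>. indicator A \<omega> * g (alpha t \<omega>) \<partial>M) = (\<integral>\<omega>. indicator A \<omega> * g (alpha s \<omega>) \<partial>M)
      + (LBINT u:{s<..t}. (\<integral>\<omega>. indicator A \<omega> * gen g u (alpha u \<omega>) \<partial>M))"
    and "set_integrable lborel {s<..t} (\<lambda>u. \<integral>\<omega>. indicator A \<omega> * gen g u (alpha u \<omega>) \<partial>M)"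
proof -
  interpret pair_sigma_finite lborel M by standard
  obtain K where K: "0 \<le> K" "\<And>x. \<bar>g x\<bar> \<le> K" "\<And>u x. 0 \<le> u \<Longrightarrow> \<bar>gen g u x\<bar> \<le> K"
    using C2b_bounds[OF g] by blast
  note [measurable] = C2b_borel[OF g] gen_joint_measurable[OF g] F_sets[OF A]
  \<comment> \<open>The integrand of the martingale problem, set to zero at negative times: jointly
    measurable and bounded by \<open>K\<close> everywhere, as Fubini requires.\<close>
  define H where "H = (\<lambda>u \<omega>. indicator {0..} u * gen g u (alpha (max 0 u) \<omega>))"
  have Hm [measurable]: "case_prod H \<in> borel_measurable (lborel \<Otimes>\<^sub>M M)"
    unfolding H_def using gen_joint_measurable[OF g] by simp
  have Hb: "\<bar>H u \<omega>\<bar> \<le> K" for u \<omega> using K by (auto simp: H_def indicator_def)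
  have HI: "(LBINT u:{0..r}. lam * f u * deriv g (alpha u \<omega>) + 2 * (sin (alpha u \<omega> / 2))\<^sup>2 * deriv (deriv g) (alpha u \<omega>))
      = (LBINT u:{0..r}. H u \<omega>)" for r \<omega>
    by (rule set_lebesgue_integral_cong) (auto simp: H_def gen_def)
  have Hint: "set_integrable lborel S (\<lambda>u. H u \<omega>)" if "S \<in> sets borel" "emeasure lborel S < \<infinity>" "\<omega> \<in> space M" for S \<omega>
    unfolding set_integrable_def
    by (rule integrableI_bounded_set_indicator[where B=K]) (use that Hb in auto)
  have J: "(LBINT u:{0..t}. H u \<omega>) = (LBINT u:{0..s}. H u \<omega>) + (LBINT u:{s<..t}. H u \<omega>)" if "\<omega> \<in> space M" for \<omega>
  proof -
    have *: "{0..t} = {0..s} \<union> {s<..t}" "{0..s} \<inter> {s<..t} = {}" using st by auto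
    have "set_integrable lborel {0..s} (\<lambda>u. H u \<omega>)" "set_integrable lborel {s<..t} (\<lambda>u. H u \<omega>)"
      using that st by (auto intro!: Hint)
    then show ?thesis unfolding *(1) by (rule set_integral_Un[OF *(2)])
  qed
  define J where "J = (\<lambda>r \<omega>. LBINT u:{0..r}. H u \<omega>)"
  have mart: "is_martingale M F (\<lambda>t \<omega>. g (alpha t \<omega>) - J t \<omega>)"
    using sol[unfolded carousel_sde_solution_def, THEN conjunct2, THEN conjunct2, THEN conjunct2, THEN conjunct2,
        THEN spec, of g] g
    by (simp only: HI J_def simp_thms)
  have gi: "integrable M (\<lambda>\<omega>. g (alpha r \<omega>))" if "0 \<le> r" for r
    by (rule integrable_const_bound[of _ K]) (use K that in auto)
  \<comment> \<open>\<open>J r\<close> is the difference of the bounded \<open>g (alpha r)\<close>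
    and an integrable martingale.\<close>
  have Ji: "integrable M (J r)" if "0 \<le> r" for r
  proof -
    have "integrable M (\<lambda>\<omega>. g (alpha r \<omega>) - J r \<omega>)" using mart that unfolding is_martingale_def by blast
    from Bochner_Integration.integrable_diff[OF gi[OF that] this] show ?thesis by simp
  qed
  have iA: "integrable M (\<lambda>\<omega>. indicator A \<omega> * h \<omega>)" if "integrable M h" for h :: "'a \<Rightarrow> real"
    using integrable_real_mult_indicator[OF F_sets[OF A] that] by (simp only: mult.commute)
  have t0: "0 \<le> t" using st by simp
  have "(\<integral>\<omega>. indicator A \<omega> * (g (alpha t \<omega>) - J t \<omega>) \<partial>M) = (\<integral>\<omega>. indicator A \<omega> * (g (alpha s \<omega>) - J s \<omega>) \<partial>M)"
    using mart st A unfolding is_martingale_def by blast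
  then have 1: "(\<integral>\<omega>. indicator A \<omega> * g (alpha t \<omega>) \<partial>M) - (\<integral>\<omega>. indicator A \<omega> * g (alpha s \<omega>) \<partial>M)
      = (\<integral>\<omega>. indicator A \<omega> * J t \<omega> \<partial>M) - (\<integral>\<omega>. indicator A \<omega> * J s \<omega> \<partial>M)"
    using iA[OF gi[OF t0]] iA[OF gi[OF st(1)]] iA[OF Ji[OF t0]] iA[OF Ji[OF st(1)]]
    by (simp add: right_diff_distrib)
  define \<Phi> where "\<Phi> = (\<lambda>u \<omega>. indicator {s<..t} u * (indicator A \<omega> * H u \<omega>))"
  have "integrable (lborel \<Otimes>\<^sub>M M) (case_prod \<Phi>)"
  proof (rule integrableI_bounded_set[where A="{s<..t} \<times> space M" and B=K])
    show "case_prod \<Phi> \<in> borel_measurable (lborel \<Otimes>\<^sub>M M)"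
      unfolding \<Phi>_def case_prod_beta using Hm[unfolded case_prod_beta] by measurable
    show "emeasure (lborel \<Otimes>\<^sub>M M) ({s<..t} \<times> space M) < \<infinity>"
      using st by (subst sigma_finite_measure.emeasure_pair_measure_Times[OF prob_space_imp_sigma_finite[OF prob_space_axioms]]) (auto simp: emeasure_space_1)
    show "AE x in lborel \<Otimes>\<^sub>M M. x \<in> {s<..t} \<times> space M \<longrightarrow> norm (case_prod \<Phi> x) \<le> K"
      using Hb K(1) by (auto simp: \<Phi>_def indicator_def)
  qed (auto simp: \<Phi>_def indicator_def space_pair_measure)
  note \<Phi>i = this
  have H_gen: "indicator {s<..t} u * (\<integral>\<omega>. indicator A \<omega> * H u \<omega> \<partial>M) = indicator {s<..t} u * (\<integral>\<omega>. indicator A \<omega> * gen g u (alpha u \<omega>) \<partial>M)" for u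
    using st by (auto simp: H_def indicator_def)
  have "(\<integral>\<omega>. indicator A \<omega> * J t \<omega> \<partial>M) - (\<integral>\<omega>. indicator A \<omega> * J s \<omega> \<partial>M)
     = (\<integral>\<omega>. indicator A \<omega> * J t \<omega> - indicator A \<omega> * J s \<omega> \<partial>M)"
    using iA[OF Ji[OF t0]] iA[OF Ji[OF st(1)]] by simp
  also have "\<dots> = (\<integral>\<omega>. (\<integral>u. \<Phi> u \<omega> \<partial>lborel) \<partial>M)"
  proof (rule Bochner_Integration.integral_cong)
    fix \<omega> assume "\<omega> \<in> space M"
    from J[OF this] show "indicator A \<omega> * J t \<omega> - indicator A \<omega> * J s \<omega> = (\<integral>u. \<Phi> u \<omega> \<partial>lborel)"
      by (auto simp: J_def \<Phi>_def set_lebesgue_integral_def indicator_def)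
  qed simp
  also have "\<dots> = (\<integral>u. (\<integral>\<omega>. \<Phi> u \<omega> \<partial>M) \<partial>lborel)"
    by (rule Fubini_integral[OF \<Phi>i])
  also have "\<dots> = (LBINT u:{s<..t}. (\<integral>\<omega>. indicator A \<omega> * gen g u (alpha u \<omega>) \<partial>M))"
    unfolding set_lebesgue_integral_def \<Phi>_def
    by (simp only: real_scaleR_def integral_mult_right_zero H_gen)
  finally show "(\<integral>\<omega>. indicator A \<omega> * g (alpha t \<omega>) \<partial>M) = (\<integral>\<omega>. indicator A \<omega> * g (alpha s \<omega>) \<partial>M)
      + (LBINT u:{s<..t}. (\<integral>\<omega>. indicator A \<omega> * gen g u (alpha u \<omega>) \<partial>M))"
    using 1 by simp
  show "set_integrable lborel {s<..t} (\<lambda>u. \<integral>\<omega>. indicator A \<omega> * gen g u (alpha u \<omega>) \<partial>M)"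
    using integrable_fst'[OF \<Phi>i] unfolding set_integrable_def \<Phi>_def
    by (simp only: real_scaleR_def integral_mult_right_zero H_gen prod.case fst_conv snd_conv)
qed

lemma integrable_test:
  fixes q :: "real \<Rightarrow> real"
  assumes "continuous_on UNIV q" "\<And>x. \<bar>q x\<bar> \<le> K" "A \<in> sets M" "0 \<le> u"
  shows "integrable M (\<lambda>\<omega>. indicator A \<omega> * q (alpha u \<omega>))"
proof -
  have [measurable]: "q \<in> borel_measurable borel" using assms(1) by (rule borel_measurable_continuous_onI)
  note [measurable] = assms(3)
  have "norm (indicator A \<omega> * q (alpha u \<omega>)) \<le> K" for \<omega>
    using order_trans[OF abs_ge_zero assms(2)] assms(2)[of "alpha u \<omega>"] by (cases "\<omega> \<in> A") auto
  then show ?thesis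
    by (intro integrable_const_bound[of _ K]) (use assms(4) in auto)
qed

lemma integral_test_bound:
  fixes q :: "real \<Rightarrow> real"
  assumes "continuous_on UNIV q" "\<And>x. \<bar>q x\<bar> \<le> K" "A \<in> sets M" "0 \<le> u"
  shows "\<bar>\<integral>\<omega>. indicator A \<omega> * q (alpha u \<omega>) \<partial>M\<bar> \<le> K"
proof -
  have K: "0 \<le> K" using order_trans[OF abs_ge_zero assms(2)] .
  have "\<bar>\<integral>\<omega>. indicator A \<omega> * q (alpha u \<omega>) \<partial>M\<bar> \<le> (\<integral>\<omega>. K \<partial>M)"
    unfolding real_norm_def[symmetric]
  proof (rule Bochner_Integration.integral_norm_bound[THEN order_trans], rule integral_mono)
    show "integrable M (\<lambda>\<omega>. norm (indicator A \<omega> * q (alpha u \<omega>)))"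
      by (rule integrable_norm[OF integrable_test[OF assms]])
    show "norm (indicator A \<omega> * q (alpha u \<omega>)) \<le> K" for \<omega>
      using K assms(2)[of "alpha u \<omega>"] by (cases "\<omega> \<in> A") auto
  qed simp
  then show ?thesis by (simp add: prob_space)
qed

lemma set_integrable_test:
  fixes q :: "real \<Rightarrow> real"
  assumes q: "continuous_on UNIV q" "\<And>x. \<bar>q x\<bar> \<le> K" and A: "A \<in> sets M" and s: "0 \<le> s"
  shows "set_integrable lborel {s<..t} (\<lambda>u. \<integral>\<omega>. indicator A \<omega> * q (alpha u \<omega>) \<partial>M)"
proof -
  have [measurable]: "q \<in> borel_measurable borel" using q(1) by (rule borel_measurable_continuous_onI)
  note [measurable] = alpha_joint_measurable A
  have "(\<lambda>z. indicator A (snd z) * q (case z of (u, \<omega>) \<Rightarrow> alpha (max 0 u) \<omega>)) \<in> borel_measurable (lborel \<Otimes>\<^sub>M M)"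
    by measurable
  then have "(\<lambda>u. \<integral>\<omega>. indicator A \<omega> * q (alpha (max 0 u) \<omega>) \<partial>M) \<in> borel_measurable lborel"
    by (intro borel_measurable_lebesgue_integral) (simp add: case_prod_beta')
  then have "integrable lborel (\<lambda>u. indicator {s<..t} u *\<^sub>R (\<integral>\<omega>. indicator A \<omega> * q (alpha (max 0 u) \<omega>) \<partial>M))"
    by (rule integrableI_bounded_set_indicator[where B=K, rotated])
      (use integral_test_bound[OF q A] s in \<open>auto simp: emeasure_bounded_finite[of "{s<..t}", simplified]\<close>)
  then show ?thesis unfolding set_integrable_def
    by (rule Bochner_Integration.integrable_cong[THEN iffD1, rotated -1]) (use s in \<open>auto simp: indicator_def\<close>)
qed

lemma gen_continuous: "C2b g \<Longrightarrow> continuous_on UNIV (gen g u)"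
  unfolding gen_def by (intro continuous_intros C2b_continuous) auto

lemma gen_integrable:
  assumes g: "C2b g" and u: "0 \<le> u" and A: "A \<in> sets M"
  shows "integrable M (\<lambda>\<omega>. indicator A \<omega> * gen g u (alpha u \<omega>))"
proof -
  obtain K where K: "0 \<le> K" "\<And>x. \<bar>gen g u x\<bar> \<le> K" using C2b_bounds[OF g] u by metis
  show ?thesis
    by (rule integrable_test[OF gen_continuous[OF g] K(2) A u])
qed

text \<open>\<open>A\<close> belongs to every later sigma-algebra, so Dynkin's formula holds on each
  subinterval; boundedness of the generator makes G(u) = E[1_A g(\<alpha>(u))] Lipschitz, and the
  scalar Gronwall lemma applies. The generator bound is asked only almost surely at each time, since
  it is available for nonnegative \<alpha> and the sign is known only in that sense.\<close>

lemma gronwall_upper: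
  assumes g: "C2b g" and st: "0 \<le> s" "s \<le> t" and A: "A \<in> sets (F s)"
    and AE: "\<And>u. s < u \<Longrightarrow> u \<le> t \<Longrightarrow> AE \<omega> in M. \<omega> \<in> A \<longrightarrow> gen g u (alpha u \<omega>) \<le> - k * g (alpha u \<omega>)"
  shows "(\<integral>\<omega>. indicator A \<omega> * g (alpha t \<omega>) \<partial>M) \<le> exp (- k * (t - s)) * (\<integral>\<omega>. indicator A \<omega> * g (alpha s \<omega>) \<partial>M)"
proof -
  obtain K where K: "0 \<le> K" "\<And>x. \<bar>g x\<bar> \<le> K" "\<And>u x. 0 \<le> u \<Longrightarrow> \<bar>gen g u x\<bar> \<le> K"
    using C2b_bounds[OF g] by blast
  note AM = F_sets[OF A]
  note gc = C2b_continuous(1)[OF g]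
  define G where "G = (\<lambda>u. \<integral>\<omega>. indicator A \<omega> * g (alpha u \<omega>) \<partial>M)"
  define D where "D = (\<lambda>u. \<integral>\<omega>. indicator A \<omega> * gen g u (alpha u \<omega>) \<partial>M)"
  have Db: "\<bar>D u\<bar> \<le> K" if "0 \<le> u" for u
    unfolding D_def
    by (rule integral_test_bound[OF gen_continuous[OF g] K(3)[OF that] AM that])
  have dyn: "G v = G u + (LBINT r:{u<..v}. D r)" "set_integrable lborel {u<..v} D" if "s \<le> u" "u \<le> v" for u v
  proof -
    have "0 \<le> u" "A \<in> sets (F u)" using A F_mono[OF st(1) that(1)] st that by auto
    from dynkin[OF g this(1) that(2) this(2)]
    show "G v = G u + (LBINT r:{u<..v}. D r)" "set_integrable lborel {u<..v} D" unfolding G_def D_def .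
  qed
  have Dle: "D u \<le> - k * G u" if "s < u" "u \<le> t" for u
  proof -
    have u: "0 \<le> u" using st that by simp
    have "D u \<le> (\<integral>\<omega>. - k * (indicator A \<omega> * g (alpha u \<omega>)) \<partial>M)"
      unfolding D_def
    proof (rule integral_mono_AE[OF gen_integrable[OF g u AM]])
      show "integrable M (\<lambda>\<omega>. - k * (indicator A \<omega> * g (alpha u \<omega>)))"
        by (rule integrable_mult_right[OF integrable_test[OF gc K(2) AM u]])
    qed (use AE[OF that] in \<open>auto simp: indicator_def\<close>)
    then show ?thesis by (simp add: G_def)
  qed
  have lip: "\<bar>G v - G u\<bar> \<le> K * \<bar>v - u\<bar>" if "s \<le> u" "u \<le> v" for u v
  proof -
    have "\<bar>LBINT r:{u<..v}. D r\<bar> \<le> (LBINT r:{u<..v}. K)"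
      unfolding real_norm_def[symmetric] set_lebesgue_integral_def
    proof (rule Bochner_Integration.integral_norm_bound[THEN order_trans], rule integral_mono)
      show "integrable lborel (\<lambda>r. norm (indicat_real {u<..v} r *\<^sub>R D r))"
        using integrable_norm[OF dyn(2)[OF that, unfolded set_integrable_def]] .
      show "integrable lborel (\<lambda>r. indicat_real {u<..v} r *\<^sub>R K)" using that by simp
    qed (use Db st that in \<open>auto simp: indicator_def\<close>)
    also have "\<dots> = K * \<bar>v - u\<bar>" using that by (simp add: set_lebesgue_integral_def mult.commute)
    finally show ?thesis using dyn(1)[OF that] by simp
  qed
  have cont: "continuous_on {s..t} G"
  proof (rule lipschitz_on_continuous_on[of K], rule lipschitz_onI)
    fix u v assume "u \<in> {s..t}" "v \<in> {s..t}"
    then show "dist (G u) (G v) \<le> K * dist u v"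
      using lip[of u v] lip[of v u] by (cases "u \<le> v") (auto simp: dist_real_def abs_minus_commute)
  qed (rule K(1))
  have "G t \<le> exp (- k * (t - s)) * G s"
  proof (rule gronwall_integral[OF st(2) cont])
    fix u v assume uv: "s \<le> u" "u \<le> v" "v \<le> t"
    have cuv: "continuous_on {u..v} G" using continuous_on_subset[OF cont] uv by simp
    have iG: "set_integrable lborel {u<..v} G"
      unfolding G_def by (rule set_integrable_test[OF gc K(2) AM]) (use st uv in auto)
    have "(LBINT r:{u<..v}. G r) = integral {u<..v} G"
      by (rule set_borel_integral_eq_integral(2)[OF iG])
    also have "\<dots> = integral {u..v} G"
      by (rule integral_spike_set) (auto intro: negligible_subset[of "{u}"])
    finally have e: "(LBINT r:{u<..v}. G r) = integral {u..v} G" .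
    have "G v - G u = (LBINT r:{u<..v}. D r)" using dyn(1)[OF uv(1,2)] by simp
    also have "\<dots> \<le> (LBINT r:{u<..v}. - k * G r)"
      by (rule set_integral_mono[OF dyn(2)[OF uv(1,2)] set_integrable_mult_right[OF iG]]) (use uv Dle in auto)
    also have "\<dots> = - k * integral {u..v} G" by (simp only: set_integral_mult_right e)
    finally show "G v - G u \<le> - k * integral {u..v} G" .
  qed
  then show ?thesis by (simp add: G_def)
qed

lemma gronwall_lower:
  assumes g: "C2b g" and st: "0 \<le> s" "s \<le> t" and A: "A \<in> sets (F s)"
    and AE: "\<And>u. s < u \<Longrightarrow> u \<le> t \<Longrightarrow> AE \<omega> in M. \<omega> \<in> A \<longrightarrow> - k * g (alpha u \<omega>) \<le> gen g u (alpha u \<omega>)"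
  shows "exp (- k * (t - s)) * (\<integral>\<omega>. indicator A \<omega> * g (alpha s \<omega>) \<partial>M) \<le> (\<integral>\<omega>. indicator A \<omega> * g (alpha t \<omega>) \<partial>M)"
proof -
  have "gen (\<lambda>x. - g x) u x = - gen g u x" for u x
    unfolding gen_def C2b_uminus(3)[OF g] unfolding C2b_uminus(2)[OF g] by simp
  then have "AE \<omega> in M. \<omega> \<in> A \<longrightarrow> gen (\<lambda>x. - g x) u (alpha u \<omega>) \<le> - k * - g (alpha u \<omega>)" if "s < u" "u \<le> t" for u
    using AE[OF that] by eventually_elim (use \<open>\<And>u x. gen (\<lambda>x. - g x) u x = - gen g u x\<close> in auto)
  from gronwall_upper[OF C2b_uminus(1)[OF g] st A this] show ?thesis by simp
qed

text \<open>The three terms of the bound are the drift, controlled by b/(1 + u^2) and integrating to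
  a difference of arctangents, a smoothing error \<open>e\<close> per unit of time, and a gain
  \<open>q\<close> that is kept on the left.\<close>

lemma dynkin_le:
  assumes g: "C2b g" and st: "0 \<le> s" "s \<le> t" and A: "A \<in> sets (F s)"
    and q: "continuous_on UNIV q" "\<And>x. \<bar>q x\<bar> \<le> (K::real)"
    and AE: "\<And>u. s < u \<Longrightarrow> u \<le> t \<Longrightarrow> AE \<omega> in M. gen g u (alpha u \<omega>) \<le> b / (1 + u\<^sup>2) + e - q (alpha u \<omega>)"
  shows "(\<integral>\<omega>. indicator A \<omega> * g (alpha t \<omega>) \<partial>M) + (LBINT u:{s<..t}. \<integral>\<omega>. indicator A \<omega> * q (alpha u \<omega>) \<partial>M)
    \<le> (\<integral>\<omega>. indicator A \<omega> * g (alpha s \<omega>) \<partial>M) + measure M A * (b * (arctan t - arctan s) + e * (t - s))"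
proof -
  note AM = F_sets[OF A]
  define D where "D = (\<lambda>u. \<integral>\<omega>. indicator A \<omega> * gen g u (alpha u \<omega>) \<partial>M)"
  define Q where "Q = (\<lambda>u. \<integral>\<omega>. indicator A \<omega> * q (alpha u \<omega>) \<partial>M)"
  note dyn = dynkin[OF g st A, folded D_def]
  have Qi: "set_integrable lborel {s<..t} Q" unfolding Q_def by (rule set_integrable_test[OF q AM st(1)])
  define B where "B = (\<lambda>u. measure M A * (b / (1 + u\<^sup>2) + e))"
  have nz: "1 + x\<^sup>2 \<noteq> 0" for x :: real using add_pos_nonneg[of 1 "x\<^sup>2"] by simp
  have Bi: "set_integrable lborel {s<..t} B"
    by (rule set_integrable_subset[of _ "{s..t}"], rule borel_integrable_atLeastAtMost')
      (auto simp: B_def nz intro!: continuous_intros)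
  have "(LBINT u:{s<..t}. B u) = integral {s<..t} B" by (rule set_borel_integral_eq_integral(2)[OF Bi])
  also have "\<dots> = integral {s..t} B"
    by (rule integral_spike_set) (auto intro: negligible_subset[of "{s}"])
  also have "\<dots> = measure M A * (b * arctan t + e * t) - measure M A * (b * arctan s + e * s)"
  proof (rule integral_unique, rule fundamental_theorem_of_calculus[OF st(2)])
    fix u assume "u \<in> {s..t}"
    have "((\<lambda>u. measure M A * (b * arctan u + e * u)) has_real_derivative B u) (at u within {s..t})"
      unfolding B_def by (auto intro!: derivative_eq_intros simp: divide_inverse)
    then show "((\<lambda>u. measure M A * (b * arctan u + e * u)) has_vector_derivative B u) (at u within {s..t})"
      by (simp only: has_real_derivative_iff_has_vector_derivative)
  qed
  finally have BI: "(LBINT u:{s<..t}. B u) = measure M A * (b * (arctan t - arctan s) + e * (t - s))"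
    by (simp add: algebra_simps)
  have Dle: "D u \<le> B u - Q u" if "s < u" "u \<le> t" for u
  proof -
    have u: "0 \<le> u" using st that by simp
    have iq: "integrable M (\<lambda>\<omega>. indicator A \<omega> * q (alpha u \<omega>))" by (rule integrable_test[OF q AM u])
    have iI: "integrable M (\<lambda>\<omega>. (b / (1 + u\<^sup>2) + e) * indicator A \<omega>)"
      by (intro integrable_mult_right integrable_real_indicator AM) (simp add: less_top[symmetric])
    have "D u \<le> (\<integral>\<omega>. (b / (1 + u\<^sup>2) + e) * indicator A \<omega> - indicator A \<omega> * q (alpha u \<omega>) \<partial>M)"
      unfolding D_def
    proof (rule integral_mono_AE[OF gen_integrable[OF g u AM]])
      show "integrable M (\<lambda>\<omega>. (b / (1 + u\<^sup>2) + e) * indicator A \<omega> - indicator A \<omega> * q (alpha u \<omega>))"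
        by (intro Bochner_Integration.integrable_diff iI iq)
    qed (use AE[OF that] in \<open>auto simp: indicator_def\<close>)
    also have "\<dots> = B u - Q u"
      unfolding Bochner_Integration.integral_diff[OF iI iq] using AM by (simp add: B_def Q_def)
    finally show ?thesis .
  qed
  have "(LBINT u:{s<..t}. D u) \<le> (LBINT u:{s<..t}. B u - Q u)"
    by (rule set_integral_mono[OF dyn(2) set_integral_diff(1)[OF Bi Qi]]) (use Dle in auto)
  also have "\<dots> = (LBINT u:{s<..t}. B u) - (LBINT u:{s<..t}. Q u)" by (rule set_integral_diff(2)[OF Bi Qi])
  finally show ?thesis using dyn(1) BI unfolding Q_def by linarith
qed

end

section \<open>Convergence to multiples of $2\pi$\<close>

text \<open>The cubic term is what shows that the barrier below is at least of order (b - x)^3 near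
  its zero.\<close>

lemma exp_lower_Taylor_cubic:
  fixes y :: real
  assumes "0 \<le> y"
  shows "1 + y + y\<^sup>2 / 2 + y ^ 3 / 6 \<le> exp y"
proof -
  define \<psi> where "\<psi> = (\<lambda>y::real. exp y - (1 + y + y\<^sup>2 / 2 + y ^ 3 / 6))"
  have "\<psi> 0 \<le> \<psi> y"
  proof (rule DERIV_nonneg_imp_nondecreasing[OF assms])
    fix x :: real assume x: "0 \<le> x" "x \<le> y"
    have "(\<psi> has_real_derivative exp x - (1 + x + x\<^sup>2 / 2)) (at x)"
      unfolding \<psi>_def by (auto intro!: derivative_eq_intros simp: power2_eq_square power3_eq_cube)
    then show "\<exists>d. (\<psi> has_real_derivative d) (at x) \<and> 0 \<le> d"
      using exp_lower_Taylor_quadratic[OF x(1)] by force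
  qed
  then show ?thesis by (simp add: \<psi>_def)
qed

lemma sin_half_shift: "(sin ((x - 2 * pi * of_int j) / 2))\<^sup>2 = (sin (x / 2 :: real))\<^sup>2"
proof -
  have *: "(x - 2 * pi * of_int j) / 2 = x / 2 - pi * of_int j" by (simp add: field_simps)
  show ?thesis unfolding * by (simp add: sin_diff power_mult_distrib)
qed

lemma sin_sq_le: "(sin x)\<^sup>2 \<le> x\<^sup>2" for x :: real
  using power_mono[OF abs_sin_x_le_abs_x[of x], of 2] by simp

text \<open>With y = b - x, \<open>h\<close> is the integral of v^2 exp(-v)/2 from 0 to y, the
  distribution function of a Gamma(3) variable. So it is bounded, positive exactly to the left of
  \<open>b\<close>, and vanishes there to third order.\<close>

lemma barrier_function:
  fixes b :: real
  defines "h \<equiv> \<lambda>x. if x \<le> b then 1 - (1 + (b - x) + (b - x)\<^sup>2 / 2) * exp (x - b) else 0"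
  shows "C2b h" "deriv h = (\<lambda>x. if x \<le> b then - ((b - x)\<^sup>2 / 2) * exp (x - b) else 0)"
    "deriv (deriv h) = (\<lambda>x. if x \<le> b then ((b - x) - (b - x)\<^sup>2 / 2) * exp (x - b) else 0)"
    "(b - x) ^ 3 / 6 * exp (x - b) \<le> h x \<or> b < x"
proof -
  let ?l = "\<lambda>x. 1 - (1 + (b - x) + (b - x)\<^sup>2 / 2) * exp (x - b)"
  let ?l1 = "\<lambda>x. - ((b - x)\<^sup>2 / 2) * exp (x - b)"
  let ?l2 = "\<lambda>x. ((b - x) - (b - x)\<^sup>2 / 2) * exp (x - b)"
  have d: "(h has_real_derivative (if x \<le> b then ?l1 x else 0)) (at x)" for x
    unfolding h_def
    by (rule has_real_derivative_glue[where S=UNIV]) (auto intro!: derivative_eq_intros simp: field_simps power2_eq_square)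
  have d1: "((\<lambda>x. if x \<le> b then ?l1 x else 0) has_real_derivative (if x \<le> b then ?l2 x else 0)) (at x)" for x
    by (rule has_real_derivative_glue[where S=UNIV]) (auto intro!: derivative_eq_intros simp: field_simps power2_eq_square)
  have c: "continuous_on UNIV (\<lambda>x. if x \<le> b then ?l2 x else 0)"
    by (rule continuous_on_glue_UNIV) (auto intro!: continuous_intros)
  have e: "0 \<le> b - x \<and> (b - x) * exp (x - b) \<le> 1 \<and> (b - x)\<^sup>2 / 2 * exp (x - b) \<le> 1
     \<and> (1 + (b - x) + (b - x)\<^sup>2 / 2) * exp (x - b) \<le> 1" if "x \<le> b" for x
  proof -
    define y where "y = b - x"
    have y: "0 \<le> y" using that by (simp add: y_def)
    have "1 + y + y\<^sup>2 / 2 \<le> exp y" by (rule exp_lower_Taylor_quadratic[OF y])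
    moreover have "0 \<le> y\<^sup>2 / 2" by simp
    ultimately have le: "y \<le> exp y" "y\<^sup>2 / 2 \<le> exp y" "1 + y + y\<^sup>2 / 2 \<le> exp y" using y by linarith+
    have *: "z * exp (x - b) \<le> 1" if "z \<le> exp y" for z
    proof -
      have "z * exp (x - b) \<le> exp y * exp (x - b)" using that by (rule mult_right_mono) simp
      also have "\<dots> = 1" by (simp add: y_def flip: exp_add)
      finally show ?thesis .
    qed
    show ?thesis unfolding y_def[symmetric] by (intro conjI y * le)
  qed
  have bd: "bounded (range h)"
    by (rule boundedI[of _ 1]) (use e in \<open>auto simp: h_def\<close>)
  have bd1: "bounded (range (\<lambda>x. if x \<le> b then ?l1 x else 0))"
    by (rule boundedI[of _ 1]) (use e in \<open>auto simp: abs_mult\<close>)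
  have bd2: "bounded (range (\<lambda>x. if x \<le> b then ?l2 x else 0))"
  proof -
    have "\<bar>((b - x) - (b - x)\<^sup>2 / 2) * exp (x - b)\<bar> \<le> 2" if "x \<le> b" for x
    proof -
    from e[OF that] have "0 \<le> (b - x) * exp (x - b)" "0 \<le> (b - x)\<^sup>2 / 2 * exp (x - b)"
      "(b - x) * exp (x - b) \<le> 1" "(b - x)\<^sup>2 / 2 * exp (x - b) \<le> 1" by auto
    then show ?thesis unfolding left_diff_distrib by linarith
    qed
    then show ?thesis by (intro boundedI[of _ 2]) auto
  qed
  note C2b_intro[OF d d1 c bd bd1 bd2]
  then show "C2b h" "deriv h = (\<lambda>x. if x \<le> b then ?l1 x else 0)"
    "deriv (deriv h) = (\<lambda>x. if x \<le> b then ?l2 x else 0)" by auto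
  show "(b - x) ^ 3 / 6 * exp (x - b) \<le> h x \<or> b < x"
  proof (cases "x \<le> b")
    case True
    then have "1 + (b - x) + (b - x)\<^sup>2 / 2 + (b - x) ^ 3 / 6 \<le> exp (b - x)"
      by (intro exp_lower_Taylor_cubic) simp
    then have "(1 + (b - x) + (b - x)\<^sup>2 / 2 + (b - x) ^ 3 / 6) * exp (x - b) \<le> exp (b - x) * exp (x - b)"
      by (rule mult_right_mono) simp
    also have "\<dots> = 1" by (simp flip: exp_add)
    finally show ?thesis using True by (simp add: h_def algebra_simps)
  qed simp
qed

text \<open>Once |sin(a/2)| stays below 1, \<open>a\<close> cannot reach an odd multiple of pi, so
  by continuity it remains within pi of one multiple of 2 pi, where arcsin inverts the sine.\<close>

lemma tendsto_multiple_of_2pi: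
  fixes a :: "real \<Rightarrow> real"
  assumes c: "continuous_on {0..} a" and s: "((\<lambda>t. sin (a t / 2)) \<longlongrightarrow> 0) at_top"
  obtains j :: int where "(a \<longlongrightarrow> 2 * pi * of_int j) at_top"
proof -
  have "\<forall>\<^sub>F t in at_top. dist (sin (a t / 2)) 0 < 1" using tendstoD[OF s, of 1] by simp
  then obtain T0 where T0: "\<And>t. T0 \<le> t \<Longrightarrow> \<bar>sin (a t / 2)\<bar> < 1"
    unfolding eventually_at_top_linorder by auto
  define T where "T = max 0 T0"
  have T: "0 \<le> T" "\<And>t. T \<le> t \<Longrightarrow> \<bar>sin (a t / 2)\<bar> < 1" using T0 by (auto simp: T_def)
  define j where "j = round (a T / (2 * pi))"
  define d where "d = (\<lambda>t. a t - 2 * pi * of_int j)"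
  have sd: "\<bar>sin (d t / 2)\<bar> = \<bar>sin (a t / 2)\<bar>" for t
    using sin_half_shift[of "a t" j] unfolding d_def by (metis power2_eq_iff abs_minus_cancel)
  have no: "\<bar>d t\<bar> \<noteq> pi" if "T \<le> t" for t
  proof
    assume "\<bar>d t\<bar> = pi"
    then have "d t = pi \<or> d t = - pi" by linarith
    then have "\<bar>sin (d t / 2)\<bar> = 1" by auto
    with T(2)[OF that] sd show False by simp
  qed
  \<comment> \<open>Rounding gives only distance at most pi; equality is then excluded by
    \<open>no\<close>.\<close>
  have "\<bar>of_int j - a T / (2 * pi)\<bar> \<le> 1 / 2" unfolding j_def by (rule of_int_round_abs_le)
  then have "2 * pi * \<bar>of_int j - a T / (2 * pi)\<bar> \<le> pi" by (simp add: field_simps)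
  moreover have "2 * pi * \<bar>of_int j - a T / (2 * pi)\<bar> = \<bar>d T\<bar>"
  proof -
    have "2 * pi * \<bar>of_int j - a T / (2 * pi)\<bar> = \<bar>2 * pi * (of_int j - a T / (2 * pi))\<bar>" by (simp add: abs_mult)
    also have "2 * pi * (of_int j - a T / (2 * pi)) = - d T" by (simp add: d_def field_simps)
    finally show ?thesis by simp
  qed
  ultimately have dT: "\<bar>d T\<bar> \<le> pi" by simp
  have dt: "\<bar>d t\<bar> < pi" if Tt: "T \<le> t" for t
  proof (rule ccontr)
    assume "\<not> \<bar>d t\<bar> < pi"
    moreover have "continuous_on {T..t} (\<lambda>t. \<bar>d t\<bar>)"
      unfolding d_def by (intro continuous_intros continuous_on_subset[OF c]) (use T in auto)
    ultimately obtain x where "T \<le> x" "x \<le> t" "\<bar>d x\<bar> = pi"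
      using IVT'[of "\<lambda>t. \<bar>d t\<bar>" T pi t] dT Tt by auto
    with no show False by blast
  qed
  have "((\<lambda>t. \<bar>sin (d t / 2)\<bar>) \<longlongrightarrow> 0) at_top" using tendsto_rabs_zero[OF s] by (simp add: sd)
  then have "((\<lambda>t. sin (d t / 2)) \<longlongrightarrow> 0) at_top" by (rule tendsto_rabs_zero_cancel)
  then have "((\<lambda>t. 2 * arcsin (sin (d t / 2))) \<longlongrightarrow> 2 * arcsin 0) at_top"
    by (intro tendsto_mult tendsto_const isCont_tendsto_compose[OF isCont_arcsin]) auto
  then have "((\<lambda>t. 2 * arcsin (sin (d t / 2))) \<longlongrightarrow> 0) at_top" by simp
  moreover have "\<forall>\<^sub>F t in at_top. 2 * arcsin (sin (d t / 2)) = d t"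
    using eventually_ge_at_top[of T]
  proof eventually_elim
    case (elim t)
    then show ?case using dt[OF elim] by (subst arcsin_sin) auto
  qed
  ultimately have "(d \<longlongrightarrow> 0) at_top" by (simp cong: tendsto_cong)
  then have "((\<lambda>t. d t + 2 * pi * of_int j) \<longlongrightarrow> 0 + 2 * pi * of_int j) at_top" by (intro tendsto_intros)
  then show thesis by (intro that[of j]) (simp add: d_def)
qed

lemma sqrt_sin_function:
  fixes \<delta> :: real
  assumes \<delta>: "0 < \<delta>"
  defines "\<phi> \<equiv> \<lambda>x. sqrt (\<delta> + (sin (x / 2))\<^sup>2)"
  shows "C2b \<phi>" "deriv \<phi> x = sin (x / 2) * cos (x / 2) / (2 * \<phi> x)"
    "deriv (deriv \<phi>) x = ((cos (x / 2))\<^sup>2 - (sin (x / 2))\<^sup>2) / (4 * \<phi> x) - (sin (x / 2) * cos (x / 2))\<^sup>2 / (4 * \<phi> x ^ 3)"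
proof -
  have p: "0 < \<delta> + (sin (x / 2))\<^sup>2" for x using \<delta> by (simp add: add_pos_nonneg)
  have \<phi>p: "0 < \<phi> x" for x using p by (simp add: \<phi>_def)
  have \<phi>0: "sqrt \<delta> \<le> \<phi> x" for x by (simp add: \<phi>_def)
  define p1 where "p1 = (\<lambda>x. sin (x / 2) * cos (x / 2) / (2 * \<phi> x))"
  define p2 where "p2 = (\<lambda>x. ((cos (x / 2))\<^sup>2 - (sin (x / 2))\<^sup>2) / (4 * \<phi> x) - (sin (x / 2) * cos (x / 2))\<^sup>2 / (4 * \<phi> x ^ 3))"
  have d: "(\<phi> has_real_derivative p1 x) (at x)" for x
    unfolding p1_def \<phi>_def using p[of x]
    by (auto intro!: derivative_eq_intros simp: field_simps)
  have d1: "(p1 has_real_derivative p2 x) (at x)" for x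
  proof -
    have "(p1 has_real_derivative (((cos (x / 2) * (1/2)) * cos (x / 2) + sin (x / 2) * (- sin (x / 2) * (1/2))) * (2 * \<phi> x)
        - sin (x / 2) * cos (x / 2) * (2 * p1 x)) / ((2 * \<phi> x) * (2 * \<phi> x))) (at x)"
      unfolding p1_def[abs_def] using \<phi>p[of x] d[of x]
      by (auto intro!: derivative_eq_intros simp: p1_def)
    moreover have "(((cos (x / 2) * (1/2)) * cos (x / 2) + sin (x / 2) * (- sin (x / 2) * (1/2))) * (2 * \<phi> x)
        - sin (x / 2) * cos (x / 2) * (2 * p1 x)) / ((2 * \<phi> x) * (2 * \<phi> x)) = p2 x"
      unfolding p1_def p2_def using \<phi>p[of x]
      by (simp add: divide_simps power2_eq_square power3_eq_cube)
    ultimately show ?thesis by simp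
  qed
  have c\<phi>: "continuous_on UNIV \<phi>" unfolding \<phi>_def by (intro continuous_intros) auto
  have c: "continuous_on UNIV p2" unfolding p2_def
    using \<phi>p by (auto intro!: continuous_intros c\<phi> simp: less_imp_neq[symmetric])
  \<comment> \<open>The function and its two derivatives are continuous functions of (sin, cos),
    which ranges in the compact square; \<delta> > 0 keeps the denominators away from zero.\<close>
  have bd: "bounded (range (\<lambda>x. \<Phi> (sin (x / 2), cos (x / 2))))"
    if "continuous_on ({-1..1} \<times> {-1..1}) \<Phi>" for \<Phi> :: "real \<times> real \<Rightarrow> real"
    by (rule bounded_subset[OF compact_imp_bounded[OF compact_continuous_image[OF that]]])
      (auto intro: compact_Times)
  have pz: "\<delta> + z\<^sup>2 \<noteq> 0" "0 < \<delta> + z\<^sup>2" for z using \<delta> add_pos_nonneg[of \<delta> "z\<^sup>2"] by auto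
  have "bounded (range \<phi>)"
    using bd[of "\<lambda>z. sqrt (\<delta> + (fst z)\<^sup>2)"] by (simp add: \<phi>_def continuous_intros)
  moreover have "bounded (range p1)"
    using bd[of "\<lambda>z. fst z * snd z / (2 * sqrt (\<delta> + (fst z)\<^sup>2))"] pz
    by (simp add: \<phi>_def p1_def continuous_intros)
  moreover have "bounded (range p2)"
    using bd[of "\<lambda>z. ((snd z)\<^sup>2 - (fst z)\<^sup>2) / (4 * sqrt (\<delta> + (fst z)\<^sup>2)) - (fst z * snd z)\<^sup>2 / (4 * sqrt (\<delta> + (fst z)\<^sup>2) ^ 3)"] pz
    by (simp add: \<phi>_def p2_def continuous_intros)
  ultimately have "C2b \<phi>" "deriv \<phi> = p1" "deriv (deriv \<phi>) = p2"
    using C2b_intro[OF d d1 c] by auto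
  then show "C2b \<phi>" "deriv \<phi> x = sin (x / 2) * cos (x / 2) / (2 * \<phi> x)"
    "deriv (deriv \<phi>) x = ((cos (x / 2))\<^sup>2 - (sin (x / 2))\<^sup>2) / (4 * \<phi> x) - (sin (x / 2) * cos (x / 2))\<^sup>2 / (4 * \<phi> x ^ 3)"
    by (simp_all add: p1_def p2_def)
qed

context carousel
begin

text \<open>At a multiple of \<open>2 \<pi>\<close> the noise vanishes and the drift is nonnegative, so it cannot be crossed downwards.\<close>
lemma level_stays:
  fixes j :: int
  assumes st: "0 \<le> s" "s \<le> t"
  shows "AE \<omega> in M. 2 * pi * of_int j \<le> alpha s \<omega> \<longrightarrow> 2 * pi * of_int j \<le> alpha t \<omega>"
proof -
  define b where "b = 2 * pi * of_int j"
  define h where "h = (\<lambda>x. if x \<le> b then 1 - (1 + (b - x) + (b - x)\<^sup>2 / 2) * exp (x - b) else 0)"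
  note B = barrier_function[of b, folded h_def]
  define A where "A = {\<omega> \<in> space M. b \<le> alpha s \<omega>}"
  have A: "A \<in> sets (F s)"
    using measurable_sets[OF alpha_adapted[OF st(1)], of "{b..}"] by (auto simp: A_def space_F vimage_def Int_def conj_commute)
  have hpos: "0 \<le> h x" "x < b \<Longrightarrow> 0 < h x" for x
  proof -
    show *: "0 < h x" if "x < b"
    proof -
      have "0 < (b - x) ^ 3 / 6 * exp (x - b)" using that by simp
      then show ?thesis unfolding h_def using B(4)[of x] that by linarith
    qed
    show "0 \<le> h x"
    proof (cases "x < b")
      case True then show ?thesis using * by simp
    qed (simp add: h_def)
  qed
  have gen_le: "gen h u x \<le> 3 * h x" if u: "0 \<le> u" for u x
  proof (cases "x \<le> b")
    case False
    then show ?thesis unfolding gen_def B(3) unfolding B(2) by (simp add: h_def)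
  next
    case True
    define y where "y = b - x"
    have y: "0 \<le> y" using True by (simp add: y_def)
    have "(x - 2 * pi * of_int j) / 2 = - (y / 2)" by (simp add: y_def b_def field_simps)
    then have "(sin (x / 2))\<^sup>2 = (sin (- (y / 2)))\<^sup>2"
      using sin_half_shift[of x j] by metis
    also have "\<dots> \<le> (y / 2)\<^sup>2" using sin_sq_le[of "y / 2"] by simp
    finally have s: "2 * (sin (x / 2))\<^sup>2 \<le> y\<^sup>2 / 2" by (simp add: power_divide)
    \<comment> \<open>The squared noise is at most y^2/2 near the level and the second derivative of
      \<open>h\<close> at most y exp(-y), so the product is at most y^3 exp(-y)/2, three times the
      cubic lower bound of \<open>h\<close>. The drift term has the favourable sign because
      \<open>h\<close> decreases.\<close>
    have "2 * (sin (x / 2))\<^sup>2 * ((y - y\<^sup>2 / 2) * exp (x - b)) \<le> 2 * (sin (x / 2))\<^sup>2 * (y * exp (x - b))"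
      by (intro mult_left_mono mult_right_mono) auto
    also have "\<dots> \<le> y\<^sup>2 / 2 * (y * exp (x - b))"
      using s y by (intro mult_right_mono) auto
    also have "\<dots> = 3 * (y ^ 3 / 6 * exp (x - b))" by (simp add: power2_eq_square power3_eq_cube)
    also have "\<dots> \<le> 3 * h x"
    proof -
      have "(b - x) ^ 3 / 6 * exp (x - b) \<le> h x" unfolding h_def using B(4)[of x] True by linarith
      then show ?thesis unfolding y_def by (rule mult_left_mono) simp
    qed
    finally have 1: "2 * (sin (x / 2))\<^sup>2 * ((y - y\<^sup>2 / 2) * exp (x - b)) \<le> 3 * h x" .
    have "0 \<le> lam * f u * (y\<^sup>2 / 2 * exp (x - b))"
      using lam_nonneg f_nonneg[OF u] by (intro mult_nonneg_nonneg) auto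
    with 1 show ?thesis using True unfolding gen_def B(3) unfolding B(2) y_def by simp
  qed
  have le: "(\<integral>\<omega>. indicator A \<omega> * h (alpha t \<omega>) \<partial>M) \<le> exp (- (-3) * (t - s)) * (\<integral>\<omega>. indicator A \<omega> * h (alpha s \<omega>) \<partial>M)"
    by (rule gronwall_upper[OF B(1) st A]) (use gen_le st in auto)
  \<comment> \<open>On \<open>A\<close> the path starts where \<open>h\<close> vanishes, so
    exponential growth from zero leaves zero.\<close>
  have "(\<integral>\<omega>. indicator A \<omega> * h (alpha s \<omega>) \<partial>M) = (\<integral>\<omega>. 0 \<partial>M)"
    by (rule Bochner_Integration.integral_cong) (auto simp: A_def h_def indicator_def)
  with le have "(\<integral>\<omega>. indicator A \<omega> * h (alpha t \<omega>) \<partial>M) \<le> 0" by simp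
  moreover have nn: "AE \<omega> in M. 0 \<le> indicator A \<omega> * h (alpha t \<omega>)" using hpos by (auto simp: indicator_def)
  ultimately have "(\<integral>\<omega>. indicator A \<omega> * h (alpha t \<omega>) \<partial>M) = 0"
    using integral_nonneg_AE[OF nn] by simp
  moreover obtain K where K: "\<forall>x. \<bar>h x\<bar> \<le> K" using C2b_bounded[OF B(1)] ..
  have "integrable M (\<lambda>\<omega>. indicator A \<omega> * h (alpha t \<omega>))"
    by (rule integrable_test[OF C2b_continuous(1)[OF B(1)] K[rule_format] F_sets[OF A]]) (use st in auto)
  ultimately have "AE \<omega> in M. indicator A \<omega> * h (alpha t \<omega>) = 0"
    using integral_nonneg_eq_0_iff_AE[OF _ nn] by blast
  then show ?thesis using AE_space
  proof eventually_elim
    case (elim \<omega>)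
    then show ?case using hpos(2)[of "alpha t \<omega>"] by (cases "alpha t \<omega> < b") (auto simp: A_def b_def indicator_def split: if_splits)
  qed
qed

lemma alpha_nonneg: "0 \<le> t \<Longrightarrow> AE \<omega> in M. 0 \<le> alpha t \<omega>"
  using level_stays[of 0 t 0] AE_space by (auto elim!: AE_mp simp: alpha_0)

section \<open>Almost sure convergence of |sin(\<alpha>/2)| to zero\<close>

definition sn :: "real \<Rightarrow> 'a \<Rightarrow> real" where "sn t \<omega> = \<bar>sin (alpha t \<omega> / 2)\<bar>"

text \<open>The most that the drift can add to |sin(\<alpha>/2)| between \<open>s\<close> and
  \<open>t\<close>: the slope is at most 1/2 and \<open>f u\<close> at most c/(1 + u^2).\<close>

definition slack :: "real \<Rightarrow> real \<Rightarrow> real" where "slack s t = lam * c / 2 * (arctan t - arctan s)"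

lemma slack_nonneg: "s \<le> t \<Longrightarrow> 0 \<le> slack s t"
  using lam_nonneg c_nonneg by (simp add: slack_def arctan_le_iff)

text \<open>\<open>\<bar>sin(x/2)\<bar>\<close> is concave between its zeros, and at the zeros the vanishing noise produces no local
  time: smoothing it to \<open>sqrt(\<delta> + sin\<^sup>2(x/2))\<close> costs only \<open>sqrt \<delta> / 2\<close> per unit of time.\<close>
lemma sin_decreases:
  assumes st: "0 \<le> s" "s \<le> t" and A: "A \<in> sets (F s)"
  shows "(\<integral>\<omega>. indicator A \<omega> * sn t \<omega> \<partial>M) + (LBINT u:{s<..t}. \<integral>\<omega>. indicator A \<omega> * (sn u \<omega> ^ 4 / 4) \<partial>M)
    \<le> (\<integral>\<omega>. indicator A \<omega> * sn s \<omega> \<partial>M) + slack s t"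
proof (rule field_le_epsilon)
  fix e :: real assume e: "0 < e"
  \<comment> \<open>The two losses, \<open>r\<close> from smoothing at the initial time and at most
    \<open>r * (t - s)\<close> accumulated by the smoothing error, together fit into
    \<open>e\<close>.\<close>
  define r where "r = min 1 (e / (1 + (t - s)))"
  have r: "0 < r" "r \<le> 1" "r * (1 + (t - s)) \<le> e"
    using e st by (auto simp: r_def min_def divide_simps mult.commute)
  define \<delta> where "\<delta> = r\<^sup>2"
  define \<phi> where "\<phi> = (\<lambda>x. sqrt (\<delta> + (sin (x / 2))\<^sup>2))"
  have \<delta>: "0 < \<delta>" "sqrt \<delta> = r" "\<delta> \<le> 1" using r by (auto simp: \<delta>_def power_le_one)
  note P = sqrt_sin_function[OF \<delta>(1), folded \<phi>_def]
  have \<phi>2: "\<phi> x ^ 2 = \<delta> + (sin (x / 2))\<^sup>2" for x using \<delta> by (simp add: \<phi>_def)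
  have \<phi>pos: "r \<le> \<phi> x" "0 < \<phi> x" "\<bar>sin (x / 2)\<bar> \<le> \<phi> x" "\<phi> x \<le> r + \<bar>sin (x / 2)\<bar>" for x
  proof -
    show "r \<le> \<phi> x" unfolding \<phi>_def \<delta>(2)[symmetric] by simp
    then show "0 < \<phi> x" using r by simp
    show "\<bar>sin (x / 2)\<bar> \<le> \<phi> x" unfolding \<phi>_def using \<delta>(1) by (intro real_le_rsqrt) simp
    show "\<phi> x \<le> r + \<bar>sin (x / 2)\<bar>" unfolding \<phi>_def using r
      by (intro real_le_lsqrt) (auto simp: power2_sum \<delta>_def)
  qed
  have gen_le: "gen \<phi> u x \<le> lam * c / 2 / (1 + u\<^sup>2) + r / 2 - \<bar>sin (x / 2)\<bar> ^ 4 / 4" if u: "0 \<le> u" for u x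
  proof -
    define S C p where "S = sin (x / 2)" and "C = cos (x / 2)" and "p = \<phi> x"
    have SC: "C\<^sup>2 = 1 - S\<^sup>2" by (simp add: S_def C_def cos_squared_eq)
    have p: "0 < p" "r \<le> p" "\<bar>S\<bar> \<le> p" "p\<^sup>2 = \<delta> + S\<^sup>2" using \<phi>pos[of x] \<phi>2[of x] by (auto simp: p_def S_def)
    have "\<bar>S * C / (2 * p)\<bar> \<le> 1 / 2"
    proof -
      have "\<bar>S * C\<bar> \<le> p * 1" unfolding abs_mult using p by (intro mult_mono) (auto simp: C_def)
      then show ?thesis using p by (simp add: abs_mult)
    qed
    then have "f u * (S * C / (2 * p)) \<le> f u * (1 / 2)"
      by (intro mult_left_mono[OF _ f_nonneg[OF u]]) (rule abs_le_D1)
    also have "\<dots> \<le> c / (1 + u\<^sup>2) * (1 / 2)" using f_bound[OF u] by (intro mult_right_mono) auto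
    finally have "lam * (f u * (S * C / (2 * p))) \<le> lam * (c / (1 + u\<^sup>2) * (1 / 2))"
      using lam_nonneg by (rule mult_left_mono)
    then have 1: "lam * f u * (S * C / (2 * p)) \<le> lam * c / 2 / (1 + u\<^sup>2)"
      by (simp only: divide_inverse ac_simps mult_1_left)
    \<comment> \<open>Since p^2 - S^2 = \<delta>, the first term is a pure smoothing error; the
      second is the loss that survives as \<delta> tends to 0.\<close>
    have "2 * S\<^sup>2 * ((C\<^sup>2 - S\<^sup>2) / (4 * p) - (S * C)\<^sup>2 / (4 * p ^ 3)) = S\<^sup>2 * C\<^sup>2 * (p\<^sup>2 - S\<^sup>2) / (2 * p ^ 3) - S ^ 4 / (2 * p)"
      using p(1) by (simp add: field_simps power2_eq_square power3_eq_cube power4_eq_xxxx)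
    also have "\<dots> = S\<^sup>2 * C\<^sup>2 * \<delta> / (2 * p ^ 3) - S ^ 4 / (2 * p)" by (simp add: p(4))
    finally have 2: "2 * S\<^sup>2 * ((C\<^sup>2 - S\<^sup>2) / (4 * p) - (S * C)\<^sup>2 / (4 * p ^ 3))
      = S\<^sup>2 * C\<^sup>2 * \<delta> / (2 * p ^ 3) - S ^ 4 / (2 * p)" .
    have 3: "S\<^sup>2 * C\<^sup>2 * \<delta> / (2 * p ^ 3) \<le> r / 2"
    proof -
      have "S\<^sup>2 * C\<^sup>2 * \<delta> \<le> p\<^sup>2 * 1 * (r * p)"
      proof (intro mult_mono)
        show "S\<^sup>2 \<le> p\<^sup>2" using p(4) \<delta>(1) by simp
        show "C\<^sup>2 \<le> 1" using SC by simp
        show "\<delta> \<le> r * p" using p(2) r(1) by (simp add: \<delta>_def power2_eq_square)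
      qed (use \<delta>(1) in auto)
      then have "S\<^sup>2 * C\<^sup>2 * \<delta> \<le> r * p ^ 3" by (simp add: power2_eq_square power3_eq_cube ac_simps)
      then show ?thesis using p(1) by (simp add: divide_simps)
    qed
    \<comment> \<open>p^2 = \<delta> + S^2 is at most 2, so p \<le> 2 gives a loss free of
      \<delta>.\<close>
    have 4: "S ^ 4 / 4 \<le> S ^ 4 / (2 * p)"
    proof -
      have "p\<^sup>2 \<le> 2\<^sup>2" using p(4) \<delta>(3) SC zero_le_power2[of C] by simp
      then have "p \<le> 2" by (rule power2_le_imp_le) simp
      then show ?thesis using p(1) by (intro divide_left_mono) auto
    qed
    have "2 * S\<^sup>2 * ((C\<^sup>2 - S\<^sup>2) / (4 * p) - (S * C)\<^sup>2 / (4 * p ^ 3)) \<le> r / 2 - S ^ 4 / 4"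
      using 2 3 4 by linarith
    moreover have "sqrt (\<delta> + S\<^sup>2) = p" by (simp add: p_def \<phi>_def S_def)
    ultimately show ?thesis using 1 unfolding gen_def P(2,3) S_def[symmetric] C_def[symmetric]
      by simp
  qed
  have qc: "continuous_on UNIV (\<lambda>x::real. \<bar>sin (x / 2)\<bar> ^ 4 / 4)" by (intro continuous_intros) auto
  have qb: "\<bar>\<bar>sin (x / 2)\<bar> ^ 4 / 4\<bar> \<le> 1" for x :: real
    using power_le_one[of "\<bar>sin (x / 2)\<bar>" 4] by simp
  have dyn: "(\<integral>\<omega>. indicator A \<omega> * \<phi> (alpha t \<omega>) \<partial>M) + (LBINT u:{s<..t}. \<integral>\<omega>. indicator A \<omega> * (sn u \<omega> ^ 4 / 4) \<partial>M)
    \<le> (\<integral>\<omega>. indicator A \<omega> * \<phi> (alpha s \<omega>) \<partial>M) + measure M A * (slack s t + r / 2 * (t - s))"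
    unfolding sn_def slack_def by (rule dynkin_le[OF P(1) st A qc qb]) (use gen_le st in auto)
  obtain K where K: "\<forall>x. \<bar>\<phi> x\<bar> \<le> K" using C2b_bounded[OF P(1)] ..
  have i\<phi>: "integrable M (\<lambda>\<omega>. indicator A \<omega> * \<phi> (alpha u \<omega>))" if "0 \<le> u" for u
    by (rule integrable_test[OF C2b_continuous(1)[OF P(1)] K[rule_format] F_sets[OF A] that])
  have isn: "integrable M (\<lambda>\<omega>. indicator A \<omega> * sn u \<omega>)" if "0 \<le> u" for u
    unfolding sn_def by (rule integrable_test[OF _ _ F_sets[OF A] that, of "\<lambda>x. \<bar>sin (x / 2)\<bar>" 1]) (auto intro!: continuous_intros)
  have t0: "0 \<le> t" using st by simp
  have 1: "(\<integral>\<omega>. indicator A \<omega> * sn t \<omega> \<partial>M) \<le> (\<integral>\<omega>. indicator A \<omega> * \<phi> (alpha t \<omega>) \<partial>M)"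
    by (rule integral_mono[OF isn[OF t0] i\<phi>[OF t0]]) (auto intro!: mult_left_mono \<phi>pos simp: sn_def)
  have "(\<integral>\<omega>. indicator A \<omega> * \<phi> (alpha s \<omega>) \<partial>M) \<le> (\<integral>\<omega>. r + indicator A \<omega> * sn s \<omega> \<partial>M)"
    by (rule integral_mono[OF i\<phi>[OF st(1)]]) (use isn[OF st(1)] \<phi>pos(4) r in \<open>auto simp: sn_def indicator_def\<close>)
  also have "\<dots> = r + (\<integral>\<omega>. indicator A \<omega> * sn s \<omega> \<partial>M)" using isn[OF st(1)] by (simp add: prob_space)
  finally have 2: "(\<integral>\<omega>. indicator A \<omega> * \<phi> (alpha s \<omega>) \<partial>M) \<le> r + (\<integral>\<omega>. indicator A \<omega> * sn s \<omega> \<partial>M)" .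
  have "measure M A * (slack s t + r / 2 * (t - s)) \<le> 1 * (slack s t + r / 2 * (t - s))"
    using slack_nonneg[OF st(2)] r st by (intro mult_right_mono) auto
  also have "\<dots> \<le> slack s t + r * (t - s)" using r st by simp
  finally have 3: "measure M A * (slack s t + r / 2 * (t - s)) \<le> slack s t + r * (t - s)" .
  have "r + r * (t - s) \<le> e" using r(3) by (simp add: algebra_simps)
  then show "(\<integral>\<omega>. indicator A \<omega> * sn t \<omega> \<partial>M) + (LBINT u:{s<..t}. \<integral>\<omega>. indicator A \<omega> * (sn u \<omega> ^ 4 / 4) \<partial>M)
    \<le> (\<integral>\<omega>. indicator A \<omega> * sn s \<omega> \<partial>M) + slack s t + e"
    using dyn 1 2 3 by linarith
qed

lemma sn_bounds: "0 \<le> sn t \<omega>" "sn t \<omega> \<le> 1"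
  by (auto simp: sn_def)

lemma sn_adapted: "0 \<le> t \<Longrightarrow> sn t \<in> borel_measurable (F t)"
  unfolding sn_def using alpha_adapted[of t] by measurable

lemma sn_meas [measurable]: "0 \<le> t \<Longrightarrow> sn t \<in> borel_measurable M"
  using measurable_from_subalg[OF subalgebra_F sn_adapted] .

lemma sn_integrable: "0 \<le> t \<Longrightarrow> A \<in> sets M \<Longrightarrow> integrable M (\<lambda>\<omega>. indicator A \<omega> * sn t \<omega>)"
  unfolding sn_def
  by (rule integrable_test[of "\<lambda>x. \<bar>sin (x / 2)\<bar>" 1]) (auto intro!: continuous_intros)

lemma sin_supermartingale:
  assumes "0 \<le> s" "s \<le> t" "A \<in> sets (F s)"
  shows "(\<integral>\<omega>. indicator A \<omega> * sn t \<omega> \<partial>M) \<le> (\<integral>\<omega>. indicator A \<omega> * sn s \<omega> \<partial>M) + slack s t"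
proof -
  have "0 \<le> (LBINT u:{s<..t}. \<integral>\<omega>. indicator A \<omega> * (sn u \<omega> ^ 4 / 4) \<partial>M)"
    unfolding set_lebesgue_integral_def by (intro integral_nonneg_AE AE_I2) (auto intro!: integral_nonneg_AE simp: sn_bounds)
  then show ?thesis using sin_decreases[OF assms] by linarith
qed

lemma slack_add: "slack r s + slack s t = slack r t"
  by (simp add: slack_def flip: distrib_left)

lemma slack_le: "slack s t \<le> lam * c / 2 * (pi / 2 - arctan s)"
proof -
  have "arctan t - arctan s \<le> pi / 2 - arctan s" using arctan_ubound[of t] by simp
  then show ?thesis unfolding slack_def using lam_nonneg c_nonneg by (intro mult_left_mono) auto
qed

text \<open>The loss terms have a bounded total, at most 1 plus the remaining drift. Were the mean
  to stay above \<open>e\<close>, the loss per unit of time would stay above a positive constant and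
  its total would grow linearly.\<close>

lemma mean_sin_small:
  assumes e: "0 < e" and N: "0 \<le> N"
  shows "\<exists>u\<ge>N. (\<integral>\<omega>. sn u \<omega> \<partial>M) < e"
proof (rule ccontr)
  assume neg: "\<not> (\<exists>u\<ge>N. (\<integral>\<omega>. sn u \<omega> \<partial>M) < e)"
  have big: "e \<le> (\<integral>\<omega>. sn u \<omega> \<partial>M)" if "N \<le> u" for u using that neg by force
  have sp: "space M \<in> sets (F N)" using sets.top[of "F N"] by (simp add: space_F)
  have ispc: "(\<integral>\<omega>. indicator (space M) \<omega> * h \<omega> \<partial>M) = (\<integral>\<omega>. h \<omega> \<partial>M)" for h :: "'a \<Rightarrow> real"
    by (rule Bochner_Integration.integral_cong) auto
  define r where "r = (e / 2) ^ 4"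
  have r: "0 < r" using e by (simp add: r_def)
  have i4: "integrable M (\<lambda>\<omega>. sn u \<omega> ^ 4 / 4)" if "0 \<le> u" for u
    by (rule integrable_const_bound[of _ 1]) (use sn_bounds that in \<open>auto simp: power_le_one order_trans[OF power_le_one]\<close>)
  have i1: "integrable M (sn u)" if "0 \<le> u" for u
    by (rule integrable_const_bound[of _ 1]) (use sn_bounds that in auto)
  have low: "r / 4 \<le> (\<integral>\<omega>. sn u \<omega> ^ 4 / 4 \<partial>M)" if u: "N \<le> u" for u
  proof -
    have u0: "0 \<le> u" using N u by simp
    \<comment> \<open>An elementary substitute for Jensen's inequality: either x is below e/2, or x
      (e/2)^3 is at most x^4.\<close>
    have pt: "x \<le> e / 2 + x ^ 4 / (e / 2) ^ 3" if "0 \<le> x" for x :: real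
    proof (cases "x \<le> e / 2")
      case True
      then show ?thesis using e that by (intro add_increasing2) auto
    next
      case False
      then have "x * (e / 2) ^ 3 \<le> x * x ^ 3" using e that by (intro mult_left_mono power_mono) auto
      then have "x \<le> x ^ 4 / (e / 2) ^ 3" using e by (simp add: pos_le_divide_eq power4_eq_xxxx power3_eq_cube mult.assoc)
      then show ?thesis using e by linarith
    qed
    have "e \<le> (\<integral>\<omega>. sn u \<omega> \<partial>M)" by (rule big[OF u])
    also have "\<dots> \<le> (\<integral>\<omega>. e / 2 + 4 / (e / 2) ^ 3 * (sn u \<omega> ^ 4 / 4) \<partial>M)"
    proof (rule integral_mono[OF i1[OF u0]])
      show "integrable M (\<lambda>\<omega>. e / 2 + 4 / (e / 2) ^ 3 * (sn u \<omega> ^ 4 / 4))"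
        by (intro Bochner_Integration.integrable_add integrable_mult_right i4[OF u0]) simp
    qed (use pt[OF sn_bounds(1)] in simp)
    also have "\<dots> = e / 2 + 4 / (e / 2) ^ 3 * (\<integral>\<omega>. sn u \<omega> ^ 4 / 4 \<partial>M)"
      by (subst Bochner_Integration.integral_add[OF _ integrable_mult_right[OF i4[OF u0]]]) (auto simp: prob_space)
    finally have "e / 2 \<le> 4 / (e / 2) ^ 3 * (\<integral>\<omega>. sn u \<omega> ^ 4 / 4 \<partial>M)" by linarith
    then have "(e / 2) ^ 3 / 4 * (e / 2) \<le> (e / 2) ^ 3 / 4 * (4 / (e / 2) ^ 3 * (\<integral>\<omega>. sn u \<omega> ^ 4 / 4 \<partial>M))"
      using e by (intro mult_left_mono) auto
    also have "\<dots> = (\<integral>\<omega>. sn u \<omega> ^ 4 / 4 \<partial>M)" using e by simp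
    also have "(e / 2) ^ 3 / 4 * (e / 2) = r / 4" by (simp add: r_def power4_eq_xxxx power3_eq_cube)
    finally show ?thesis .
  qed
  define C where "C = lam * c / 2 * (pi / 2 - arctan N)"
  have "r / 4 * (t - N) \<le> 1 + C" if t: "N \<le> t" for t
  proof -
    have q: "continuous_on UNIV (\<lambda>x::real. \<bar>sin (x / 2)\<bar> ^ 4 / 4)" "\<And>x::real. \<bar>\<bar>sin (x / 2)\<bar> ^ 4 / 4\<bar> \<le> 1"
    proof -
      show "\<bar>\<bar>sin (x / 2)\<bar> ^ 4 / 4\<bar> \<le> 1" for x :: real
        using power_le_one[of "\<bar>sin (x / 2)\<bar>" 4] by simp
    qed (auto intro!: continuous_intros)
    have "r / 4 * (t - N) = (LBINT u:{N<..t}. r / 4)" using t by (simp add: set_lebesgue_integral_def)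
    also have "\<dots> \<le> (LBINT u:{N<..t}. \<integral>\<omega>. indicator (space M) \<omega> * (sn u \<omega> ^ 4 / 4) \<partial>M)"
    proof (rule set_integral_mono)
      show "set_integrable lborel {N<..t} (\<lambda>u. \<integral>\<omega>. indicator (space M) \<omega> * (sn u \<omega> ^ 4 / 4) \<partial>M)"
        unfolding sn_def by (rule set_integrable_test[OF q _ N]) simp
      show "set_integrable lborel {N<..t} (\<lambda>u. r / 4)"
        using t by (simp add: set_integrable_def)
    qed (use low ispc in auto)
    also have "\<dots> \<le> (\<integral>\<omega>. indicator (space M) \<omega> * sn N \<omega> \<partial>M) + slack N t
        - (\<integral>\<omega>. indicator (space M) \<omega> * sn t \<omega> \<partial>M)"
      using sin_decreases[OF N t sp] by linarith
    finally have "r / 4 * (t - N) \<le> (\<integral>\<omega>. indicator (space M) \<omega> * sn N \<omega> \<partial>M) + slack N t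
        - (\<integral>\<omega>. indicator (space M) \<omega> * sn t \<omega> \<partial>M)" .
    moreover have "(\<integral>\<omega>. indicator (space M) \<omega> * sn N \<omega> \<partial>M) \<le> (\<integral>\<omega>. 1 \<partial>M)"
      unfolding ispc by (rule integral_mono[OF i1[OF N]]) (auto simp: sn_bounds)
    moreover have "0 \<le> (\<integral>\<omega>. indicator (space M) \<omega> * sn t \<omega> \<partial>M)"
      unfolding ispc by (intro integral_nonneg_AE AE_I2 sn_bounds)
    ultimately show ?thesis using slack_le[of N t] unfolding C_def
      by (simp add: prob_space del: times_divide_eq_left times_divide_eq_right)
  qed
  \<comment> \<open>At this time the left side is 2 + |C|, which exceeds 1 + C.\<close>
  from this[of "N + (4 / r) * (1 + \<bar>C\<bar> + 1)"] r show False
    by (simp add: add_nonneg_nonneg)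
qed

text \<open>Doob's inequality for a supermartingale with drift, without stopping times:
  \<open>B n\<close> is the event that the level has not been reached up to step \<open>n\<close>.
  The induction bounds \<eta> times the probability of having reached it plus the mean of the
  current value on \<open>B n\<close>.\<close>

lemma maximal_inequality:
  fixes \<tau> :: "nat \<Rightarrow> real"
  assumes \<tau>: "mono \<tau>" "0 \<le> \<tau> 0" and \<eta>: "0 < \<eta>"
  shows "\<eta> * prob {\<omega> \<in> space M. \<exists>i\<le>n. \<eta> \<le> sn (\<tau> i) \<omega>} \<le> (\<integral>\<omega>. sn (\<tau> 0) \<omega> \<partial>M) + slack (\<tau> 0) (\<tau> n)"
proof -
  define B where "B = (\<lambda>n. {\<omega> \<in> space M. \<forall>i\<le>n. sn (\<tau> i) \<omega> < \<eta>})"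
  have \<tau>0: "0 \<le> \<tau> i" for i using \<tau> monoD[OF \<tau>(1), of 0 i] by simp
  have BF: "B n \<in> sets (F (\<tau> n))" for n
  proof -
    have "B n = (\<Inter>i\<in>{..n}. {\<omega> \<in> space M. sn (\<tau> i) \<omega> < \<eta>})" by (auto simp: B_def)
    moreover have "{\<omega> \<in> space M. sn (\<tau> i) \<omega> < \<eta>} \<in> sets (F (\<tau> n))" if "i \<le> n" for i
    proof -
      have "{\<omega> \<in> space (F (\<tau> i)). sn (\<tau> i) \<omega> < \<eta>} \<in> sets (F (\<tau> i))"
        using sn_adapted[OF \<tau>0[of i]] by measurable
      then show ?thesis using F_mono[OF \<tau>0[of i] monoD[OF \<tau>(1) that]] by (auto simp: space_F)
    qed
    ultimately show ?thesis by (simp add: sets.finite_INT)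
  qed
  note BM [measurable] = F_sets[OF BF]
  have iB: "integrable M (indicat_real (B n))" for n
    by (rule integrable_real_indicator) (auto simp: less_top[symmetric])
  have i1: "integrable M (\<lambda>\<omega>. \<eta> * (1 - indicator (B n) \<omega>))" for n
    by (intro integrable_mult_right Bochner_Integration.integrable_diff iB) simp
  have i2: "integrable M (\<lambda>\<omega>. \<eta> * (indicator (B n) \<omega> - indicator (B m) \<omega>))" for n m
    by (intro integrable_mult_right Bochner_Integration.integrable_diff iB)
  note i3 = sn_integrable[OF \<tau>0 BM]
  have ind: "\<eta> * (1 - prob (B n)) + (\<integral>\<omega>. indicator (B n) \<omega> * sn (\<tau> n) \<omega> \<partial>M) \<le> (\<integral>\<omega>. sn (\<tau> 0) \<omega> \<partial>M) + slack (\<tau> 0) (\<tau> n)" for n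
  proof (induction n)
    case 0
    have "\<eta> * (1 - prob (B 0)) + (\<integral>\<omega>. indicator (B 0) \<omega> * sn (\<tau> 0) \<omega> \<partial>M) = (\<integral>\<omega>. \<eta> * (1 - indicator (B 0) \<omega>) + indicator (B 0) \<omega> * sn (\<tau> 0) \<omega> \<partial>M)"
      unfolding Bochner_Integration.integral_add[OF i1 i3] using Bochner_Integration.integral_diff[OF _ iB[of 0], of "\<lambda>_. 1"]
      by (simp add: prob_space)
    also have "\<dots> \<le> (\<integral>\<omega>. sn (\<tau> 0) \<omega> \<partial>M)"
    proof (rule integral_mono)
      show "integrable M (\<lambda>\<omega>. \<eta> * (1 - indicator (B 0) \<omega>) + indicator (B 0) \<omega> * sn (\<tau> 0) \<omega>)"
        by (rule Bochner_Integration.integrable_add[OF i1 i3])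
      show "integrable M (sn (\<tau> 0))"
        by (rule integrable_const_bound[of _ 1]) (use sn_bounds \<tau> in auto)
    qed (auto simp: B_def indicator_def)
    finally show ?case by (simp add: slack_def)
  next
    case (Suc n)
    have le: "\<tau> n \<le> \<tau> (Suc n)" using \<tau>(1) by (simp add: monoD)
    have sub: "B (Suc n) \<subseteq> B n" by (auto simp: B_def)
    \<comment> \<open>Paths lost between \<open>B n\<close> and \<open>B (Suc n)\<close> have value
      at least \<eta> at the new time, and pay for the increase of the probability.\<close>
    have "\<eta> * (prob (B n) - prob (B (Suc n))) + (\<integral>\<omega>. indicator (B (Suc n)) \<omega> * sn (\<tau> (Suc n)) \<omega> \<partial>M)
       = (\<integral>\<omega>. \<eta> * (indicator (B n) \<omega> - indicator (B (Suc n)) \<omega>) + indicator (B (Suc n)) \<omega> * sn (\<tau> (Suc n)) \<omega> \<partial>M)"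
      unfolding Bochner_Integration.integral_add[OF i2 i3] using Bochner_Integration.integral_diff[OF iB[of n] iB[of "Suc n"]]
      by simp
    also have "\<dots> \<le> (\<integral>\<omega>. indicator (B n) \<omega> * sn (\<tau> (Suc n)) \<omega> \<partial>M)"
    proof (rule integral_mono)
      show "integrable M (\<lambda>\<omega>. \<eta> * (indicator (B n) \<omega> - indicator (B (Suc n)) \<omega>) + indicator (B (Suc n)) \<omega> * sn (\<tau> (Suc n)) \<omega>)"
        by (rule Bochner_Integration.integrable_add[OF i2 i3])
      show "integrable M (\<lambda>\<omega>. indicator (B n) \<omega> * sn (\<tau> (Suc n)) \<omega>)"
        by (rule sn_integrable[OF \<tau>0 BM])
      fix \<omega> assume "\<omega> \<in> space M"
      then show "\<eta> * (indicator (B n) \<omega> - indicator (B (Suc n)) \<omega>) + indicator (B (Suc n)) \<omega> * sn (\<tau> (Suc n)) \<omega>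
          \<le> indicator (B n) \<omega> * sn (\<tau> (Suc n)) \<omega>"
        using sn_bounds[of "\<tau> (Suc n)" \<omega>] by (auto simp: B_def indicator_def le_Suc_eq)
    qed
    also have "\<dots> \<le> (\<integral>\<omega>. indicator (B n) \<omega> * sn (\<tau> n) \<omega> \<partial>M) + slack (\<tau> n) (\<tau> (Suc n))"
      by (rule sin_supermartingale[OF \<tau>0 le BF])
    also have "\<dots> \<le> (\<integral>\<omega>. sn (\<tau> 0) \<omega> \<partial>M) + slack (\<tau> 0) (\<tau> n) - \<eta> * (1 - prob (B n)) + slack (\<tau> n) (\<tau> (Suc n))"
      using Suc.IH by simp
    finally show ?case using slack_add[of "\<tau> 0" "\<tau> n" "\<tau> (Suc n)"] by (simp add: right_diff_distrib)
  qed
  have "{\<omega> \<in> space M. \<exists>i\<le>n. \<eta> \<le> sn (\<tau> i) \<omega>} = space M - B n" by (auto simp: B_def not_le)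
  then have "prob {\<omega> \<in> space M. \<exists>i\<le>n. \<eta> \<le> sn (\<tau> i) \<omega>} = 1 - prob (B n)" by (simp add: prob_compl)
  moreover have "0 \<le> (\<integral>\<omega>. indicator (B n) \<omega> * sn (\<tau> n) \<omega> \<partial>M)"
    by (intro integral_nonneg_AE AE_I2 mult_nonneg_nonneg sn_bounds) auto
  ultimately show ?thesis using ind[of n] by simp
qed

lemma slack_tail: "0 < e \<Longrightarrow> \<exists>N\<ge>0. \<forall>t. slack N t < e"
proof -
  assume e: "0 < e"
  have "((\<lambda>N. lam * c / 2 * (pi / 2 - arctan N)) \<longlongrightarrow> lam * c / 2 * (pi / 2 - pi / 2)) at_top"
    by (intro tendsto_intros tendsto_arctan_at_top)
  then have "\<forall>\<^sub>F N in at_top. lam * c / 2 * (pi / 2 - arctan N) < e"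
    using e by (intro order_tendstoD(2)) auto
  then have "\<forall>\<^sub>F N in at_top. 0 \<le> N \<and> lam * c / 2 * (pi / 2 - arctan N) < e"
    using eventually_ge_at_top[of "0::real"] by eventually_elim auto
  then obtain N where "0 \<le> N" "lam * c / 2 * (pi / 2 - arctan N) < e"
    using eventually_happens[of _ "at_top :: real filter"] by force
  then show ?thesis using slack_le[of N] by (metis le_less_trans)
qed

text \<open>From a late time \<open>u\<close> both the mean and the drift still to come are below
  \<epsilon> \<eta>/2, so the maximal inequality bounds the probability of an excursion by
  \<epsilon> uniformly over all grids.\<close>

lemma sin_tail:
  assumes \<epsilon>: "0 < \<epsilon>" and \<eta>: "0 < \<eta>"
  shows "\<exists>u E. E \<in> sets M \<and> prob E \<le> \<epsilon> \<and> (\<forall>\<omega>\<in>space M - E. \<forall>t\<ge>u. sn t \<omega> \<le> \<eta>)"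
proof -
  have \<epsilon>\<eta>: "0 < \<epsilon> * \<eta> / 2" using \<epsilon> \<eta> by simp
  obtain N where N: "0 \<le> N" "\<And>t. slack N t < \<epsilon> * \<eta> / 2" using slack_tail[OF \<epsilon>\<eta>] by blast
  obtain u where u: "N \<le> u" "(\<integral>\<omega>. sn u \<omega> \<partial>M) < \<epsilon> * \<eta> / 2" using mean_sin_small[OF \<epsilon>\<eta> N(1)] by blast
  have u0: "0 \<le> u" using N u by simp
  have su: "slack u t < \<epsilon> * \<eta> / 2" for t using slack_add[of N u t] slack_nonneg[OF u(1)] N(2)[of t] by linarith
  define \<tau> where "\<tau> = (\<lambda>p i. u + real i / 2 ^ p)"
  \<comment> \<open>Level \<open>p\<close> has mesh 2^(-p) and reaches \<open>u + p\<close>. The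
    grids are nested, since point \<open>i\<close> reappears as point \<open>2 * i\<close>, and
    together they are dense beyond \<open>u\<close>.\<close>
  define C where "C = (\<lambda>p. {\<omega> \<in> space M. \<exists>i\<le>p * 2 ^ p. \<eta> \<le> sn (\<tau> p i) \<omega>})"
  have \<tau>: "mono (\<tau> p)" "\<tau> p 0 = u" "0 \<le> \<tau> p i" for p i
    using u0 by (auto simp: \<tau>_def mono_def divide_right_mono)
  have CM: "C p \<in> sets M" for p
    unfolding C_def using sn_meas[OF \<tau>(3)] by measurable
  have Cp: "prob (C p) \<le> \<epsilon>" for p
  proof -
    have "\<eta> * prob (C p) \<le> (\<integral>\<omega>. sn (\<tau> p 0) \<omega> \<partial>M) + slack (\<tau> p 0) (\<tau> p (p * 2 ^ p))"
      unfolding C_def by (rule maximal_inequality) (use \<tau> u0 \<eta> in auto)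
    also have "\<dots> \<le> \<eta> * \<epsilon>" using u(2) su[of "\<tau> p (p * 2 ^ p)"] by (simp add: \<tau>(2) mult.commute)
    finally show ?thesis using \<eta> by simp
  qed
  have inc: "incseq C"
  proof (rule incseq_SucI, rule subsetI)
    fix p \<omega> assume "\<omega> \<in> C p"
    then obtain i where i: "\<omega> \<in> space M" "i \<le> p * 2 ^ p" "\<eta> \<le> sn (\<tau> p i) \<omega>" by (auto simp: C_def)
    have "\<tau> (Suc p) (2 * i) = \<tau> p i" by (simp add: \<tau>_def)
    moreover have "2 * i \<le> Suc p * 2 ^ Suc p" using i(2) by simp
    ultimately show "\<omega> \<in> C (Suc p)" using i unfolding C_def by (metis (mono_tags, lifting) mem_Collect_eq)
  qed
  define E where "E = (\<Union>p. C p)"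
  have "(\<lambda>p. prob (C p)) \<longlonglongrightarrow> prob E"
    unfolding E_def by (rule finite_Lim_measure_incseq[OF _ inc]) (use CM in auto)
  then have PE: "prob E \<le> \<epsilon>" by (rule LIMSEQ_le_const2) (use Cp in auto)
  have "sn t \<omega> \<le> \<eta>" if \<omega>: "\<omega> \<in> space M - E" and t: "u \<le> t" for \<omega> t
  proof -
    let ?s = "\<lambda>p. u + real_of_int \<lfloor>(t - u) * 2 ^ p\<rfloor> / 2 ^ p"
    have nn: "0 \<le> (t - u) * 2 ^ p" for p :: nat using t by simp
    have s: "?s p = \<tau> p (nat \<lfloor>(t - u) * 2 ^ p\<rfloor>)" for p using nn[of p] by (simp add: \<tau>_def)
    have "?s \<longlonglongrightarrow> u + (t - u)" by (intro tendsto_intros dyadic_floor_tendsto)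
    then have "?s \<longlonglongrightarrow> t" by simp
    moreover have "\<omega> \<in> space M" using \<omega> by simp
    ultimately have "(\<lambda>p. alpha (?s p) \<omega>) \<longlonglongrightarrow> alpha t \<omega>"
      by (intro continuous_on_tendsto_compose[OF alpha_cont]) (use t u0 s \<tau>(3) in auto)
    then have "(\<lambda>p. sn (?s p) \<omega>) \<longlonglongrightarrow> sn t \<omega>" unfolding sn_def by (intro tendsto_intros) auto
    moreover have "\<forall>\<^sub>F p in sequentially. sn (?s p) \<omega> \<le> \<eta>"
      using eventually_ge_at_top[of "nat \<lceil>t - u\<rceil>"]
    proof eventually_elim
      case (elim p)
      have "(t - u) * 2 ^ p \<le> real p * 2 ^ p" using elim by (intro mult_right_mono) (linarith, simp)
      then have "(t - u) * 2 ^ p \<le> real_of_int (int (p * 2 ^ p))" by simp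
      from floor_mono[OF this] have "\<lfloor>(t - u) * 2 ^ p\<rfloor> \<le> int (p * 2 ^ p)" unfolding floor_of_int .
      then have "nat \<lfloor>(t - u) * 2 ^ p\<rfloor> \<le> p * 2 ^ p" by (simp only: nat_le_iff)
      moreover have "\<omega> \<notin> C p" "\<omega> \<in> space M" using \<omega> by (auto simp: E_def)
      ultimately have "sn (\<tau> p (nat \<lfloor>(t - u) * 2 ^ p\<rfloor>)) \<omega> < \<eta>"
        unfolding C_def mem_Collect_eq not_le[symmetric] by blast
      then show ?case unfolding s by simp
    qed
    ultimately show ?thesis by (rule tendsto_upperbound) simp
  qed
  then show ?thesis using PE CM unfolding E_def by (intro exI[of _ u] exI[of _ "\<Union>p. C p"]) auto
qed

lemma AE_sin_tendsto_0: "AE \<omega> in M. ((\<lambda>t. sin (alpha t \<omega> / 2)) \<longlongrightarrow> 0) at_top"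
proof -
  have 1: "AE \<omega> in M. \<exists>u. \<forall>t\<ge>u. sn t \<omega> \<le> \<eta>" if \<eta>: "0 < \<eta>" for \<eta>
  proof -
    have "\<forall>k::nat. \<exists>u E. E \<in> sets M \<and> prob E \<le> 1 / real (Suc k) \<and> (\<forall>\<omega>\<in>space M - E. \<forall>t\<ge>u. sn t \<omega> \<le> \<eta>)"
      using sin_tail[OF _ \<eta>] by simp
    then obtain u E where uE: "\<And>k::nat. E k \<in> sets M" "\<And>k. prob (E k) \<le> 1 / real (Suc k)"
      "\<And>k \<omega> t. \<omega> \<in> space M - E k \<Longrightarrow> u k \<le> t \<Longrightarrow> sn t \<omega> \<le> \<eta>" by metis
    \<comment> \<open>A path is bad only if it lies in every exceptional set, so the bound 1/(k+1)
      for all k makes the bad event null.\<close>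
    define N where "N = (\<Inter>k. E k)"
    have NM: "N \<in> sets M" unfolding N_def using uE(1) by auto
    have "prob N \<le> 1 / real (Suc k)" for k
      using finite_measure_mono[of N "E k"] uE(1,2)[of k] by (force simp: N_def)
    moreover have "(\<lambda>k. 1 / real (Suc k)) \<longlonglongrightarrow> 0"
      using LIMSEQ_inverse_real_of_nat by (simp add: inverse_eq_divide)
    ultimately have "prob N \<le> 0" by (intro LIMSEQ_le_const) auto
    then have "N \<in> null_sets M" using NM by (simp add: null_sets_def emeasure_eq_measure measure_le_0_iff)
    moreover have "{\<omega> \<in> space M. \<not> (\<exists>u. \<forall>t\<ge>u. sn t \<omega> \<le> \<eta>)} \<subseteq> N"
      unfolding N_def using uE(3) by blast
    ultimately show ?thesis by (rule AE_I')
  qed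
  have "AE \<omega> in M. \<forall>n::nat. \<exists>u. \<forall>t\<ge>u. sn t \<omega> \<le> 1 / real (Suc n)"
    unfolding AE_all_countable using 1 by simp
  then show ?thesis
  proof eventually_elim
    case (elim \<omega>)
    show ?case
    proof (rule tendstoI)
      fix e :: real assume "0 < e"
      then obtain n where n: "1 / real (Suc n) < e" using nat_approx_posE by blast
      obtain u where "\<forall>t\<ge>u. sn t \<omega> \<le> 1 / real (Suc n)" using elim by blast
      then show "\<forall>\<^sub>F t in at_top. dist (sin (alpha t \<omega> / 2)) 0 < e"
        using n by (auto simp: eventually_at_top_linorder sn_def intro!: exI[of _ u] intro: le_less_trans)
    qed
  qed
qed

section \<open>The count, and its comparison with the path at a finite time\<close>

lemma AE_count:
  "AE \<omega> in M. \<exists>j::int. 0 \<le> j \<and> carousel_count alpha \<omega> = of_int j \<and> ((\<lambda>t. alpha t \<omega>) \<longlongrightarrow> 2 * pi * of_int j) at_top"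
proof -
  \<comment> \<open>Nonnegativity is known almost surely at each fixed time, so the sign of the
    limit is read off along the integers.\<close>
  have "AE \<omega> in M. \<forall>n::nat. 0 \<le> alpha (real n) \<omega>"
    unfolding AE_all_countable using alpha_nonneg by simp
  with AE_sin_tendsto_0 show ?thesis using AE_space
  proof eventually_elim
    case (elim \<omega>)
    obtain j :: int where j: "((\<lambda>t. alpha t \<omega>) \<longlongrightarrow> 2 * pi * of_int j) at_top"
      using tendsto_multiple_of_2pi[OF alpha_cont[OF elim(3)] elim(1)] by blast
    have "(\<lambda>n. alpha (real n) \<omega>) \<longlonglongrightarrow> 2 * pi * of_int j"
      by (rule filterlim_compose[OF j filterlim_real_sequentially])
    then have "0 \<le> 2 * pi * real_of_int j" by (rule LIMSEQ_le_const) (use elim(2) in auto)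
    then have "0 \<le> j" using pi_gt_zero by (auto simp: zero_le_mult_iff)
    moreover have "carousel_count alpha \<omega> = of_int j"
      unfolding carousel_count_def using tendsto_Lim[OF _ j] by simp
    ultimately show ?case using j by blast
  qed
qed

text \<open>\<^const>\<open>Lim\<close> is a definite description: on divergent paths the count is the fixed junk value \<open>J\<close>.\<close>
lemma count_measurable [measurable]: "carousel_count alpha \<in> borel_measurable M"
proof -
  \<comment> \<open>Cauchy's criterion at infinity over rational times, which makes the set of
    convergence a countable combination of events. Continuity of the paths extends it to all
    times.\<close>
  define Cv where "Cv = {\<omega> \<in> space M. \<forall>k::nat. \<exists>N::nat. \<forall>p\<in>\<rat>. \<forall>q\<in>\<rat>. real N \<le> p \<longrightarrow> real N \<le> q \<longrightarrow> \<bar>alpha p \<omega> - alpha q \<omega>\<bar> \<le> 1 / real (Suc k)}"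
  have [measurable]: "Cv \<in> sets M"
  proof -
    have cr: "countable (\<rat> :: real set)" by (rule countable_rat)
    have "{\<omega> \<in> space M. real N \<le> p \<longrightarrow> real N \<le> q \<longrightarrow> \<bar>alpha p \<omega> - alpha q \<omega>\<bar> \<le> 1 / real (Suc k)} \<in> sets M" for N k :: nat and p q :: real
    proof (cases "real N \<le> p \<and> real N \<le> q")
      case True
      then have "0 \<le> p" "0 \<le> q" by linarith+
      then show ?thesis using True by simp
    qed (auto simp: sets.top cong: conj_cong)
    then show ?thesis unfolding Cv_def
      by (intro sets.sets_Collect_countable_All sets.sets_Collect_countable_Ex sets.sets_Collect_countable_All'[OF _ cr]) auto
  qed
  have conv: "((\<lambda>t. alpha t \<omega>) \<longlongrightarrow> lim (\<lambda>n. alpha (real n) \<omega>)) at_top" if "\<omega> \<in> Cv" for \<omega>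
  proof -
    have \<omega>: "\<omega> \<in> space M" using that by (simp add: Cv_def)
    have ca: "\<exists>N::nat. \<forall>p\<ge>real N. \<forall>q\<ge>real N. \<bar>alpha p \<omega> - alpha q \<omega>\<bar> \<le> 1 / real (Suc k)" for k
    proof -
      obtain N :: nat where N: "\<And>p q. p \<in> \<rat> \<Longrightarrow> q \<in> \<rat> \<Longrightarrow> real N \<le> p \<Longrightarrow> real N \<le> q \<Longrightarrow> \<bar>alpha p \<omega> - alpha q \<omega>\<bar> \<le> 1 / real (Suc k)"
        using \<open>\<omega> \<in> Cv\<close> unfolding Cv_def by blast
      have "\<bar>alpha p \<omega> - alpha q \<omega>\<bar> \<le> 1 / real (Suc k)" if pq: "real N \<le> p" "real N \<le> q" for p q
      proof -
        have seq: "\<exists>s. (\<forall>n. s n \<in> \<rat> \<and> real N \<le> s n) \<and> s \<longlonglongrightarrow> x" if "real N \<le> x" for x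
        proof -
          let ?s = "\<lambda>n. real N + real_of_int \<lfloor>(x - real N) * 2 ^ n\<rfloor> / 2 ^ n"
          have "?s \<longlonglongrightarrow> real N + (x - real N)" by (intro tendsto_intros dyadic_floor_tendsto)
          moreover have "?s n \<in> \<rat>" "real N \<le> ?s n" for n using that by (auto intro!: Rats_add Rats_divide Rats_power)
          ultimately show ?thesis by (intro exI[of _ ?s]) auto
        qed
        obtain s r where s: "\<And>n. s n \<in> \<rat>" "\<And>n. real N \<le> s n" "s \<longlonglongrightarrow> p"
          and r: "\<And>n. r n \<in> \<rat>" "\<And>n. real N \<le> r n" "r \<longlonglongrightarrow> q" using seq[OF pq(1)] seq[OF pq(2)] by metis
        have nn: "0 \<le> s n" "0 \<le> r n" "0 \<le> p" "0 \<le> q" for n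
          using s(2)[of n] r(2)[of n] pq by linarith+
        have "(\<lambda>n. alpha (s n) \<omega>) \<longlonglongrightarrow> alpha p \<omega>"
          by (rule continuous_on_tendsto_compose[OF alpha_cont[OF \<omega>] s(3)]) (use nn in auto)
        moreover have "(\<lambda>n. alpha (r n) \<omega>) \<longlonglongrightarrow> alpha q \<omega>"
          by (rule continuous_on_tendsto_compose[OF alpha_cont[OF \<omega>] r(3)]) (use nn in auto)
        ultimately have "(\<lambda>n. \<bar>alpha (s n) \<omega> - alpha (r n) \<omega>\<bar>) \<longlonglongrightarrow> \<bar>alpha p \<omega> - alpha q \<omega>\<bar>"
          by (intro tendsto_intros)
        then show ?thesis by (rule LIMSEQ_le_const2) (use N s r in auto)
      qed
      then show ?thesis by blast
    qed
    have "Cauchy (\<lambda>n. alpha (real n) \<omega>)"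
    proof (rule metric_CauchyI)
      fix e :: real assume "0 < e"
      then obtain k where k: "1 / real (Suc k) < e" using nat_approx_posE by blast
      obtain N :: nat where "\<forall>p\<ge>real N. \<forall>q\<ge>real N. \<bar>alpha p \<omega> - alpha q \<omega>\<bar> \<le> 1 / real (Suc k)" using ca by blast
      then have "dist (alpha (real m) \<omega>) (alpha (real n) \<omega>) < e" if "N \<le> m" "N \<le> n" for m n
        unfolding dist_real_def by (intro le_less_trans[OF _ k]) (use that in auto)
      then show "\<exists>N. \<forall>m\<ge>N. \<forall>n\<ge>N. dist (alpha (real m) \<omega>) (alpha (real n) \<omega>) < e" by blast
    qed
    then have L: "(\<lambda>n. alpha (real n) \<omega>) \<longlonglongrightarrow> lim (\<lambda>n. alpha (real n) \<omega>)"
      using Cauchy_convergent convergent_LIMSEQ_iff by blast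
    show ?thesis
    proof (rule tendstoI)
      fix e :: real assume "0 < e"
      then obtain k where k: "1 / real (Suc k) < e" using nat_approx_posE by blast
      obtain N :: nat where N: "\<forall>p\<ge>real N. \<forall>q\<ge>real N. \<bar>alpha p \<omega> - alpha q \<omega>\<bar> \<le> 1 / real (Suc k)" using ca by blast
      have "\<bar>alpha t \<omega> - lim (\<lambda>n. alpha (real n) \<omega>)\<bar> \<le> 1 / real (Suc k)" if "real N \<le> t" for t
      proof (rule LIMSEQ_le_const2)
        show "(\<lambda>n. \<bar>alpha t \<omega> - alpha (real n) \<omega>\<bar>) \<longlonglongrightarrow> \<bar>alpha t \<omega> - lim (\<lambda>n. alpha (real n) \<omega>)\<bar>"
          by (intro tendsto_intros L)
        show "\<exists>M. \<forall>n\<ge>M. \<bar>alpha t \<omega> - alpha (real n) \<omega>\<bar> \<le> 1 / real (Suc k)"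
          by (intro exI[of _ N]) (use N that in auto)
      qed
      then show "\<forall>\<^sub>F t in at_top. dist (alpha t \<omega>) (lim (\<lambda>n. alpha (real n) \<omega>)) < e"
        using k by (auto simp: eventually_at_top_linorder dist_real_def intro!: exI[of _ "real N"] intro: le_less_trans)
    qed
  qed
  have noconv: "\<not> ((\<lambda>t. alpha t \<omega>) \<longlongrightarrow> l) at_top" if "\<omega> \<in> space M - Cv" for \<omega> l
  proof
    assume l: "((\<lambda>t. alpha t \<omega>) \<longlongrightarrow> l) at_top"
    have "\<exists>N::nat. \<forall>p\<in>\<rat>. \<forall>q\<in>\<rat>. real N \<le> p \<longrightarrow> real N \<le> q \<longrightarrow> \<bar>alpha p \<omega> - alpha q \<omega>\<bar> \<le> 1 / real (Suc k)" for k
    proof -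
      have "\<forall>\<^sub>F t in at_top. dist (alpha t \<omega>) l < 1 / real (Suc k) / 2" by (rule tendstoD[OF l]) simp
      then obtain T where T: "\<And>t. T \<le> t \<Longrightarrow> \<bar>alpha t \<omega> - l\<bar> < 1 / real (Suc k) / 2"
        unfolding eventually_at_top_linorder dist_real_def by blast
      have "\<bar>alpha p \<omega> - alpha q \<omega>\<bar> \<le> 1 / real (Suc k)" if "real (nat \<lceil>T\<rceil>) \<le> p" "real (nat \<lceil>T\<rceil>) \<le> q" for p q
      proof -
        have "T \<le> p" "T \<le> q" using that by linarith+
        moreover have "\<bar>x - y\<bar> \<le> e" if "\<bar>x - l\<bar> < e / 2" "\<bar>y - l\<bar> < e / 2" for x y e :: real
          using that by linarith
        ultimately show ?thesis using T by blast
      qed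
      then show ?thesis by blast
    qed
    with that show False unfolding Cv_def by blast
  qed
  define J where "J = (THE l :: real. False) / (2 * pi)"
  have "carousel_count alpha \<omega> = (if \<omega> \<in> Cv then lim (\<lambda>n. alpha (real n) \<omega>) / (2 * pi) else J)" if "\<omega> \<in> space M" for \<omega>
    using tendsto_Lim[OF _ conv[of \<omega>]] noconv[of \<omega>] that by (auto simp: carousel_count_def J_def t2_space_class.Lim_def)
  moreover have "(\<lambda>\<omega>. if \<omega> \<in> Cv then lim (\<lambda>n. alpha (real n) \<omega>) / (2 * pi) else J) \<in> borel_measurable M"
    by measurable
  ultimately show ?thesis by (simp cong: measurable_cong)
qed

text \<open>If the path is at or above level k + 1 at time \<open>T\<close>, it is still there at
  all times \<open>T + n\<close>, hence so is its limit.\<close>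

lemma count_le_imp_alpha_less:
  fixes k :: nat
  assumes T: "0 \<le> T"
  shows "AE \<omega> in M. carousel_count alpha \<omega> \<le> real k \<longrightarrow> alpha T \<omega> < 2 * pi * (real k + 1)"
proof -
  let ?b = "2 * pi * real_of_int (int k + 1)"
  have "AE \<omega> in M. \<forall>n::nat. ?b \<le> alpha T \<omega> \<longrightarrow> ?b \<le> alpha (T + real n) \<omega>"
    unfolding AE_all_countable using level_stays[OF T, of "T + real n" "int k + 1" for n] by simp
  with AE_count show ?thesis
  proof eventually_elim
    case (elim \<omega>)
    obtain j :: int where j: "carousel_count alpha \<omega> = of_int j" "((\<lambda>t. alpha t \<omega>) \<longlongrightarrow> 2 * pi * of_int j) at_top"
      using elim(1) by blast
    have "filterlim (\<lambda>n. T + real n) at_top sequentially"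
      by (rule filterlim_tendsto_add_at_top[OF tendsto_const filterlim_real_sequentially])
    then have lim: "(\<lambda>n. alpha (T + real n) \<omega>) \<longlonglongrightarrow> 2 * pi * of_int j" by (rule filterlim_compose[OF j(2)])
    show ?case
    proof (intro impI, rule ccontr)
      assume le: "carousel_count alpha \<omega> \<le> real k" and "\<not> alpha T \<omega> < 2 * pi * (real k + 1)"
      then have "?b \<le> alpha T \<omega>" by simp
      then have "?b \<le> 2 * pi * of_int j" by (intro LIMSEQ_le_const[OF lim]) (use elim(2) in auto)
      then have "int k + 1 \<le> j" using pi_gt_zero by (simp add: mult_le_cancel_left_pos del: of_int_add)
      with le j(1) show False by linarith
    qed
  qed
qed

text \<open>Markov's inequality in the limit t to infinity. After \<open>T\<close> the mean of
  arctan \<alpha> on \<open>A\<close> grows by at most \<open>prob A\<close> times the drift still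
  to come, because arctan is concave on the half line and has slope at most 1. A positive count
  would put the limit of arctan \<alpha> at or above arctan(2 pi). The estimate is useful when
  \<open>a\<close> is below 2 pi and \<open>T\<close> is large against lam.\<close>

lemma prob_count_zero_ge:
  fixes a :: real
  assumes T: "0 \<le> T"
  defines "A \<equiv> {\<omega> \<in> space M. alpha T \<omega> \<le> a}"
  shows "prob A * (1 - (arctan a + lam * c * (pi / 2 - arctan T)) / arctan (2 * pi))
    \<le> prob {\<omega> \<in> space M. carousel_count alpha \<omega> \<le> 0}"
proof -
  have AF: "A \<in> sets (F T)"
    using measurable_sets[OF alpha_adapted[OF T], of "{..a}"] by (auto simp: A_def space_F vimage_def Int_def conj_commute)
  note AM [measurable] = F_sets[OF AF]
  define \<kappa> where "\<kappa> = arctan a + lam * c * (pi / 2 - arctan T)"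
  have aint: "integrable M (\<lambda>\<omega>. indicator A \<omega> * arctan (alpha t \<omega>))" if "0 \<le> t" for t
    by (rule integrable_test[OF C2b_continuous(1)[OF arctan_C2b(1)] _ AM that, of "pi / 2"])
      (rule abs_arctan_le)
  have bound: "(\<integral>\<omega>. indicator A \<omega> * arctan (alpha (T + real n) \<omega>) \<partial>M) \<le> \<kappa> * prob A" for n
  proof -
    let ?t = "T + real n"
    have gen_le: "gen arctan u x \<le> lam * c / (1 + u\<^sup>2) + 0 - 0" if u: "0 \<le> u" and x: "0 \<le> x" for u x
    proof -
      have p: "1 \<le> 1 + x\<^sup>2" by simp
      have "f u * inverse (1 + x\<^sup>2) \<le> c / (1 + u\<^sup>2) * 1"
        using f_nonneg[OF u] f_bound[OF u] p by (intro mult_mono) (auto simp: inverse_le_1_iff)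
      then have "lam * (f u * inverse (1 + x\<^sup>2)) \<le> lam * (c / (1 + u\<^sup>2))"
        using lam_nonneg by (intro mult_left_mono) auto
      moreover have "0 \<le> 2 * (sin (x / 2))\<^sup>2 * (2 * x / (1 + x\<^sup>2)\<^sup>2)" using x by simp
      ultimately show ?thesis unfolding gen_def arctan_C2b(3) unfolding arctan_C2b(2) by (simp add: mult.assoc)
    qed
    have "(\<integral>\<omega>. indicator A \<omega> * arctan (alpha ?t \<omega>) \<partial>M) + (LBINT u:{T<..?t}. \<integral>\<omega>. indicator A \<omega> * 0 \<partial>M)
       \<le> (\<integral>\<omega>. indicator A \<omega> * arctan (alpha T \<omega>) \<partial>M) + prob A * (lam * c * (arctan ?t - arctan T) + 0 * (?t - T))"
    proof (rule dynkin_le[OF arctan_C2b(1) T _ AF, of _ "\<lambda>_. 0" 0])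
      fix u assume "T < u"
      then have "0 \<le> u" using T by simp
      then show "AE \<omega> in M. gen arctan u (alpha u \<omega>) \<le> lam * c / (1 + u\<^sup>2) + 0 - 0"
        using alpha_nonneg[of u] gen_le by (auto elim!: AE_mp)
    qed auto
    moreover have "(\<integral>\<omega>. indicator A \<omega> * arctan (alpha T \<omega>) \<partial>M) \<le> (\<integral>\<omega>. indicator A \<omega> * arctan a \<partial>M)"
    proof (rule integral_mono[OF aint[OF T]])
      show "integrable M (\<lambda>\<omega>. indicator A \<omega> * arctan a)"
        by (intro integrable_mult_left integrable_real_indicator AM) (simp add: less_top[symmetric])
    qed (auto simp: A_def indicator_def arctan_le_iff)
    moreover have "prob A * (lam * c * (arctan ?t - arctan T)) \<le> prob A * (lam * c * (pi / 2 - arctan T))"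
      using arctan_ubound[of ?t] lam_nonneg c_nonneg by (intro mult_left_mono) auto
    ultimately show ?thesis by (simp add: \<kappa>_def algebra_simps)
  qed
  define L where "L = (\<lambda>\<omega>. indicator A \<omega> * arctan (2 * pi * carousel_count alpha \<omega>))"
  have Lm: "L \<in> borel_measurable M" unfolding L_def by measurable
  have "(\<lambda>n. \<integral>\<omega>. indicator A \<omega> * arctan (alpha (T + real n) \<omega>) \<partial>M) \<longlonglongrightarrow> (\<integral>\<omega>. L \<omega> \<partial>M)"
  proof (rule integral_dominated_convergence[OF Lm, of _ "\<lambda>_. pi / 2"])
    show "AE \<omega> in M. (\<lambda>n. indicator A \<omega> * arctan (alpha (T + real n) \<omega>)) \<longlonglongrightarrow> L \<omega>"
      using AE_count
    proof eventually_elim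
      case (elim \<omega>)
      then obtain j :: int where j: "carousel_count alpha \<omega> = of_int j" "((\<lambda>t. alpha t \<omega>) \<longlongrightarrow> 2 * pi * of_int j) at_top"
        by blast
      have "filterlim (\<lambda>n. T + real n) at_top sequentially"
        by (rule filterlim_tendsto_add_at_top[OF tendsto_const filterlim_real_sequentially])
      then have "(\<lambda>n. alpha (T + real n) \<omega>) \<longlonglongrightarrow> 2 * pi * of_int j" by (rule filterlim_compose[OF j(2)])
      then show ?case unfolding L_def j(1) by (intro tendsto_intros)
    qed
    show "AE \<omega> in M. norm (indicator A \<omega> * arctan (alpha (T + real n) \<omega>)) \<le> pi / 2" for n
      using abs_arctan_le by (auto simp: indicator_def)
  qed (use aint T in \<open>auto intro: borel_measurable_integrable\<close>)
  then have LE: "(\<integral>\<omega>. L \<omega> \<partial>M) \<le> \<kappa> * prob A" by (rule LIMSEQ_le_const2) (use bound in auto)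
  define B where "B = A \<inter> {\<omega> \<in> space M. 0 < carousel_count alpha \<omega>}"
  have [measurable]: "B \<in> sets M" unfolding B_def by measurable
  have "arctan (2 * pi) * prob B = (\<integral>\<omega>. arctan (2 * pi) * indicator B \<omega> \<partial>M)" by simp
  also have "\<dots> \<le> (\<integral>\<omega>. L \<omega> \<partial>M)"
  proof (rule integral_mono_AE)
    show "integrable M (\<lambda>\<omega>. arctan (2 * pi) * indicator B \<omega>)"
      by (intro integrable_mult_right integrable_real_indicator) (auto simp: less_top[symmetric])
    show "integrable M L"
      by (rule integrable_const_bound[of _ "pi / 2", OF _ Lm])
        (use abs_arctan_le in \<open>auto simp: L_def indicator_def\<close>)
    show "AE \<omega> in M. arctan (2 * pi) * indicator B \<omega> \<le> L \<omega>"
      using AE_count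
    proof eventually_elim
      case (elim \<omega>)
      then obtain j :: int where j: "carousel_count alpha \<omega> = of_int j" "0 \<le> j" by blast
      then have "0 \<le> arctan (2 * pi * of_int j)" by simp
      moreover have "arctan (2 * pi) \<le> arctan (2 * pi * of_int j)" if "0 < j"
      proof -
        have "1 \<le> real_of_int j" using that by linarith
        then show ?thesis by (simp add: arctan_le_iff)
      qed
      ultimately show ?case using j by (auto simp: B_def L_def indicator_def)
    qed
  qed
  finally have PB: "arctan (2 * pi) * prob B \<le> \<kappa> * prob A" using LE by linarith
  have at: "0 < arctan (2 * pi)" by simp
  have "prob A = prob (A - B) + prob B"
    using finite_measure_Diff[OF AM, of B] by (simp add: B_def)
  moreover have "prob (A - B) \<le> prob {\<omega> \<in> space M. carousel_count alpha \<omega> \<le> 0}"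
    by (rule finite_measure_mono) (auto simp: B_def A_def)
  moreover have "prob B \<le> \<kappa> * prob A / arctan (2 * pi)" using PB at by (simp add: pos_le_divide_eq mult.commute)
  ultimately show ?thesis unfolding \<kappa>_def[symmetric] by (simp add: right_diff_distrib mult.commute)
qed

end

section \<open>Super- and subsolutions\<close>

definition upper_test :: "real \<Rightarrow> real \<Rightarrow> real \<Rightarrow> real" where
  "upper_test R \<theta> x = (if x \<le> R then exp (- \<theta> * x) * (R - x) ^ 3 else 0)"

text \<open>4 arctan 2 is the point where tan(x/4) = 2. It lies beyond pi, where tan(x/4) = 1 is the
  cheap place to stay, and before 2 pi, so that some distance to a completed turn is left.\<close>

definition lower_test :: "real \<Rightarrow> real \<Rightarrow> real" where
  "lower_test \<theta> x = (if x \<le> 4 * arctan 2 then exp (- \<theta> * tan (x / 4)) * (2 - tan (x / 4)) ^ 3 else 0)"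

text \<open>Only nonnegative arguments matter, since the process is almost surely nonnegative. The
  cube vanishes at \<open>R\<close> together with two derivatives, which permits continuation by
  zero.\<close>

lemma upper_test_extension:
  assumes R: "0 < R"
  obtains g where "C2b g" "\<And>x. 0 \<le> x \<Longrightarrow> g x = upper_test R \<theta> x"
    "\<And>x. 0 \<le> x \<Longrightarrow> x \<le> R \<Longrightarrow> deriv g x = - exp (- \<theta> * x) * (\<theta> * (R - x) ^ 3 + 3 * (R - x)\<^sup>2)"
    "\<And>x. 0 \<le> x \<Longrightarrow> x \<le> R \<Longrightarrow> deriv (deriv g) x = exp (- \<theta> * x) * (\<theta>\<^sup>2 * (R - x) ^ 3 + 6 * \<theta> * (R - x)\<^sup>2 + 6 * (R - x))"
    "\<And>x. R \<le> x \<Longrightarrow> g x = 0 \<and> deriv g x = 0 \<and> deriv (deriv g) x = 0"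
proof -
  let ?p = "\<lambda>x. exp (- \<theta> * x) * (R - x) ^ 3"
  let ?p1 = "\<lambda>x. - exp (- \<theta> * x) * (\<theta> * (R - x) ^ 3 + 3 * (R - x)\<^sup>2)"
  let ?p2 = "\<lambda>x. exp (- \<theta> * x) * (\<theta>\<^sup>2 * (R - x) ^ 3 + 6 * \<theta> * (R - x)\<^sup>2 + 6 * (R - x))"
  have d: "(?p has_real_derivative ?p1 x) (at x within S)" for x S
    by (auto intro!: derivative_eq_intros simp: algebra_simps power2_eq_square power3_eq_cube)
  have d1: "(?p1 has_real_derivative ?p2 x) (at x within S)" for x S
    by (auto intro!: derivative_eq_intros simp: algebra_simps power2_eq_square power3_eq_cube)
  have c: "continuous_on {0..R} ?p2" by (intro continuous_intros)
  obtain g where g: "C2b g" "\<And>x. x \<in> {0..R} \<Longrightarrow> g x = ?p x" "\<And>x. x \<in> {0..R} \<Longrightarrow> deriv g x = ?p1 x"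
    "\<And>x. x \<in> {0..R} \<Longrightarrow> deriv (deriv g) x = ?p2 x"
    "\<And>x. ?p R = 0 \<Longrightarrow> ?p1 R = 0 \<Longrightarrow> ?p2 R = 0 \<Longrightarrow> R \<le> x \<Longrightarrow> g x = 0 \<and> deriv g x = 0 \<and> deriv (deriv g) x = 0"
    by (rule C2b_extension[OF less_imp_le[OF R] d d1 c], rule that)
  have z: "g x = 0 \<and> deriv g x = 0 \<and> deriv (deriv g) x = 0" if "R \<le> x" for x
    using g(5)[of x] that by simp
  show thesis
    by (rule that[OF g(1)]) (use g(2-4) z in \<open>auto simp: upper_test_def\<close>)
qed

text \<open>The chain rule for y = tan(x/4), with y' = (1 + y^2)/4 and y'' = y (1 + y^2)/8. Stopping
  at y = 2 avoids the pole at 2 pi.\<close>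

lemma lower_test_extension:
  obtains g where "C2b g" "\<And>x. 0 \<le> x \<Longrightarrow> g x = lower_test \<theta> x"
    "\<And>x y. 0 \<le> x \<Longrightarrow> x \<le> 4 * arctan 2 \<Longrightarrow> y = tan (x / 4) \<Longrightarrow>
      deriv g x = - exp (- \<theta> * y) * (\<theta> * (2 - y) ^ 3 + 3 * (2 - y)\<^sup>2) * ((1 + y\<^sup>2) / 4)"
    "\<And>x y. 0 \<le> x \<Longrightarrow> x \<le> 4 * arctan 2 \<Longrightarrow> y = tan (x / 4) \<Longrightarrow>
      deriv (deriv g) x = exp (- \<theta> * y) * ((\<theta>\<^sup>2 * (2 - y) ^ 3 + 6 * \<theta> * (2 - y)\<^sup>2 + 6 * (2 - y)) * (1 + y\<^sup>2)\<^sup>2 / 16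
        - (\<theta> * (2 - y) ^ 3 + 3 * (2 - y)\<^sup>2) * (y * (1 + y\<^sup>2) / 8))"
    "\<And>x. 4 * arctan 2 \<le> x \<Longrightarrow> g x = 0 \<and> deriv g x = 0 \<and> deriv (deriv g) x = 0"
proof -
  define V where "V = (\<lambda>y. exp (- \<theta> * y) * (2 - y) ^ 3)"
  define V1 where "V1 = (\<lambda>y. - exp (- \<theta> * y) * (\<theta> * (2 - y) ^ 3 + 3 * (2 - y)\<^sup>2))"
  define V2 where "V2 = (\<lambda>y. exp (- \<theta> * y) * (\<theta>\<^sup>2 * (2 - y) ^ 3 + 6 * \<theta> * (2 - y)\<^sup>2 + 6 * (2 - y)))"
  have dV: "(V has_real_derivative V1 x) (at x within S)" "(V1 has_real_derivative V2 x) (at x within S)" for x S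
    unfolding V_def V1_def V2_def
    by (auto intro!: derivative_eq_intros simp: algebra_simps power2_eq_square power3_eq_cube)
  let ?R = "4 * arctan 2"
  let ?y = "\<lambda>x::real. tan (x / 4)"
  let ?p = "\<lambda>x. V (?y x)"
  let ?p1 = "\<lambda>x. V1 (?y x) * ((1 + (?y x)\<^sup>2) / 4)"
  let ?p2 = "\<lambda>x. V2 (?y x) * (1 + (?y x)\<^sup>2)\<^sup>2 / 16 + V1 (?y x) * (?y x * (1 + (?y x)\<^sup>2) / 8)"
  have cos: "cos (x / 4) \<noteq> 0" if "x \<in> {0..?R}" for x
  proof -
    have "0 \<le> x / 4" "x / 4 \<le> arctan 2" using that by auto
    then have "- (pi / 2) < x / 4" "x / 4 < pi / 2" using arctan_ubound[of 2] pi_gt_zero by linarith+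
    then show ?thesis using cos_gt_zero_pi[of "x / 4"] by simp
  qed
  have dy: "(?y has_real_derivative (1 + (?y x)\<^sup>2) / 4) (at x within S)" if "x \<in> {0..?R}" for x S
  proof -
    have "(?y has_real_derivative inverse ((cos (x / 4))\<^sup>2) * (1 / 4)) (at x within S)"
      using cos[OF that] by (auto intro!: derivative_eq_intros)
    then show ?thesis using tan_sec[OF cos[OF that]] by (simp add: power_inverse)
  qed
  have R0: "0 \<le> ?R" by simp
  have yR: "?y ?R = 2" by (simp add: tan_arctan)
  have d: "(?p has_real_derivative ?p1 x) (at x within {0..?R})" if "x \<in> {0..?R}" for x
    by (rule DERIV_chain2[OF dV(1) dy[OF that]])
  have d1: "(?p1 has_real_derivative ?p2 x) (at x within {0..?R})" if "x \<in> {0..?R}" for x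
  proof -
    have "((\<lambda>x. V1 (?y x)) has_real_derivative V2 (?y x) * ((1 + (?y x)\<^sup>2) / 4)) (at x within {0..?R})"
      by (rule DERIV_chain2[OF dV(2) dy[OF that]])
    moreover have "((\<lambda>x. (1 + (?y x)\<^sup>2) / 4) has_real_derivative ?y x * (1 + (?y x)\<^sup>2) / 8) (at x within {0..?R})"
      by (rule derivative_eq_intros dy[OF that] refl | simp)+
    ultimately show ?thesis
      by (rule DERIV_mult[THEN DERIV_cong]) (simp add: power2_eq_square ac_simps)
  qed
  have cy: "continuous_on {0..?R} ?y"
    by (rule DERIV_continuous_on[OF dy])
  have "continuous_on UNIV (\<lambda>y. V2 y * (1 + y\<^sup>2)\<^sup>2 / 16 + V1 y * (y * (1 + y\<^sup>2) / 8))"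
    unfolding V1_def V2_def by (intro continuous_intros) auto
  from continuous_on_compose2[OF this cy] have c: "continuous_on {0..?R} ?p2" by simp
  obtain g where g: "C2b g" "\<And>x. x \<in> {0..?R} \<Longrightarrow> g x = ?p x" "\<And>x. x \<in> {0..?R} \<Longrightarrow> deriv g x = ?p1 x"
    "\<And>x. x \<in> {0..?R} \<Longrightarrow> deriv (deriv g) x = ?p2 x"
    "\<And>x. ?p ?R = 0 \<Longrightarrow> ?p1 ?R = 0 \<Longrightarrow> ?p2 ?R = 0 \<Longrightarrow> ?R \<le> x \<Longrightarrow> g x = 0 \<and> deriv g x = 0 \<and> deriv (deriv g) x = 0"
    by (rule C2b_extension[OF R0 d d1 c], assumption, assumption, rule that)
  have z: "g x = 0 \<and> deriv g x = 0 \<and> deriv (deriv g) x = 0" if "?R \<le> x" for x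
    using g(5)[of x] that unfolding yR by (simp add: V_def V1_def V2_def)
  show thesis
  proof (rule that[OF g(1)])
    show "g x = lower_test \<theta> x" if "0 \<le> x" for x
      using g(2)[of x] z[of x] that by (auto simp: lower_test_def V_def)
    show "deriv g x = - exp (- \<theta> * y) * (\<theta> * (2 - y) ^ 3 + 3 * (2 - y)\<^sup>2) * ((1 + y\<^sup>2) / 4)"
      if "0 \<le> x" "x \<le> ?R" "y = tan (x / 4)" for x y
      using g(3)[of x] that by (simp add: V1_def)
    show "deriv (deriv g) x = exp (- \<theta> * y) * ((\<theta>\<^sup>2 * (2 - y) ^ 3 + 6 * \<theta> * (2 - y)\<^sup>2 + 6 * (2 - y)) * (1 + y\<^sup>2)\<^sup>2 / 16
        - (\<theta> * (2 - y) ^ 3 + 3 * (2 - y)\<^sup>2) * (y * (1 + y\<^sup>2) / 8))"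
      if "0 \<le> x" "x \<le> ?R" "y = tan (x / 4)" for x y
    proof -
      have alg: "(e * a) * b / 16 + (- e * c) * d = e * (a * b / 16 - c * d)" for a b c d e :: real
        by (simp add: algebra_simps)
      show ?thesis using g(4)[of x] that(1,2) unfolding that(3)[symmetric] V1_def V2_def alg by simp
    qed
  qed (rule z)
qed

lemma upper_test_nonneg: "0 \<le> upper_test R \<theta> x"
  by (simp add: upper_test_def)

text \<open>Passing to the exponent of the next cell costs \<open>R\<close> times the jump, because
  x \<le> R on the support. Over all cells these costs add up to lam times a multiple of the
  variation.\<close>

lemma upper_test_change:
  assumes "0 \<le> x"
  shows "upper_test R \<theta>' x \<le> exp (R * \<bar>\<theta>' - \<theta>\<bar>) * upper_test R \<theta> x"
proof (cases "x \<le> R")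
  case True
  have "(\<theta> - \<theta>') * x \<le> \<bar>\<theta>' - \<theta>\<bar> * R" using assms True by (intro mult_mono) auto
  then have "exp (- \<theta>' * x) \<le> exp (R * \<bar>\<theta>' - \<theta>\<bar> + - \<theta> * x)" by (simp add: algebra_simps)
  then have "exp (- \<theta>' * x) * (R - x) ^ 3 \<le> exp (R * \<bar>\<theta>' - \<theta>\<bar>) * exp (- \<theta> * x) * (R - x) ^ 3"
    unfolding exp_add using True by (intro mult_right_mono) auto
  then show ?thesis using True by (simp add: upper_test_def)
qed (simp add: upper_test_def)

lemma tan_quarter_bounds:
  assumes "0 \<le> x" "x \<le> 4 * arctan 2"
  shows "0 \<le> tan (x / 4)" "tan (x / 4) \<le> 2"
proof -
  have x: "0 \<le> x / 4" "x / 4 \<le> arctan 2" "x / 4 < pi / 2"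
    using assms arctan_ubound[of 2] by linarith+
  show "0 \<le> tan (x / 4)"
    using tan_mono_le[of 0 "x / 4"] x by simp
  show "tan (x / 4) \<le> 2"
    using tan_mono_le[of "x / 4" "arctan 2"] x arctan_ubound[of 2] by (simp add: tan_arctan)
qed

text \<open>The same exchange for the other test function; the factor 2 is the largest value of
  tan(x/4) on its support.\<close>

lemma lower_test_change:
  assumes "0 \<le> x"
  shows "exp (- 2 * \<bar>\<theta>' - \<theta>\<bar>) * lower_test \<theta> x \<le> lower_test \<theta>' x"
proof (cases "x \<le> 4 * arctan 2")
  case True
  define y where "y = tan (x / 4)"
  have y: "0 \<le> y" "y \<le> 2" using tan_quarter_bounds[OF assms True] by (auto simp: y_def)
  have "(\<theta>' - \<theta>) * y \<le> \<bar>\<theta>' - \<theta>\<bar> * 2" using y by (intro mult_mono) auto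
  then have "exp (- 2 * \<bar>\<theta>' - \<theta>\<bar> + - \<theta> * y) \<le> exp (- \<theta>' * y)" by (simp add: algebra_simps)
  then have "exp (- 2 * \<bar>\<theta>' - \<theta>\<bar>) * exp (- \<theta> * y) * (2 - y) ^ 3 \<le> exp (- \<theta>' * y) * (2 - y) ^ 3"
    unfolding exp_add using y by (intro mult_right_mono) auto
  then show ?thesis using True by (simp add: lower_test_def y_def)
qed (simp add: lower_test_def)

lemma lower_test_bounds:
  assumes "0 \<le> x" "0 \<le> \<theta>"
  shows "0 \<le> lower_test \<theta> x" "lower_test \<theta> x \<le> 8 * indicator {..4 * arctan 2} x"
proof -
  have "0 \<le> lower_test \<theta> x \<and> lower_test \<theta> x \<le> 8 * indicator {..4 * arctan 2} x"
  proof (cases "x \<le> 4 * arctan 2")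
    case True
    define y where "y = tan (x / 4)"
    have y: "0 \<le> y" "y \<le> 2" using tan_quarter_bounds[OF assms(1) True] by (auto simp: y_def)
    have "exp (- \<theta> * y) * (2 - y) ^ 3 \<le> 1 * 2 ^ 3"
      using y assms(2) by (intro mult_mono power_mono) auto
    then show ?thesis using True y by (simp add: lower_test_def flip: y_def)
  qed (simp add: lower_test_def)
  then show "0 \<le> lower_test \<theta> x" "lower_test \<theta> x \<le> 8 * indicator {..4 * arctan 2} x" by auto
qed

lemma borel_measurable_tests [measurable]:
  "upper_test R \<theta> \<in> borel_measurable borel" "lower_test \<theta> \<in> borel_measurable borel"
  unfolding upper_test_def lower_test_def tan_def by measurable

lemma upper_test_le: "0 \<le> x \<Longrightarrow> 0 \<le> \<theta> \<Longrightarrow> 0 \<le> R \<Longrightarrow> \<bar>upper_test R \<theta> x\<bar> \<le> R ^ 3"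
  by (auto simp: upper_test_def abs_mult intro!: mult_mono[of _ 1 _ "R ^ 3", simplified] power_mono)

section \<open>One time step for each test function, and the iteration over the grid\<close>

context carousel
begin

lemma upper_step:
  fixes m :: nat
  assumes st: "0 \<le> s" "s \<le> t" and a: "0 \<le> a" "\<And>u. s < u \<Longrightarrow> u \<le> t \<Longrightarrow> a \<le> f u"
    and m: "0 < m" and R: "R = 2 * pi * real m" and \<theta>: "\<theta> = lam * a / 4"
  shows "(\<integral>\<omega>. upper_test R \<theta> (alpha t \<omega>) \<partial>M)
    \<le> exp ((3 - lam\<^sup>2 * a\<^sup>2 / 8) * (t - s)) * (\<integral>\<omega>. upper_test R \<theta> (alpha s \<omega>) \<partial>M)"
proof -
  have Rpos: "0 < R" using m by (simp add: R)
  obtain g where g: "C2b g" "\<And>x. 0 \<le> x \<Longrightarrow> g x = upper_test R \<theta> x"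
    and g1: "\<And>x. 0 \<le> x \<Longrightarrow> x \<le> R \<Longrightarrow> deriv g x = - exp (- \<theta> * x) * (\<theta> * (R - x) ^ 3 + 3 * (R - x)\<^sup>2)"
    and g2: "\<And>x. 0 \<le> x \<Longrightarrow> x \<le> R \<Longrightarrow> deriv (deriv g) x = exp (- \<theta> * x) * (\<theta>\<^sup>2 * (R - x) ^ 3 + 6 * \<theta> * (R - x)\<^sup>2 + 6 * (R - x))"
    and g0: "\<And>x. R \<le> x \<Longrightarrow> g x = 0 \<and> deriv g x = 0 \<and> deriv (deriv g) x = 0"
    using upper_test_extension[OF Rpos, of \<theta>] by blast
  have gen_le: "gen g u x \<le> - (lam\<^sup>2 * a\<^sup>2 / 8 - 3) * g x" if u: "s < u" "u \<le> t" and x: "0 \<le> x" for u x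
  proof (cases "x \<le> R")
    case False
    then show ?thesis using g0[of x] by (simp add: gen_def)
  next
    case True
    define z where "z = R - x"
    define S where "S = (sin (x / 2))\<^sup>2"
    define E where "E = exp (- \<theta> * x)"
    have z: "0 \<le> z" using True by (simp add: z_def)
    have E: "0 < E" by (simp add: E_def)
    have S: "0 \<le> S" "S \<le> 1" by (auto simp: S_def abs_square_le_1)
    \<comment> \<open>\<open>R\<close> is a multiple of 2 pi, so the noise vanishes at the zero of
      the cubic factor: sin^2(x/2) is at most z^2/4.\<close>
    have "(x - 2 * pi * of_int (int m)) / 2 = - (z / 2)" by (simp add: z_def R field_simps)
    then have "S = (sin (- (z / 2)))\<^sup>2"
      using sin_half_shift[of x "int m"] by (metis S_def)
    also have "\<dots> \<le> (z / 2)\<^sup>2" using sin_sq_le[of "z / 2"] by simp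
    finally have S2: "4 * S \<le> z\<^sup>2" by (simp add: power_divide)
    have \<theta>0: "0 \<le> \<theta>" using lam_nonneg a(1) by (simp add: \<theta>)
    have lf: "4 * \<theta> \<le> lam * f u" using a(2)[OF u] lam_nonneg by (simp add: \<theta> mult_left_mono)
    \<comment> \<open>With lam f replaced by 4 \<theta>, the terms linear in \<theta> cancel: -12
      \<theta> z^2 from the drift against at most 12 \<theta> z^2 from the noise. The cubic factor
      then costs only 12 S z \<le> 3 z^3, the constant 3 in the rate, and 2 \<theta>^2 = lam^2 a^2/8
      remains.\<close>
    have "- (lam * f u) * (\<theta> * z ^ 3 + 3 * z\<^sup>2) \<le> - (4 * \<theta>) * (\<theta> * z ^ 3 + 3 * z\<^sup>2)"
      using lf z \<theta>0 by (intro mult_right_mono) auto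
    moreover have "2 * S * (\<theta>\<^sup>2 * z ^ 3) \<le> 2 * 1 * (\<theta>\<^sup>2 * z ^ 3)"
      using S z by (intro mult_mono) auto
    moreover have "2 * S * (6 * \<theta> * z\<^sup>2) \<le> 2 * 1 * (6 * \<theta> * z\<^sup>2)"
      using S z \<theta>0 by (intro mult_mono) auto
    moreover have "2 * S * (6 * z) = 3 * z * (4 * S)" by simp
    moreover have "3 * z * (4 * S) \<le> 3 * z * z\<^sup>2" using S2 z by (intro mult_left_mono) auto
    moreover have "3 * z * z\<^sup>2 = 3 * z ^ 3" by (simp add: power2_eq_square power3_eq_cube)
    ultimately have "- (lam * f u) * (\<theta> * z ^ 3 + 3 * z\<^sup>2) + 2 * S * (\<theta>\<^sup>2 * z ^ 3 + 6 * \<theta> * z\<^sup>2 + 6 * z)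
        \<le> 3 * z ^ 3 - 2 * (\<theta>\<^sup>2 * z ^ 3)"
      unfolding distrib_left by (simp add: power2_eq_square)
    also have "\<dots> = - (lam\<^sup>2 * a\<^sup>2 / 8 - 3) * z ^ 3"
      by (simp add: \<theta> power_divide power_mult_distrib algebra_simps)
    finally have "E * (- (lam * f u) * (\<theta> * z ^ 3 + 3 * z\<^sup>2) + 2 * S * (\<theta>\<^sup>2 * z ^ 3 + 6 * \<theta> * z\<^sup>2 + 6 * z))
        \<le> E * (- (lam\<^sup>2 * a\<^sup>2 / 8 - 3) * z ^ 3)" using E by (intro mult_left_mono) auto
    then show ?thesis
      unfolding gen_def g1[OF x True] g2[OF x True] g(2)[OF x] S_def[symmetric] E_def[symmetric] z_def[symmetric]
      using True by (simp add: upper_test_def E_def z_def algebra_simps)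
  qed
  have sp: "space M \<in> sets (F s)" using sets.top[of "F s"] by (simp add: space_F)
  have eq: "(\<integral>\<omega>. indicator (space M) \<omega> * g (alpha r \<omega>) \<partial>M) = (\<integral>\<omega>. upper_test R \<theta> (alpha r \<omega>) \<partial>M)" if "0 \<le> r" for r
  proof (rule integral_cong_AE)
    have [measurable]: "upper_test R \<theta> \<in> borel_measurable borel" unfolding upper_test_def by measurable
    show "(\<lambda>\<omega>. upper_test R \<theta> (alpha r \<omega>)) \<in> borel_measurable M" using that by measurable
    note [measurable] = C2b_borel(1)[OF g(1)]
    show "(\<lambda>\<omega>. indicator (space M) \<omega> * g (alpha r \<omega>)) \<in> borel_measurable M" using that by measurable
    show "AE \<omega> in M. indicator (space M) \<omega> * g (alpha r \<omega>) = upper_test R \<theta> (alpha r \<omega>)"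
      using alpha_nonneg[OF that] AE_space by eventually_elim (simp add: g(2))
  qed
  have "(\<integral>\<omega>. indicator (space M) \<omega> * g (alpha t \<omega>) \<partial>M)
     \<le> exp (- (lam\<^sup>2 * a\<^sup>2 / 8 - 3) * (t - s)) * (\<integral>\<omega>. indicator (space M) \<omega> * g (alpha s \<omega>) \<partial>M)"
  proof (rule gronwall_upper[OF g(1) st sp])
    fix u assume u: "s < u" "u \<le> t"
    have "AE \<omega> in M. 0 \<le> alpha u \<omega>" using u st by (intro alpha_nonneg) simp
    then show "AE \<omega> in M. \<omega> \<in> space M \<longrightarrow> gen g u (alpha u \<omega>) \<le> - (lam\<^sup>2 * a\<^sup>2 / 8 - 3) * g (alpha u \<omega>)"
      by eventually_elim (use gen_le[OF u] in blast)
  qed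
  then show ?thesis using eq st by simp
qed

text \<open>In the variable y = tan(x/4), and up to the common factor E, the terms in \<theta>^2 are
  (y^2/2) z^3 from the noise and -((1 + y^2)/2) z^3 from the drift. Their sum is free of y and gives
  lam^2 b^2/8; the terms of lower order need only \<open>2 * lam * b + 3\<close>.\<close>

lemma lower_step:
  assumes st: "0 \<le> s" "s \<le> t" and b: "\<And>u. s < u \<Longrightarrow> u \<le> t \<Longrightarrow> f u \<le> b" and b0: "0 \<le> b"
    and \<theta>: "\<theta> = lam * b / 2"
  shows "exp (- (lam\<^sup>2 * b\<^sup>2 / 8 + 2 * lam * b + 3) * (t - s)) * (\<integral>\<omega>. lower_test \<theta> (alpha s \<omega>) \<partial>M)
    \<le> (\<integral>\<omega>. lower_test \<theta> (alpha t \<omega>) \<partial>M)"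
proof -
  let ?k = "lam\<^sup>2 * b\<^sup>2 / 8 + 2 * lam * b + 3"
  obtain g where g: "C2b g" "\<And>x. 0 \<le> x \<Longrightarrow> g x = lower_test \<theta> x"
    and g1: "\<And>x y. 0 \<le> x \<Longrightarrow> x \<le> 4 * arctan 2 \<Longrightarrow> y = tan (x / 4) \<Longrightarrow>
      deriv g x = - exp (- \<theta> * y) * (\<theta> * (2 - y) ^ 3 + 3 * (2 - y)\<^sup>2) * ((1 + y\<^sup>2) / 4)"
    and g2: "\<And>x y. 0 \<le> x \<Longrightarrow> x \<le> 4 * arctan 2 \<Longrightarrow> y = tan (x / 4) \<Longrightarrow>
      deriv (deriv g) x = exp (- \<theta> * y) * ((\<theta>\<^sup>2 * (2 - y) ^ 3 + 6 * \<theta> * (2 - y)\<^sup>2 + 6 * (2 - y)) * (1 + y\<^sup>2)\<^sup>2 / 16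
        - (\<theta> * (2 - y) ^ 3 + 3 * (2 - y)\<^sup>2) * (y * (1 + y\<^sup>2) / 8))"
    and g0: "\<And>x. 4 * arctan 2 \<le> x \<Longrightarrow> g x = 0 \<and> deriv g x = 0 \<and> deriv (deriv g) x = 0"
    using lower_test_extension[of \<theta>] by blast
  have \<theta>0: "0 \<le> \<theta>" using lam_nonneg b0 by (simp add: \<theta>)
  have gen_ge: "- ?k * g x \<le> gen g u x" if u: "s < u" "u \<le> t" and x: "0 \<le> x" for u x
  proof (cases "x \<le> 4 * arctan 2")
    case False
    then show ?thesis using g0[of x] by (simp add: gen_def)
  next
    case True
    define y where "y = tan (x / 4)"
    define z where "z = 2 - y"
    define E where "E = exp (- \<theta> * y)"
    have E: "0 < E" by (simp add: E_def)
    have "0 \<le> x / 4" "x / 4 \<le> arctan 2" using x True by auto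
    then have x4: "- (pi / 2) < x / 4" "x / 4 < pi / 2" "0 \<le> x / 4"
      using arctan_ubound[of 2] pi_gt_zero by linarith+
    have cp: "0 < cos (x / 4)" using x4 by (intro cos_gt_zero_pi) auto
    have y0: "0 \<le> y" unfolding y_def tan_def using cp x4 sin_ge_zero[of "x / 4"] by simp
    have "x / 4 \<le> arctan 2" using True by simp
    then have "tan (x / 4) \<le> tan (arctan 2)" using x4 arctan_ubound[of 2] tan_mono_le[of "x / 4" "arctan 2"] by simp
    then have y2: "y \<le> 2" by (simp add: y_def tan_arctan)
    have z0: "0 \<le> z" using y2 by (simp add: z_def)
    have w: "0 < 1 + y\<^sup>2" by (simp add: add_pos_nonneg)
    \<comment> \<open>Half-angle substitution: sin(x/2) = 2y/(1 + y^2).\<close>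
    have sin: "(sin (x / 2))\<^sup>2 = 4 * y\<^sup>2 / (1 + y\<^sup>2)\<^sup>2"
    proof -
      have "1 + y\<^sup>2 = inverse ((cos (x / 4))\<^sup>2)" unfolding y_def using tan_sec[of "x / 4"] cp by (simp add: power_inverse)
      moreover have "sin (x / 2) = 2 * sin (x / 4) * cos (x / 4)" using sin_double[of "x / 4"] by simp
      ultimately show ?thesis unfolding y_def tan_def using cp by (simp add: power2_eq_square field_simps)
    qed
    have lf: "lam * f u \<le> 2 * \<theta>" using b[OF u] lam_nonneg by (simp add: \<theta> mult_left_mono)
    have W: "y ^ 3 / (1 + y\<^sup>2) \<le> y" using y0 w by (simp add: pos_divide_le_eq power2_eq_square power3_eq_cube algebra_simps)
    have P: "0 \<le> \<theta> * z ^ 3 + 3 * z\<^sup>2" using z0 \<theta>0 by simp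
    define Q where "Q = \<theta> * z ^ 3 + 3 * z\<^sup>2"
    define Q2 where "Q2 = \<theta>\<^sup>2 * z ^ 3 + 6 * \<theta> * z\<^sup>2 + 6 * z"
    have Q0: "0 \<le> Q" using P by (simp add: Q_def)
    have gen: "gen g u x = E * (y\<^sup>2 / 2 * Q2 - (lam * f u * (1 + y\<^sup>2) / 4 + y ^ 3 / (1 + y\<^sup>2)) * Q)"
    proof -
      have aux: "2 * (4 * y\<^sup>2 / W\<^sup>2) * (E * (Q2 * W\<^sup>2 / 16 - Q * (y * W / 8)))
        = E * (y\<^sup>2 / 2 * Q2 - y ^ 3 / W * Q)" if "W \<noteq> 0" for W
        using that by (simp add: field_simps power2_eq_square power3_eq_cube)
      have "2 * (4 * y\<^sup>2 / (1 + y\<^sup>2)\<^sup>2) * (E * (Q2 * (1 + y\<^sup>2)\<^sup>2 / 16 - Q * (y * (1 + y\<^sup>2) / 8)))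
        = E * (y\<^sup>2 / 2 * Q2 - y ^ 3 / (1 + y\<^sup>2) * Q)"
        by (rule aux) (use w in simp)
      note e1 = this
      have alg: "L * (- E * Q * (A / 4)) + E * (Y * Q2 - B * Q) = E * (Y * Q2 - (L * A / 4 + B) * Q)" for L A B Y :: real
        by (simp add: algebra_simps)
      show ?thesis
        unfolding gen_def sin g1[OF x True y_def] g2[OF x True y_def] E_def[symmetric] z_def[symmetric]
          Q_def[symmetric] Q2_def[symmetric] e1 alg ..
    qed
    have "(lam * f u * (1 + y\<^sup>2) / 4 + y ^ 3 / (1 + y\<^sup>2)) * Q \<le> (2 * \<theta> * (1 + y\<^sup>2) / 4 + y) * Q"
      using lf W w Q0 by (intro mult_right_mono add_mono divide_right_mono) auto
    moreover have "- ?k * z ^ 3 \<le> y\<^sup>2 / 2 * Q2 - (2 * \<theta> * (1 + y\<^sup>2) / 4 + y) * Q"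
    proof -
      have k: "?k = \<theta>\<^sup>2 / 2 + 4 * \<theta> + 3" by (simp add: \<theta> power_divide power_mult_distrib)
      \<comment> \<open>The terms in \<theta>^2 have cancelled against \<theta>^2/2. The constants 4
        \<theta> and 3 make the two remaining coefficients nonnegative for 0 \<le> y \<le> 2, which
        completing the square shows.\<close>
      have "y\<^sup>2 / 2 * Q2 - (2 * \<theta> * (1 + y\<^sup>2) / 4 + y) * Q + (\<theta>\<^sup>2 / 2 + 4 * \<theta> + 3) * z ^ 3
         = \<theta> * (z\<^sup>2 * ((4 - y) * z + 3 / 2 * (y\<^sup>2 - 1))) + 3 * z * (z\<^sup>2 - y * z + y\<^sup>2)"
        unfolding Q_def Q2_def by (simp add: field_simps power2_eq_square power3_eq_cube)
      also have "0 \<le> \<dots>"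
      proof -
        have "(4 - y) * z + 3 / 2 * (y\<^sup>2 - 1) = 5 / 2 * (y - 6 / 5)\<^sup>2 + 29 / 10"
          unfolding z_def by (simp add: field_simps power2_eq_square)
        then have p1: "0 \<le> (4 - y) * z + 3 / 2 * (y\<^sup>2 - 1)" by simp
        have "z\<^sup>2 - y * z + y\<^sup>2 = (z - y / 2)\<^sup>2 + 3 / 4 * y\<^sup>2" by (simp add: field_simps power2_eq_square)
        then have p2: "0 \<le> z\<^sup>2 - y * z + y\<^sup>2" by simp
        have "0 \<le> 3 * z" using z0 by simp
        from add_nonneg_nonneg[OF mult_nonneg_nonneg[OF \<theta>0 mult_nonneg_nonneg[OF zero_le_power2 p1]] mult_nonneg_nonneg[OF this p2]]
        show ?thesis .
      qed
      finally show ?thesis unfolding k mult_minus_left by linarith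
    qed
    ultimately have "- ?k * z ^ 3 \<le> y\<^sup>2 / 2 * Q2 - (lam * f u * (1 + y\<^sup>2) / 4 + y ^ 3 / (1 + y\<^sup>2)) * Q"
      by linarith
    then have "E * (- ?k * z ^ 3) \<le> gen g u x" unfolding gen using E by (intro mult_left_mono) auto
    moreover have "g x = E * z ^ 3" using g(2)[OF x] True by (simp add: lower_test_def E_def z_def y_def)
    ultimately show ?thesis by (simp add: ac_simps)
  qed
  have sp: "space M \<in> sets (F s)" using sets.top[of "F s"] by (simp add: space_F)
  have eq: "(\<integral>\<omega>. indicator (space M) \<omega> * g (alpha r \<omega>) \<partial>M) = (\<integral>\<omega>. lower_test \<theta> (alpha r \<omega>) \<partial>M)" if "0 \<le> r" for r
  proof (rule integral_cong_AE)
    have [measurable]: "lower_test \<theta> \<in> borel_measurable borel" unfolding lower_test_def tan_def by measurable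
    show "(\<lambda>\<omega>. lower_test \<theta> (alpha r \<omega>)) \<in> borel_measurable M" using that by measurable
    note [measurable] = C2b_borel(1)[OF g(1)]
    show "(\<lambda>\<omega>. indicator (space M) \<omega> * g (alpha r \<omega>)) \<in> borel_measurable M" using that by measurable
    show "AE \<omega> in M. indicator (space M) \<omega> * g (alpha r \<omega>) = lower_test \<theta> (alpha r \<omega>)"
      using alpha_nonneg[OF that] AE_space by eventually_elim (simp add: g(2))
  qed
  have "exp (- ?k * (t - s)) * (\<integral>\<omega>. indicator (space M) \<omega> * g (alpha s \<omega>) \<partial>M)
     \<le> (\<integral>\<omega>. indicator (space M) \<omega> * g (alpha t \<omega>) \<partial>M)"
  proof (rule gronwall_lower[OF g(1) st sp])
    fix u assume u: "s < u" "u \<le> t"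
    have "AE \<omega> in M. 0 \<le> alpha u \<omega>" using u st by (intro alpha_nonneg) simp
    then show "AE \<omega> in M. \<omega> \<in> space M \<longrightarrow> - ?k * g (alpha u \<omega>) \<le> gen g u (alpha u \<omega>)"
      by eventually_elim (use gen_ge[OF u] in blast)
  qed
  then show ?thesis using eq st by simp
qed

lemma integrable_upper_test:
  assumes "0 \<le> t" "0 \<le> \<theta>" "0 \<le> R"
  shows "integrable M (\<lambda>\<omega>. upper_test R \<theta> (alpha t \<omega>))"
proof (rule integrable_const_bound[of _ "R ^ 3"])
  show "AE \<omega> in M. norm (upper_test R \<theta> (alpha t \<omega>)) \<le> R ^ 3"
    using alpha_nonneg[OF assms(1)] by eventually_elim (use upper_test_le assms in simp)
qed (use assms in measurable)

lemma integrable_lower_test: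
  assumes "0 \<le> t" "0 \<le> \<theta>"
  shows "integrable M (\<lambda>\<omega>. lower_test \<theta> (alpha t \<omega>))"
proof (rule integrable_const_bound[of _ 8])
  show "AE \<omega> in M. norm (lower_test \<theta> (alpha t \<omega>)) \<le> 8"
    using alpha_nonneg[OF assms(1)]
  proof eventually_elim
    case (elim \<omega>)
    show ?case using lower_test_bounds[OF elim assms(2)] by (cases "alpha t \<omega> \<le> 4 * arctan 2") auto
  qed
qed (use assms in measurable)

text \<open>Markov's inequality for the test function at time n h: on the event it is at least
  \<open>q\<close>, while its mean starts from R^3 and is multiplied in each cell by the decay
  factor and by the cost of changing the exponent.\<close>

lemma prob_count_le:
  fixes k n :: nat and a :: "nat \<Rightarrow> real"
  assumes h: "0 < h" and a: "\<And>i. 0 \<le> a i"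
    and af: "\<And>i u. real i * h \<le> u \<Longrightarrow> u \<le> real (Suc i) * h \<Longrightarrow> a i \<le> f u"
    and R: "R = 2 * pi * real (k + 2)"
  shows "prob {\<omega> \<in> space M. carousel_count alpha \<omega> \<le> real k}
    \<le> (R / (2 * pi)) ^ 3 * exp (lam / 4 * a n * R + (\<Sum>i<n. R * (lam / 4 * \<bar>a (Suc i) - a i\<bar>) + (3 - lam\<^sup>2 * (a i)\<^sup>2 / 8) * h))"
proof -
  have Rpos: "0 < R" unfolding R by simp
  define \<theta> where "\<theta> = (\<lambda>i. lam * a i / 4)"
  have \<theta>0: "0 \<le> \<theta> i" for i using lam_nonneg a by (simp add: \<theta>_def)
  define U where "U = (\<lambda>i. \<integral>\<omega>. upper_test R (\<theta> i) (alpha (real i * h) \<omega>) \<partial>M)"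
  define w where "w = (\<lambda>i. R * (lam / 4 * \<bar>a (Suc i) - a i\<bar>) + (3 - lam\<^sup>2 * (a i)\<^sup>2 / 8) * h)"
  have g0: "0 \<le> real i * h" for i :: nat using h by simp
  have step: "U (Suc i) \<le> exp (w i) * U i" for i
  proof -
    have le: "real i * h \<le> real (Suc i) * h" using h by (intro mult_right_mono) auto
    have d: "\<bar>\<theta> (Suc i) - \<theta> i\<bar> = lam / 4 * \<bar>a (Suc i) - a i\<bar>"
    proof -
      have "\<theta> (Suc i) - \<theta> i = lam / 4 * (a (Suc i) - a i)" by (simp add: \<theta>_def algebra_simps)
      then show ?thesis unfolding \<open>\<theta> (Suc i) - \<theta> i = _\<close> abs_mult using lam_nonneg by simp
    qed
    let ?t = "real (Suc i) * h"
    have "U (Suc i) \<le> (\<integral>\<omega>. exp (R * \<bar>\<theta> (Suc i) - \<theta> i\<bar>) * upper_test R (\<theta> i) (alpha ?t \<omega>) \<partial>M)"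
      unfolding U_def
    proof (rule integral_mono_AE)
      show "AE \<omega> in M. upper_test R (\<theta> (Suc i)) (alpha ?t \<omega>) \<le> exp (R * \<bar>\<theta> (Suc i) - \<theta> i\<bar>) * upper_test R (\<theta> i) (alpha ?t \<omega>)"
        using alpha_nonneg[OF g0[of "Suc i"]] by eventually_elim (rule upper_test_change)
    qed (intro integrable_mult_right integrable_upper_test[OF g0 \<theta>0 less_imp_le[OF Rpos]])+
    also have "\<dots> = exp (R * (lam / 4 * \<bar>a (Suc i) - a i\<bar>)) * (\<integral>\<omega>. upper_test R (\<theta> i) (alpha ?t \<omega>) \<partial>M)"
      unfolding d by simp
    also have "(\<integral>\<omega>. upper_test R (\<theta> i) (alpha ?t \<omega>) \<partial>M) \<le> exp ((3 - lam\<^sup>2 * (a i)\<^sup>2 / 8) * (?t - real i * h)) * U i"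
      unfolding U_def
      by (rule upper_step[OF g0 le a _ _ R]) (use af in \<open>auto simp: \<theta>_def\<close>)
    also have "?t - real i * h = h" by (simp add: algebra_simps)
    finally show ?thesis by (simp add: w_def exp_add mult.assoc)
  qed
  have U0: "U 0 = R ^ 3"
  proof -
    have "U 0 = (\<integral>\<omega>. R ^ 3 \<partial>M)" unfolding U_def
      by (rule Bochner_Integration.integral_cong) (use Rpos in \<open>auto simp: alpha_0 upper_test_def\<close>)
    then show ?thesis by (simp add: prob_space)
  qed
  have Un: "U n \<le> R ^ 3 * exp (\<Sum>i<n. w i)" for n
  proof (induction n)
    case (Suc n)
    have "exp (w n) * U n \<le> exp (w n) * (R ^ 3 * exp (\<Sum>i<n. w i))" using Suc by (intro mult_left_mono) auto
    then have "U (Suc n) \<le> exp (w n) * (R ^ 3 * exp (\<Sum>i<n. w i))" by (rule order_trans[OF step])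
    then show ?case by (simp add: exp_add ac_simps)
  qed (simp add: U0)
  define T where "T = real n * h"
  have T: "0 \<le> T" using g0 by (simp add: T_def)
  define A where "A = {\<omega> \<in> space M. carousel_count alpha \<omega> \<le> real k}"
  have AM [measurable]: "A \<in> sets M" unfolding A_def by measurable
  define q where "q = exp (- \<theta> n * R) * (2 * pi) ^ 3"
  have q: "0 < q" by (simp add: q_def)
  have "q * prob A = (\<integral>\<omega>. q * indicator A \<omega> \<partial>M)" by simp
  also have "\<dots> \<le> U n" unfolding U_def T_def[symmetric]
  proof (rule integral_mono_AE)
    show "integrable M (\<lambda>\<omega>. q * indicator A \<omega>)"
      by (intro integrable_mult_right integrable_real_indicator AM) (simp add: less_top[symmetric])
    show "integrable M (\<lambda>\<omega>. upper_test R (\<theta> n) (alpha T \<omega>))"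
      by (rule integrable_upper_test[OF T \<theta>0]) (use Rpos in simp)
    show "AE \<omega> in M. q * indicator A \<omega> \<le> upper_test R (\<theta> n) (alpha T \<omega>)"
      using alpha_nonneg[OF T] count_le_imp_alpha_less[OF T, of k]
    proof eventually_elim
      case (elim \<omega>)
      show ?case
      proof (cases "\<omega> \<in> A")
        case True
        then have x: "alpha T \<omega> < 2 * pi * (real k + 1)" using elim(2) by (simp add: A_def)
        \<comment> \<open>This is why \<open>R\<close> is k + 2 turns and not k + 1: one full turn
          of distance bounds the cube below by (2 pi)^3, uniformly on the event.\<close>
        have r: "2 * pi \<le> R - alpha T \<omega>" using x unfolding R by (simp add: algebra_simps)
        then have xR: "alpha T \<omega> \<le> R" using pi_gt_zero by linarith
        have "q \<le> exp (- \<theta> n * alpha T \<omega>) * (R - alpha T \<omega>) ^ 3"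
          unfolding q_def using r xR \<theta>0[of n] by (intro mult_mono power_mono) (auto intro: mult_left_mono)
        then show ?thesis using True xR by (simp add: upper_test_def)
      qed (simp add: upper_test_nonneg)
    qed
  qed
  also have "U n \<le> R ^ 3 * exp (\<Sum>i<n. w i)" by (rule Un)
  finally have "prob A \<le> R ^ 3 * exp (\<Sum>i<n. w i) / q" using q by (simp add: pos_le_divide_eq mult.commute)
  also have "\<dots> = (R / (2 * pi)) ^ 3 * exp (\<theta> n * R + (\<Sum>i<n. w i))"
    by (simp add: q_def exp_minus exp_add power_divide divide_simps)
  finally show ?thesis by (simp add: A_def \<theta>_def w_def)
qed

text \<open>The bound is proved for the event of count zero. The subsolution keeps the path below 4
  arctan 2 up to time n h with the stated exponential probability, and from there it never completes
  a turn with conditional probability at least \<open>q\<close>.\<close>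

lemma prob_count_ge:
  fixes k n :: nat and b :: "nat \<Rightarrow> real"
  assumes h: "0 < h" and b: "\<And>i. 0 \<le> b i"
    and bf: "\<And>i u. real i * h \<le> u \<Longrightarrow> u \<le> real (Suc i) * h \<Longrightarrow> f u \<le> b i"
    and q: "0 \<le> q" "q \<le> 1 - (arctan (4 * arctan 2) + lam * c * (pi / 2 - arctan (real n * h))) / arctan (2 * pi)"
  shows "q * exp (- (\<Sum>i<n. lam * \<bar>b (Suc i) - b i\<bar> + (lam\<^sup>2 * (b i)\<^sup>2 / 8 + 2 * lam * b i + 3) * h))
    \<le> prob {\<omega> \<in> space M. carousel_count alpha \<omega> \<le> real k}"
proof -
  define \<theta> where "\<theta> = (\<lambda>i. lam * b i / 2)"
  have \<theta>0: "0 \<le> \<theta> i" for i using lam_nonneg b by (simp add: \<theta>_def)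
  define U where "U = (\<lambda>i. \<integral>\<omega>. lower_test (\<theta> i) (alpha (real i * h) \<omega>) \<partial>M)"
  define w where "w = (\<lambda>i. lam * \<bar>b (Suc i) - b i\<bar> + (lam\<^sup>2 * (b i)\<^sup>2 / 8 + 2 * lam * b i + 3) * h)"
  have g0: "0 \<le> real i * h" for i :: nat using h by simp
  have step: "exp (- w i) * U i \<le> U (Suc i)" for i
  proof -
    have le: "real i * h \<le> real (Suc i) * h" using h by (intro mult_right_mono) auto
    have d: "2 * \<bar>\<theta> (Suc i) - \<theta> i\<bar> = lam * \<bar>b (Suc i) - b i\<bar>"
    proof -
      have "2 * (\<theta> (Suc i) - \<theta> i) = lam * (b (Suc i) - b i)" by (simp add: \<theta>_def algebra_simps)
      then have "\<bar>2\<bar> * \<bar>\<theta> (Suc i) - \<theta> i\<bar> = \<bar>lam\<bar> * \<bar>b (Suc i) - b i\<bar>"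
        by (simp only: abs_mult[symmetric])
      then show ?thesis using lam_nonneg by simp
    qed
    let ?t = "real (Suc i) * h"
    let ?k = "lam\<^sup>2 * (b i)\<^sup>2 / 8 + 2 * lam * b i + 3"
    have "exp (- ?k * (?t - real i * h)) * U i \<le> (\<integral>\<omega>. lower_test (\<theta> i) (alpha ?t \<omega>) \<partial>M)"
      unfolding U_def by (rule lower_step[OF g0 le _ b]) (use bf in \<open>auto simp: \<theta>_def\<close>)
    also have "?t - real i * h = h" by (simp add: algebra_simps)
    finally have 1: "exp (- ?k * h) * U i \<le> (\<integral>\<omega>. lower_test (\<theta> i) (alpha ?t \<omega>) \<partial>M)" .
    have e: "- w i = - 2 * \<bar>\<theta> (Suc i) - \<theta> i\<bar> + - ?k * h"
      unfolding w_def d[symmetric] mult_minus_left by linarith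
    have "exp (- w i) * U i = exp (- 2 * \<bar>\<theta> (Suc i) - \<theta> i\<bar>) * (exp (- ?k * h) * U i)"
      unfolding e exp_add mult.assoc ..
    also have "\<dots> \<le> exp (- 2 * \<bar>\<theta> (Suc i) - \<theta> i\<bar>) * (\<integral>\<omega>. lower_test (\<theta> i) (alpha ?t \<omega>) \<partial>M)"
      using 1 by (intro mult_left_mono) auto
    also have "\<dots> = (\<integral>\<omega>. exp (- 2 * \<bar>\<theta> (Suc i) - \<theta> i\<bar>) * lower_test (\<theta> i) (alpha ?t \<omega>) \<partial>M)" by simp
    also have "\<dots> \<le> U (Suc i)"
      unfolding U_def
    proof (rule integral_mono_AE)
      show "AE \<omega> in M. exp (- 2 * \<bar>\<theta> (Suc i) - \<theta> i\<bar>) * lower_test (\<theta> i) (alpha ?t \<omega>) \<le> lower_test (\<theta> (Suc i)) (alpha ?t \<omega>)"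
        using alpha_nonneg[OF g0[of "Suc i"]] by eventually_elim (rule lower_test_change)
    qed (intro integrable_mult_right integrable_lower_test[OF g0 \<theta>0])+
    finally show ?thesis .
  qed
  have U0: "U 0 = 8"
  proof -
    have "U 0 = (\<integral>\<omega>. 8 \<partial>M)" unfolding U_def
      by (rule Bochner_Integration.integral_cong) (auto simp: alpha_0 lower_test_def)
    then show ?thesis by (simp add: prob_space)
  qed
  have Un: "8 * exp (- (\<Sum>i<n. w i)) \<le> U n" for n
  proof (induction n)
    case (Suc n)
    have "exp (- w n) * (8 * exp (- (\<Sum>i<n. w i))) \<le> exp (- w n) * U n" using Suc by (intro mult_left_mono) auto
    moreover have "exp (- w n) * (8 * exp (- (\<Sum>i<n. w i))) = 8 * exp (- (\<Sum>i<Suc n. w i))"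
      by (simp add: exp_diff exp_minus divide_inverse)
    ultimately show ?case using step[of n] by linarith
  qed (simp add: U0)
  define T where "T = real n * h"
  have T: "0 \<le> T" using g0 by (simp add: T_def)
  define A where "A = {\<omega> \<in> space M. alpha T \<omega> \<le> 4 * arctan 2}"
  have AM [measurable]: "A \<in> sets M" unfolding A_def using T by measurable
  \<comment> \<open>8 = (2 - 0)^3 is both the initial value and the maximum of the test function, so
    it cancels.\<close>
  have "U n \<le> (\<integral>\<omega>. 8 * indicator A \<omega> \<partial>M)" unfolding U_def T_def[symmetric]
  proof (rule integral_mono_AE)
    show "integrable M (\<lambda>\<omega>. 8 * indicat_real A \<omega>)"
      by (intro integrable_mult_right integrable_real_indicator AM) (simp add: less_top[symmetric])
    show "integrable M (\<lambda>\<omega>. lower_test (\<theta> n) (alpha T \<omega>))" by (rule integrable_lower_test[OF T \<theta>0])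
    show "AE \<omega> in M. lower_test (\<theta> n) (alpha T \<omega>) \<le> 8 * indicator A \<omega>"
      using alpha_nonneg[OF T] AE_space
    proof eventually_elim
      case (elim \<omega>)
      show ?case using lower_test_bounds(2)[OF elim(1) \<theta>0[of n]] elim(2) by (auto simp: A_def indicator_def)
    qed
  qed
  then have "U n \<le> 8 * prob A" by simp
  with Un[of n] have PA: "exp (- (\<Sum>i<n. w i)) \<le> prob A" by linarith
  have "q * exp (- (\<Sum>i<n. w i)) \<le> q * prob A" using PA q(1) by (rule mult_left_mono)
  also have "\<dots> \<le> prob A * (1 - (arctan (4 * arctan 2) + lam * c * (pi / 2 - arctan T)) / arctan (2 * pi))"
    using q(2) by (subst mult.commute) (rule mult_left_mono, auto simp: T_def)
  also have "\<dots> \<le> prob {\<omega> \<in> space M. carousel_count alpha \<omega> \<le> 0}"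
    unfolding A_def by (rule prob_count_zero_ge[OF T])
  also have "\<dots> \<le> prob {\<omega> \<in> space M. carousel_count alpha \<omega> \<le> real k}"
    by (rule finite_measure_mono) auto
  finally show ?thesis by (simp add: w_def)
qed

end

section \<open>The rate\<close>

text \<open>\<open>g\<close> is solved from the required equation. The lower bound makes
  \<open>P\<close> positive, so its logarithm can be taken, and the two bounds together give |g|
  \<le> C/lam.\<close>

lemma linear_bound_imp_rate:
  fixes P :: "real \<Rightarrow> real"
  assumes low: "\<And>lam. 1 \<le> lam \<Longrightarrow> exp (- lam\<^sup>2 * r - C * lam) \<le> P lam"
    and up: "\<And>lam. 1 \<le> lam \<Longrightarrow> P lam \<le> exp (- lam\<^sup>2 * r + C * lam)"
  shows "\<exists>g :: real \<Rightarrow> real. (g \<longlongrightarrow> 0) at_top \<and> (\<forall>\<^sub>F lam in at_top. P lam = exp (- lam\<^sup>2 * (r + g lam)))"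
proof (intro exI conjI)
  define g where "g = (\<lambda>lam. - ln (P lam) / lam\<^sup>2 - r)"
  have pos: "0 < P lam" if "1 \<le> lam" for lam using low[OF that] exp_gt_zero less_le_trans by blast
  have g_le: "\<bar>g lam\<bar> \<le> C / lam" if l: "1 \<le> lam" for lam
  proof -
    have "- lam\<^sup>2 * r - C * lam \<le> ln (P lam)" using low[OF l] pos[OF l] by (simp add: ln_ge_iff)
    moreover have "ln (P lam) \<le> - lam\<^sup>2 * r + C * lam"
      using up[OF l] pos[OF l] by (metis ln_exp ln_le_cancel_iff exp_gt_zero)
    ultimately have "\<bar>- ln (P lam) - lam\<^sup>2 * r\<bar> \<le> C * lam" by linarith
    then have "\<bar>- ln (P lam) - lam\<^sup>2 * r\<bar> / lam\<^sup>2 \<le> C * lam / lam\<^sup>2" by (rule divide_right_mono) simp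
    moreover have "g lam = (- ln (P lam) - lam\<^sup>2 * r) / lam\<^sup>2" using l by (simp add: g_def diff_divide_distrib)
    ultimately show ?thesis using l by (simp add: power2_eq_square)
  qed
  have "((\<lambda>lam. C / lam) \<longlongrightarrow> 0) at_top" by (rule tendsto_divide_0[OF tendsto_const filterlim_at_top_imp_at_infinity[OF filterlim_ident]])
  then show "(g \<longlongrightarrow> 0) at_top"
    by (rule Lim_null_comparison[rotated]) (use g_le in \<open>auto simp: eventually_at_top_linorder intro!: exI[of _ 1]\<close>)
  show "\<forall>\<^sub>F lam in at_top. P lam = exp (- lam\<^sup>2 * (r + g lam))"
    using eventually_ge_at_top[of 1]
  proof eventually_elim
    case (elim lam)
    have "- lam\<^sup>2 * (r + g lam) = ln (P lam)" using elim by (simp add: g_def)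
    then show ?case using pos[OF elim] by simp
  qed
qed

theorem mainTheorem7:
  fixes f :: "real \<Rightarrow> real" and c :: real and k :: nat
    and M :: "real \<Rightarrow> 'a measure" and F :: "real \<Rightarrow> real \<Rightarrow> 'a measure"
    and alpha :: "real \<Rightarrow> real \<Rightarrow> 'a \<Rightarrow> real"
  assumes f_nonneg: "\<And>t. t \<ge> 0 \<Longrightarrow> f t \<ge> 0"
    and f_bound: "\<And>t. t \<ge> 0 \<Longrightarrow> f t \<le> c / (1 + t\<^sup>2)"
    and f_tv: "finite_total_variation_nonneg f"
    and sol: "\<And>lam. carousel_sde_solution f lam (M lam) (F lam) (alpha lam)"
  shows "\<exists>g :: real \<Rightarrow> real. (g \<longlongrightarrow> 0) at_top \<and>
    (\<forall>\<^sub>F lam in at_top.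
       prob_space.prob (M lam) {\<omega> \<in> space (M lam). carousel_count (alpha lam) \<omega> \<le> real k}
       = exp (- lam\<^sup>2 * ((LBINT t:{0..}. (f t)\<^sup>2) / 8 + g lam)))"
proof -
  obtain V B where V: "\<And>t. 0 \<le> t \<Longrightarrow> 0 \<le> V t" "\<And>t. 0 \<le> t \<Longrightarrow> V t \<le> (B::real)"
    "\<And>s t. 0 \<le> s \<Longrightarrow> s \<le> t \<Longrightarrow> \<bar>f t - f s\<bar> \<le> V t - V s"
    by (rule finite_total_variation_majorant[OF f_tv], rule that)
  have B0: "0 \<le> B" using V(1,2)[of 0] by simp
  have c0: "0 \<le> c" using f_nonneg[of 0] f_bound[of 0] by simp
  define N where "N = (LBINT t:{0..}. (f t)\<^sup>2)"
  define R where "R = 2 * pi * real (k + 2)"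
  have R0: "0 < R" by (simp add: R_def)
  \<comment> \<open>Half of the distance between arctan(4 arctan 2) and arctan(2 pi) may be used up
    by the drift after the horizon. The other half gives the probability \<open>q\<close>, which
    does not depend on lam.\<close>
  define gap where "gap = (arctan (2 * pi) - arctan (4 * arctan 2)) / 2"
  have gap: "0 < gap" unfolding gap_def using arctan_ubound[of 2] by (simp add: arctan_less_iff)
  define q where "q = gap / arctan (2 * pi)"
  have at: "0 < arctan (2 * pi)" by simp
  have q0: "0 < q" using gap at by (simp add: q_def)
  \<comment> \<open>At horizon at least K lam the drift still to come is at most c/K, hence at most
    \<open>gap\<close>.\<close>
  obtain K :: nat where K: "1 \<le> K" "c \<le> gap * real K"
  proof -
    obtain K0 :: nat where "c / gap \<le> real K0" using real_arch_simple by blast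
    then have "c \<le> gap * real K0" using gap by (simp add: pos_divide_le_eq mult.commute)
    also have "\<dots> \<le> gap * real (Suc K0)" using gap by simp
    finally show thesis using that[of "Suc K0"] by simp
  qed
  \<comment> \<open>Each summand is the coefficient of lam in one error: the prefactor, the last
    exponent, the changes of exponent, the rate 3 up to time at most 2 K lam, and the replacement of
    the step sum by the integral. In \<open>C2\<close> the fourth summand comes from the linear term
    2 lam b.\<close>
  define C1 where "C1 = \<bar>ln ((R / (2 * pi)) ^ 3)\<bar> + c / 4 * R + R * (3 / 4 * B) + 6 * real K + (4 * c * B + c\<^sup>2) / 8"
  define C2 where "C2 = \<bar>ln q\<bar> + 3 * B + 2 * B * (2 * c + B) / 8 + 2 * (c * pi / 2 + 2 * B) + 6 * real K"
  define C where "C = max C1 C2"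
  have main: "exp (- lam\<^sup>2 * (N / 8) - C * lam) \<le> prob_space.prob (M lam) {\<omega> \<in> space (M lam). carousel_count (alpha lam) \<omega> \<le> real k}
     \<and> prob_space.prob (M lam) {\<omega> \<in> space (M lam). carousel_count (alpha lam) \<omega> \<le> real k} \<le> exp (- lam\<^sup>2 * (N / 8) + C * lam)"
    if l: "1 \<le> lam" for lam
  proof -
    have l0: "0 \<le> lam" "0 < lam" using l by auto
    interpret carousel f c lam "M lam" "F lam" "alpha lam"
      by unfold_locales (use sol l0 f_nonneg f_bound borel_measurable_of_variation_majorant[OF V(3)] in auto)
    \<comment> \<open>The mesh 1/m, of order 1/lam, makes lam^2 h at most lam;
      \<open>K * m^2\<close> cells then reach the horizon K m, which lies between K lam and 2 K
      lam.\<close>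
    define m where "m = nat \<lceil>lam\<rceil>"
    have m: "lam \<le> real m" "real m \<le> 2 * lam" "0 < real m" using l unfolding m_def by linarith+
    define h where "h = 1 / real m"
    have h: "0 < h" "h \<le> 1" "lam * h \<le> 1" using m l by (auto simp: h_def)
    define n where "n = K * m\<^sup>2"
    have nh: "real n * h = real K * real m" using m by (simp add: n_def h_def power2_eq_square)
    have K1: "1 \<le> real K" using K(1) by simp
    have T: "lam \<le> real n * h" "real n * h \<le> 2 * real K * lam" "0 < real n * h"
      unfolding nh using mult_mono[of 1 "real K" lam "real m"] mult_left_mono[OF m(2), of "real K"] K1 m l0
      by (auto simp: mult_ac)
    have tail: "pi / 2 - arctan (real n * h) \<le> 1 / (real K * lam)"
    proof -
      have "pi / 2 - arctan (real n * h) \<le> 1 / (real n * h)" by (rule arctan_tail_le[OF T(3)])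
      also have "\<dots> \<le> 1 / (real K * lam)" unfolding nh
        using K1 l0 m by (intro divide_left_mono mult_left_mono mult_pos_pos) auto
      finally show ?thesis .
    qed
    obtain a b :: "nat \<Rightarrow> real" where
      a: "\<And>i. 0 \<le> a i" "\<And>i. a i \<le> c" and b: "\<And>i. 0 \<le> b i"
      and af: "\<And>i u. real i * h \<le> u \<Longrightarrow> u \<le> real (Suc i) * h \<Longrightarrow> a i \<le> f u"
      and bf: "\<And>i u. real i * h \<le> u \<Longrightarrow> u \<le> real (Suc i) * h \<Longrightarrow> f u \<le> b i"
      and av: "\<And>n. (\<Sum>i<n. \<bar>a (Suc i) - a i\<bar>) \<le> 3 * B" and bv: "\<And>n. (\<Sum>i<n. \<bar>b (Suc i) - b i\<bar>) \<le> 3 * B"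
      and a2: "\<And>n. (LBINT u:{0..}. (f u)\<^sup>2) \<le> (\<Sum>i<n. h * (a i)\<^sup>2) + 4 * c * B * h + c\<^sup>2 * (pi / 2 - arctan (real n * h))"
      and b2: "\<And>n. (\<Sum>i<n. h * (b i)\<^sup>2) \<le> (LBINT u:{0..}. (f u)\<^sup>2) + 2 * B * (2 * c + B) * h"
      and b1: "\<And>n. (\<Sum>i<n. h * b i) \<le> c * pi / 2 + 2 * B * h"
      by (rule step_envelopes[OF f_nonneg f_bound V h(1)], assumption+, rule that)
    let ?P = "prob {\<omega> \<in> space (M lam). carousel_count (alpha lam) \<omega> \<le> real k}"
    have lam_sq: "lam \<le> lam\<^sup>2" using l by (simp add: power2_eq_square)
    have lh: "lam\<^sup>2 * h \<le> lam" using mult_left_mono[OF h(3) l0(1)] by (simp add: power2_eq_square mult.assoc)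
    have upper: "?P \<le> exp (- lam\<^sup>2 * (N / 8) + C1 * lam)"
    proof -
      let ?S = "\<Sum>i<n. R * (lam / 4 * \<bar>a (Suc i) - a i\<bar>) + (3 - lam\<^sup>2 * (a i)\<^sup>2 / 8) * h"
      have S: "?S = R * lam / 4 * (\<Sum>i<n. \<bar>a (Suc i) - a i\<bar>) + 3 * (real n * h) - lam\<^sup>2 / 8 * (\<Sum>i<n. h * (a i)\<^sup>2)"
        by (simp add: sum.distrib sum_subtractf sum_distrib_left left_diff_distrib algebra_simps)
      have s1: "R * lam / 4 * (\<Sum>i<n. \<bar>a (Suc i) - a i\<bar>) \<le> R * lam / 4 * (3 * B)"
        using av[of n] R0 l0 by (intro mult_left_mono) auto
      have s2: "lam\<^sup>2 / 8 * (N - 4 * c * B * h - c\<^sup>2 * (1 / lam)) \<le> lam\<^sup>2 / 8 * (\<Sum>i<n. h * (a i)\<^sup>2)"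
      proof (rule mult_left_mono)
        have "1 / (real K * lam) \<le> 1 / lam" using K1 l0 by (intro divide_left_mono) auto
        then have "c\<^sup>2 * (pi / 2 - arctan (real n * h)) \<le> c\<^sup>2 * (1 / lam)" using tail by (intro mult_left_mono) auto
        then show "N - 4 * c * B * h - c\<^sup>2 * (1 / lam) \<le> (\<Sum>i<n. h * (a i)\<^sup>2)" using a2[of n] unfolding N_def by linarith
      qed simp
      have s3: "lam\<^sup>2 / 8 * (4 * c * B * h + c\<^sup>2 * (1 / lam)) \<le> (4 * c * B + c\<^sup>2) / 8 * lam"
      proof -
        have "4 * c * B * (lam\<^sup>2 * h) \<le> 4 * c * B * lam" using lh c0 B0 by (intro mult_left_mono) auto
        moreover have "lam\<^sup>2 * (c\<^sup>2 * (1 / lam)) = c\<^sup>2 * lam" using l0 by (simp add: power2_eq_square)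
        ultimately show ?thesis by (simp add: algebra_simps)
      qed
      have s4: "lam / 4 * a n * R \<le> c / 4 * R * lam"
        using mult_left_mono[OF a(2)[of n], of "lam / 4 * R"] l0 R0 by (simp add: mult_ac)
      have s5: "\<bar>ln ((R / (2 * pi)) ^ 3)\<bar> \<le> \<bar>ln ((R / (2 * pi)) ^ 3)\<bar> * lam" using l by (simp add: mult_le_cancel_left1)
      have "?P \<le> (R / (2 * pi)) ^ 3 * exp (lam / 4 * a n * R + ?S)"
        by (rule prob_count_le[OF h(1) a(1) af R_def])
      also have "\<dots> = exp (ln ((R / (2 * pi)) ^ 3) + (lam / 4 * a n * R + ?S))"
        using R0 by (simp add: exp_add)
      also have "ln ((R / (2 * pi)) ^ 3) + (lam / 4 * a n * R + ?S) \<le> - lam\<^sup>2 * (N / 8) + C1 * lam"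
      proof -
        have "ln ((R / (2 * pi)) ^ 3) \<le> \<bar>ln ((R / (2 * pi)) ^ 3)\<bar> * lam" using s5 by linarith
        moreover have "3 * (real n * h) \<le> 6 * real K * lam" using T(2) by linarith
        moreover have "lam\<^sup>2 / 8 * (N - 4 * c * B * h - c\<^sup>2 * (1 / lam)) = lam\<^sup>2 * (N / 8) - lam\<^sup>2 / 8 * (4 * c * B * h + c\<^sup>2 * (1 / lam))"
          by (simp add: algebra_simps)
        moreover have "C1 * lam = \<bar>ln ((R / (2 * pi)) ^ 3)\<bar> * lam + c / 4 * R * lam + R * lam / 4 * (3 * B)
            + 6 * real K * lam + (4 * c * B + c\<^sup>2) / 8 * lam"
          by (simp add: C1_def algebra_simps)
        ultimately show ?thesis unfolding S using s1 s2 s3 s4 by linarith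
      qed
      finally show ?thesis by simp
    qed
    have lower: "exp (- lam\<^sup>2 * (N / 8) - C2 * lam) \<le> ?P"
    proof -
      let ?S = "\<Sum>i<n. lam * \<bar>b (Suc i) - b i\<bar> + (lam\<^sup>2 * (b i)\<^sup>2 / 8 + 2 * lam * b i + 3) * h"
      have S: "?S = lam * (\<Sum>i<n. \<bar>b (Suc i) - b i\<bar>) + lam\<^sup>2 / 8 * (\<Sum>i<n. h * (b i)\<^sup>2) + 2 * lam * (\<Sum>i<n. h * b i) + 3 * (real n * h)"
        by (simp add: sum.distrib sum_distrib_left algebra_simps)
      have s1: "lam * (\<Sum>i<n. \<bar>b (Suc i) - b i\<bar>) \<le> lam * (3 * B)"
        using bv[of n] l0 by (intro mult_left_mono) auto
      have s2: "lam\<^sup>2 / 8 * (\<Sum>i<n. h * (b i)\<^sup>2) \<le> lam\<^sup>2 / 8 * (N + 2 * B * (2 * c + B) * h)"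
        using b2[of n] unfolding N_def by (rule mult_left_mono) simp
      have s3: "2 * B * (2 * c + B) * (lam\<^sup>2 * h) \<le> 2 * B * (2 * c + B) * lam"
        using lh c0 B0 by (intro mult_left_mono) auto
      have s4: "2 * lam * (\<Sum>i<n. h * b i) \<le> 2 * lam * (c * pi / 2 + 2 * B)"
      proof (rule mult_left_mono)
        have "2 * B * h \<le> 2 * B * 1" using h B0 by (intro mult_left_mono) auto
        then show "(\<Sum>i<n. h * b i) \<le> c * pi / 2 + 2 * B" using b1[of n] by linarith
      qed (use l0 in simp)
      have q1: "q \<le> 1 - (arctan (4 * arctan 2) + lam * c * (pi / 2 - arctan (real n * h))) / arctan (2 * pi)"
      proof -
        have "lam * c * (pi / 2 - arctan (real n * h)) \<le> lam * c * (1 / (real K * lam))"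
          using tail l0 c0 by (intro mult_left_mono) auto
        also have "\<dots> = c / real K" using l0 by simp
        also have "\<dots> \<le> gap" using K K1 by (simp add: pos_divide_le_eq)
        finally have "arctan (4 * arctan 2) + lam * c * (pi / 2 - arctan (real n * h)) \<le> arctan (2 * pi) - gap"
          unfolding gap_def by (simp add: field_simps)
        then have "(arctan (4 * arctan 2) + lam * c * (pi / 2 - arctan (real n * h))) / arctan (2 * pi) \<le> (arctan (2 * pi) - gap) / arctan (2 * pi)"
          using at by (intro divide_right_mono) auto
        also have "\<dots> = 1 - q" using at by (simp add: q_def diff_divide_distrib)
        finally show ?thesis by linarith
      qed
      have expo: "- lam\<^sup>2 * (N / 8) - C2 * lam \<le> ln q - ?S"
      proof -
        have "- \<bar>ln q\<bar> * lam \<le> ln q"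
        proof -
          have "\<bar>ln q\<bar> * 1 \<le> \<bar>ln q\<bar> * lam" using l by (intro mult_left_mono) auto
          then show ?thesis by linarith
        qed
        moreover have "3 * (real n * h) \<le> 6 * real K * lam" using T(2) by linarith
        moreover have "lam\<^sup>2 / 8 * (N + 2 * B * (2 * c + B) * h) = lam\<^sup>2 * (N / 8) + (2 * B * (2 * c + B) * (lam\<^sup>2 * h)) / 8"
          by (simp add: algebra_simps)
        moreover have "C2 * lam = \<bar>ln q\<bar> * lam + lam * (3 * B) + (2 * B * (2 * c + B) * lam) / 8 + 2 * lam * (c * pi / 2 + 2 * B) + 6 * real K * lam"
          by (simp add: C2_def algebra_simps)
        ultimately show ?thesis unfolding S using s1 s2 s3 s4 by linarith
      qed
      have eq: "exp (ln q - s) = q * exp (- s)" for s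
        using q0 by (simp add: exp_diff exp_minus divide_inverse)
      from expo have "exp (- lam\<^sup>2 * (N / 8) - C2 * lam) \<le> exp (ln q - ?S)" by (rule exp_le_cancel_iff[THEN iffD2])
      also have "\<dots> = q * exp (- ?S)" by (rule eq)
      also have "\<dots> \<le> ?P"
        by (rule prob_count_ge[OF h(1) b bf less_imp_le[OF q0] q1])
      finally show ?thesis .
    qed
    have "C1 * lam \<le> C * lam" "C2 * lam \<le> C * lam" using l0 by (auto simp: C_def)
    then have "exp (- lam\<^sup>2 * (N / 8) + C1 * lam) \<le> exp (- lam\<^sup>2 * (N / 8) + C * lam)"
      "exp (- lam\<^sup>2 * (N / 8) - C * lam) \<le> exp (- lam\<^sup>2 * (N / 8) - C2 * lam)" by auto
    then show ?thesis using upper lower by linarith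
  qed
  show ?thesis
    by (rule linear_bound_imp_rate[of "N / 8" C, unfolded N_def]) (use main in \<open>auto simp: N_def\<close>)
qed

end
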